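(* Let $(S_k,\,k\ge0)$, $S_0=0$, be a random walk with i.i.d. increments of density $\frac12e^{-|x|}$, let $\tau^-:=\inf\{k\ge 1:S_k<0\}$, $\nu:=\tau^--1$, and let $0=M_0<M_1<\cdots<M_\nu$ be the order statistics of $\{S_0,S_1,\ldots,S_\nu\}$. Then $\{M_0,\ldots,M_\nu\}$ has the same joint distribution as if it were constructed as follows: $M_0=0$ and, for $k=1,2,\ldots$, $M_k$ is the time of the $k^{th}$ birth or death or mark generated by the critical binary birth and death process $(Z(t/2),\,t\ge0)$, that is $$M_k:=\text{the } k^{th}\ t>0 \text{ such that } Z\left(\tfrac t2\right)-Z\left(\tfrac{t-}2\right)=\pm1\ \text{ or }\ N_{\mathrm{marks}}(t)-N_{\mathrm{marks}}(t-)=1,$$ with $Z(0)$ having the Bernoulli$(1/2)$ distribution on $\{0,1\}$, and $$N_{\mathrm{marks}}(t):=N\left(\int_0^tZ(v/2)\,dv\right),\qquad t\ge0,$$ the Cox process with intensity $Z(t/2)$ at time $t$ derived from $Z$ and an independent standard (rate $1$) Poisson process $N$. Here $\nu$ corresponds to the total number of such times. Consequently, the probability generating function of $\nu$ is $$\mathbb{E}z^\nu=z^{-1}\left(1-\sqrt{1-z}\right).$$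
   Context: $(Z(t),\,t\ge0)$ is the number of individuals alive at time $t$ in a critical binary branching process: starting from $Z(0)$ individuals, each individual lives an exponential lifetime with mean $1/2$ and at its end, according to an independent fair coin toss, leaves either $0$ or $2$ children; all individuals evolve independently according to the same mechanism. Thus $Z$ is a birth and death process on $\{0,1,2,\ldots\}$ with transitions $j\to j+1$ at rate $j$ and $j\to j-1$ at rate $j$, absorbed at $0$. *)

theory Defs
  imports "HOL-Probability.Probability"
begin

section \<open>The random walk up to its first strictly negative value\<close>

definition walk :: "(nat \<Rightarrow> 'a \<Rightarrow> real) \<Rightarrow> nat \<Rightarrow> 'a \<Rightarrow> real" where
  "walk X k \<omega> = (\<Sum>i<k. X i \<omega>)"

text \<open>If the walk never becomes negative (a null event for the walks considered here), the
  infimum over the empty set of naturals is the junk value 0.\<close>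

definition tau_minus :: "(nat \<Rightarrow> 'a \<Rightarrow> real) \<Rightarrow> 'a \<Rightarrow> nat" where
  "tau_minus X \<omega> = Inf {k. 1 \<le> k \<and> walk X k \<omega> < 0}"

definition walk_nu :: "(nat \<Rightarrow> 'a \<Rightarrow> real) \<Rightarrow> 'a \<Rightarrow> nat" where
  "walk_nu X \<omega> = tau_minus X \<omega> - 1"

definition walk_order_stat :: "(nat \<Rightarrow> 'a \<Rightarrow> real) \<Rightarrow> nat \<Rightarrow> 'a \<Rightarrow> real" where
  "walk_order_stat X k \<omega> = sort (map (\<lambda>j. walk X j \<omega>) [0..<Suc (walk_nu X \<omega>)]) ! k"


section \<open>The critical binary branching process\<close>

text \<open>Individuals carry Ulam--Harris labels: \<open>(i, w)\<close> is the descendant of the \<open>i\<close>-th initial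
  individual reached by following the word \<open>w\<close> of child numbers. \<open>L\<close> gives lifetimes and \<open>K\<close>
  numbers of children, which are born at the end of the parent's life.\<close>

type_synonym indiv = "nat \<times> nat list"

definition ever_born :: "nat \<Rightarrow> (indiv \<Rightarrow> nat) \<Rightarrow> indiv \<Rightarrow> bool" where
  "ever_born z K u \<longleftrightarrow>
     fst u < z \<and> (\<forall>k < length (snd u). snd u ! k < K (fst u, take k (snd u)))"

definition birth_time :: "(indiv \<Rightarrow> real) \<Rightarrow> indiv \<Rightarrow> real" where
  "birth_time L u = (\<Sum>k < length (snd u). L (fst u, take k (snd u)))"

definition alive :: "nat \<Rightarrow> (indiv \<Rightarrow> real) \<Rightarrow> (indiv \<Rightarrow> nat) \<Rightarrow> real \<Rightarrow> indiv set" where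
  "alive z L K t = {u. ever_born z K u \<and> birth_time L u \<le> t \<and> t < birth_time L u + L u}"

text \<open>The library's \<open>indep_var\<close> needs both variables to have the same type; this is the
  heterogeneous version.\<close>

definition indep_rv ::
    "'a measure \<Rightarrow> 'b measure \<Rightarrow> ('a \<Rightarrow> 'b) \<Rightarrow> 'c measure \<Rightarrow> ('a \<Rightarrow> 'c) \<Rightarrow> bool" where
  "indep_rv Q S X T Y \<longleftrightarrow>
     X \<in> Q \<rightarrow>\<^sub>M S \<and> Y \<in> Q \<rightarrow>\<^sub>M T \<and>
     prob_space.indep_set Q {X -` A \<inter> space Q | A. A \<in> sets S} {Y -` B \<inter> space Q | B. B \<in> sets T}"

text \<open>\<open>exponential_density 2\<close> has rate 2, that is, mean 1/2. The law of \<open>Z 0\<close> is left free.\<close>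

definition critical_binary_branching :: "'a measure \<Rightarrow> (real \<Rightarrow> 'a \<Rightarrow> nat) \<Rightarrow> bool" where
  "critical_binary_branching Q Z \<longleftrightarrow>
     prob_space Q \<and> (\<forall>t\<ge>0. Z t \<in> Q \<rightarrow>\<^sub>M count_space UNIV) \<and>
     (\<exists>(L :: indiv \<Rightarrow> 'a \<Rightarrow> real) (K :: indiv \<Rightarrow> 'a \<Rightarrow> nat).
        (\<forall>u. distributed Q lborel (L u) (exponential_density 2)) \<and>
        (\<forall>u. distr Q (count_space UNIV) (K u) = measure_pmf (pmf_of_set {0, 2})) \<and>
        (\<forall>u. indep_rv Q borel (L u) (count_space UNIV) (K u)) \<and>
        prob_space.indep_vars Q (\<lambda>_. borel \<Otimes>\<^sub>M count_space UNIV) (\<lambda>u \<omega>. (L u \<omega>, K u \<omega>)) UNIV \<and>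
        indep_rv Q (count_space UNIV) (Z 0)
          (\<Pi>\<^sub>M u\<in>UNIV. borel \<Otimes>\<^sub>M count_space UNIV) (\<lambda>\<omega> u. (L u \<omega>, K u \<omega>)) \<and>
        (AE \<omega> in Q. \<forall>t\<ge>0. Z t \<omega> = card (alive (Z 0 \<omega>) (\<lambda>u. L u \<omega>) (\<lambda>u. K u \<omega>) t)))"


section \<open>Marks and event times\<close>

text \<open>The standard Poisson process as the counting process of points with i.i.d. standard
  exponential spacings; the \<open>n\<close>-th point (counting from 0) is \<open>\<Sum>i\<le>n. E i\<close>.\<close>

definition standard_poisson_process :: "'a measure \<Rightarrow> (real \<Rightarrow> 'a \<Rightarrow> nat) \<Rightarrow> bool" where
  "standard_poisson_process Q N \<longleftrightarrow>
     prob_space Q \<and> (\<forall>t\<ge>0. N t \<in> Q \<rightarrow>\<^sub>M count_space UNIV) \<and>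
     (\<exists>E :: nat \<Rightarrow> 'a \<Rightarrow> real.
        prob_space.indep_vars Q (\<lambda>_. borel) E UNIV \<and>
        (\<forall>i. distributed Q lborel (E i) (exponential_density 1)) \<and>
        (AE \<omega> in Q. \<forall>t\<ge>0. N t \<omega> = card {n. (\<Sum>i\<le>n. E i \<omega>) \<le> t}))"

definition indep_processes ::
    "'a measure \<Rightarrow> (real \<Rightarrow> 'a \<Rightarrow> nat) \<Rightarrow> (real \<Rightarrow> 'a \<Rightarrow> nat) \<Rightarrow> bool" where
  "indep_processes Q Z N \<longleftrightarrow>
     prob_space.indep_var Q
       (\<Pi>\<^sub>M t\<in>{0..}. count_space UNIV) (\<lambda>\<omega>. \<lambda>t\<in>{0..}. Z t \<omega>)
       (\<Pi>\<^sub>M t\<in>{0..}. count_space UNIV) (\<lambda>\<omega>. \<lambda>t\<in>{0..}. N t \<omega>)"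

definition N_marks ::
    "(real \<Rightarrow> 'a \<Rightarrow> nat) \<Rightarrow> (real \<Rightarrow> 'a \<Rightarrow> nat) \<Rightarrow> real \<Rightarrow> 'a \<Rightarrow> nat" where
  "N_marks Z N t \<omega> = N (LBINT v:{0..t}. real (Z (v / 2) \<omega>)) \<omega>"

definition jump :: "(real \<Rightarrow> real) \<Rightarrow> real \<Rightarrow> real" where
  "jump f t = f t - Lim (at_left t) f"

definition event_times ::
    "(real \<Rightarrow> 'a \<Rightarrow> nat) \<Rightarrow> (real \<Rightarrow> 'a \<Rightarrow> nat) \<Rightarrow> 'a \<Rightarrow> real set" where
  "event_times Z N \<omega> =
     {t. 0 < t \<and> (jump (\<lambda>s. real (Z (s / 2) \<omega>)) t \<in> {1, -1} \<or>
                  jump (\<lambda>s. real (N_marks Z N s \<omega>)) t = 1)}"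

text \<open>The \<open>k\<close>-th element of a set of reals, \<open>k \<ge> 1\<close>. Infinite sets have \<open>card\<close> 0, so
  \<open>card {s \<in> A. s \<le> t} = k\<close> forces finiteness.\<close>

definition kth_element :: "real set \<Rightarrow> nat \<Rightarrow> real" where
  "kth_element A k = (THE t. t \<in> A \<and> card {s \<in> A. s \<le> t} = k)"

definition event_time ::
    "(real \<Rightarrow> 'a \<Rightarrow> nat) \<Rightarrow> (real \<Rightarrow> 'a \<Rightarrow> nat) \<Rightarrow> nat \<Rightarrow> 'a \<Rightarrow> real" where
  "event_time Z N k \<omega> = (if k = 0 then 0 else kth_element (event_times Z N \<omega>) k)"

definition event_count ::
    "(real \<Rightarrow> 'a \<Rightarrow> nat) \<Rightarrow> (real \<Rightarrow> 'a \<Rightarrow> nat) \<Rightarrow> 'a \<Rightarrow> nat" where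
  "event_count Z N \<omega> = card (event_times Z N \<omega>)"


section \<open>Finite sequences of random length\<close>

text \<open>The finite sequence \<open>m 0, \<dots>, m n\<close> is encoded by its index \<open>n\<close> together with the
  infinite sequence obtained by padding with zeros.\<close>

definition fin_seq :: "nat \<Rightarrow> (nat \<Rightarrow> real) \<Rightarrow> nat \<times> (nat \<Rightarrow> real)" where
  "fin_seq n m = (n, \<lambda>k. if k \<le> n then m k else 0)"

definition fin_seq_space :: "(nat \<times> (nat \<Rightarrow> real)) measure" where
  "fin_seq_space = count_space UNIV \<Otimes>\<^sub>M (\<Pi>\<^sub>M k\<in>UNIV. borel)"

definition walk_seq :: "(nat \<Rightarrow> 'a \<Rightarrow> real) \<Rightarrow> 'a \<Rightarrow> nat \<times> (nat \<Rightarrow> real)" where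
  "walk_seq X \<omega> = fin_seq (walk_nu X \<omega>) (\<lambda>k. walk_order_stat X k \<omega>)"

definition event_seq ::
    "(real \<Rightarrow> 'a \<Rightarrow> nat) \<Rightarrow> (real \<Rightarrow> 'a \<Rightarrow> nat) \<Rightarrow> 'a \<Rightarrow> nat \<times> (nat \<Rightarrow> real)" where
  "event_seq Z N \<omega> = fin_seq (event_count Z N \<omega>) (\<lambda>k. event_time Z N k \<omega>)"

text \<open>\<open>Z\<close> and \<open>N\<close> have regular paths only almost surely, so \<open>event_seq\<close> is a random
  variable only up to null sets; its law is therefore taken on \<open>completion Q\<close>. Measurability is
  part of the notion because \<open>distr\<close> is meaningless for non-measurable functions.\<close>

definition same_law ::
    "'a measure \<Rightarrow> ('a \<Rightarrow> 'c) \<Rightarrow> 'b measure \<Rightarrow> ('b \<Rightarrow> 'c) \<Rightarrow> 'c measure \<Rightarrow> bool" where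
  "same_law P f Q g S \<longleftrightarrow>
     f \<in> completion P \<rightarrow>\<^sub>M S \<and> g \<in> completion Q \<rightarrow>\<^sub>M S \<and>
     distr (completion P) S f = distr (completion Q) S g"

end

theory Submission
  imports Defs
begin

text \<open>
  The law of a finite random set \<open>C\<close> of positive reals is determined by the functionals
  \<open>E (\<Prod>x\<in>C. f x)\<close> for decreasing step functions \<open>1 - f\<close> of bounded support, because these are the
  joint generating functions of the counts \<open>card (C \<inter> {..t})\<close>.

  For the walk, cut the excursion at its minimum \<open>m\<close>: both pieces are again excursions above \<open>m\<close>, so
  the functional \<open>W t\<close> of an excursion above level \<open>t\<close> solves
  \<open>W t = 1 / 2 + (\<integral>m\<ge>t. exp (- 2 * (m - t)) * f m * (W m)\<^sup>2)\<close>. With constant \<open>f = z\<close> this is the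
  quadratic equation behind the generating function of \<open>\<nu>\<close>.

  For the branching process, integrating out the Poisson process turns the marks into the killing
  factor \<open>exp (- (\<integral>t. (1 - f t) * Z (t / 2)))\<close>, which is multiplicative over individuals. The branching
  property gives an integral equation for the functional \<open>V t\<close> of one individual born at time \<open>t\<close>.
  Both \<open>V\<close> and \<open>2 * W - 1\<close> satisfy \<open>V' = 2 * V - f * (1 + V)\<^sup>2 / 2\<close> and equal 1 beyond the
  support of \<open>1 - f\<close>, so they coincide, and \<open>1 / 2 + V 0 / 2 = W 0\<close> is the functional started from a Bernoulli number of
  individuals.
\<close>

section \<open>Excursions above a level and the decomposition at the minimum\<close>

text \<open>The cut at the minimum is exact because of a coincidence of the Laplace law: from
  \<open>y \<ge> m\<close> the probability of a step below \<open>m\<close> equals the density of a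
  step landing at \<open>m\<close>, both being \<open>exp (- (y - m)) / 2\<close>. So a path piece
  that ends at the minimum weighs as much as an excursion above it, and both pieces have the same
  form. The product functional does not see the order in which the walk visits its points. This is
  why an unordered excursion can be matched with events that come in increasing time order. The two
  functionals are compared backwards from the end of the support of \<open>1 - f\<close>. On the
  walk side the terminal value 1 expresses that the excursion ends almost surely. On the branching
  side it is immediate, and extinction enters where the functional is identified with a product over
  a finite family. Step functions jump, so the differential equation holds only off a finite set,
  and uniqueness is proved for the integrated equations.\<close>

text \<open>For \<open>x \<ge> t\<close> this is the expectation of \<open>\<Prod>k=1..n. f (S k)\<close> for the walk started at \<open>x\<close>, on the
  event that the first \<open>n\<close> steps stay at or above \<open>t\<close> and the next one falls below \<open>t\<close>. Values at
  \<open>x < t\<close> are not probabilities, but the decomposition at the minimum needs them: a path may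
  start below the minimum of its later points.\<close>

fun excursion_weight :: "(real \<Rightarrow> ennreal) \<Rightarrow> nat \<Rightarrow> real \<Rightarrow> real \<Rightarrow> ennreal" where
  "excursion_weight f 0 t x = ennreal (1 / 2 * exp (- \<bar>x - t\<bar>))"
| "excursion_weight f (Suc n) t x =
     (\<integral>\<^sup>+y. ennreal (1 / 2 * exp (- \<bar>x - y\<bar>)) * (if t \<le> y then f y * excursion_weight f n t y else 0) \<partial>lborel)"

lemma measurable_excursion_weight:
  assumes [measurable]: "f \<in> borel_measurable borel"
  shows "(\<lambda>(t, x). excursion_weight f n t x) \<in> borel_measurable (borel \<Otimes>\<^sub>M borel)"
proof (induction n)
  case 0
  show ?case by (simp add: case_prod_beta)
next
  case (Suc n)
  have [measurable (raw)]: "(\<lambda>p. excursion_weight f n (g p) (h p)) \<in> borel_measurable M"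
    if "g \<in> borel_measurable M" "h \<in> borel_measurable M" for g h and M :: "'z measure"
    using measurable_compose[OF measurable_Pair[OF that] Suc] by simp
  show ?case
    by (simp add: case_prod_beta)
qed

lemma measurable_excursion_weight' [measurable (raw)]:
  assumes "f \<in> borel_measurable borel" "g \<in> borel_measurable M" "h \<in> borel_measurable M"
  shows "(\<lambda>x. excursion_weight f n (g x) (h x)) \<in> borel_measurable M"
  using measurable_compose[OF measurable_Pair[OF assms(2,3)] measurable_excursion_weight[OF assms(1), of n]] by simp

text \<open>The exponential tails make the kernel multiplicative across an intermediate level: a
  step that has to cross \<open>t\<close> upwards forgets where below \<open>t\<close> it
  began.\<close>

lemma laplace_kernel_split:
  assumes "x \<le> t" "t \<le> y"
  shows "ennreal (1 / 2 * exp (- \<bar>x - y\<bar>)) = ennreal (exp (- (t - x))) * ennreal (1 / 2 * exp (- \<bar>t - y\<bar>))"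
proof -
  have "1 / 2 * exp (- \<bar>x - y\<bar>) = exp (- (t - x)) * (1 / 2 * exp (- \<bar>t - y\<bar>))"
    using assms by (simp flip: exp_add)
  then show ?thesis by (subst ennreal_mult[symmetric]) (simp_all only: exp_ge_zero, simp_all)
qed

text \<open>Only the first step sees the starting point. It leads to a point above \<open>t\<close>
  or, for \<open>n = 0\<close>, carries the formal value at \<open>t\<close>; in both cases the
  kernel splits at \<open>t\<close>.\<close>

lemma excursion_weight_below:
  assumes [measurable]: "f \<in> borel_measurable borel" and "x \<le> t"
  shows "excursion_weight f n t x = ennreal (exp (- (t - x))) * excursion_weight f n t t"
proof (cases n)
  case 0
  with assms(2) show ?thesis using laplace_kernel_split[of x t t] by simp
next
  case (Suc m)
  show ?thesis unfolding Suc excursion_weight.simps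
    by (subst nn_integral_cmult[symmetric], measurable)
       (intro nn_integral_cong, simp add: laplace_kernel_split[OF assms(2)] mult.assoc del: times_divide_eq_left mult_1)
qed

text \<open>Decomposition at the minimum \<open>m\<close> of the \<open>n + 1\<close> visited
  points, with \<open>i\<close> points before it and \<open>n - i\<close> after it. The closing
  weight of the first piece is read as the density of landing at \<open>m\<close>. The second piece
  starts at \<open>m\<close> and ends with a step below \<open>m\<close>, which goes below
  \<open>t\<close> with conditional probability \<open>exp (- (m - t))\<close> by lack of memory.
  The minimum may lie above \<open>x\<close>, since the start is not a visited point.\<close>

lemma excursion_weight_Suc:
  assumes [measurable]: "f \<in> borel_measurable borel" and "t \<le> x"
  shows "excursion_weight f (Suc n) t x =
    (\<integral>\<^sup>+m. (if t \<le> m then ennreal (exp (- (m - t))) * f m *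
      (\<Sum>i\<le>n. excursion_weight f i m x * excursion_weight f (n - i) m m) else 0) \<partial>lborel)"
  using assms(2)
proof (induction n arbitrary: t x)
  case 0
  show ?case unfolding excursion_weight.simps
  proof (intro nn_integral_cong)
    fix y :: real
    have "ennreal (1 / 2 * exp (- \<bar>y - t\<bar>)) = ennreal (exp (- (y - t))) * ennreal (1 / 2 * exp (- \<bar>y - y\<bar>))" if "t \<le> y"
      using laplace_kernel_split[OF that order.refl] by (metis abs_minus_commute)
    moreover have "p * (if t \<le> y then F * a else 0) = (if t \<le> y then e * F * (p * h) else 0)" if "t \<le> y \<Longrightarrow> a = e * h" for a e h p F :: ennreal
    proof (cases "t \<le> y")
      case True
      show ?thesis unfolding that[OF True] by (simp add: True mult_ac)
    qed simp
    moreover have "(\<Sum>i\<le>0. excursion_weight f i y x * excursion_weight f (0 - i) y y) = excursion_weight f 0 y x * excursion_weight f 0 y y"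
      by (simp only: atMost_0 sum.insert finite.emptyI empty_iff sum.empty add_0_right diff_zero not_False_eq_True)
    ultimately show "ennreal (1 / 2 * exp (- \<bar>x - y\<bar>)) * (if t \<le> y then f y * ennreal (1 / 2 * exp (- \<bar>y - t\<bar>)) else 0) =
      (if t \<le> y then ennreal (exp (- (y - t))) * f y *
        (\<Sum>i\<le>0. excursion_weight f i y x * excursion_weight f (0 - i) y y) else 0)"
      by (simp only: excursion_weight.simps(1))
  qed
next
  case (Suc n)
  define k where "k x y = ennreal (1 / 2 * exp (- \<bar>x - y\<bar>))" for x y :: real
  define S where "S m y = (\<Sum>i\<le>n. excursion_weight f i m y * excursion_weight f (n - i) m m)" for m y
  define e where "e t m = ennreal (exp (- (m - t)))" for t m :: real
  have [measurable]: "case_prod k \<in> borel_measurable (borel \<Otimes>\<^sub>M borel)"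
    "case_prod e \<in> borel_measurable (borel \<Otimes>\<^sub>M borel)"
    unfolding k_def e_def by measurable
  have [measurable]: "case_prod S \<in> borel_measurable (borel \<Otimes>\<^sub>M borel)"
    unfolding S_def by measurable
  have IH: "excursion_weight f (Suc n) t x = (\<integral>\<^sup>+m. (if t \<le> m then e t m * f m * S m x else 0) \<partial>lborel)" if "t \<le> x" for t x
    using Suc.IH[OF that] by (simp only: S_def e_def)
  \<comment> \<open>Seen from the first visited point \<open>y\<close>, the later points either have
    their minimum at some \<open>m \<le> y\<close> or all stay above \<open>y\<close>. In the second
    case \<open>y\<close> itself becomes the minimum, which will be the summand
    \<open>i = 0\<close>.\<close>
  have split: "excursion_weight f (Suc n) t y =
      (\<integral>\<^sup>+m. (if t \<le> m \<and> m \<le> y then e t m * f m * S m y else 0) \<partial>lborel) + e t y * excursion_weight f (Suc n) y y"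
    if "t \<le> y" for y
  proof -
    have "e t y * excursion_weight f (Suc n) y y = (\<integral>\<^sup>+m. (if y \<le> m then e t m * f m * S m y else 0) \<partial>lborel)"
      unfolding IH[OF order.refl]
    proof (subst nn_integral_cmult[symmetric], measurable, intro nn_integral_cong)
      fix m
      have "e t y * e y m = e t m"
        unfolding e_def by (simp flip: ennreal_mult exp_add)
      then show "e t y * (if y \<le> m then e y m * f m * S m y else 0) = (if y \<le> m then e t m * f m * S m y else 0)"
        by (simp flip: mult.assoc)
    qed
    also have "\<dots> = (\<integral>\<^sup>+m. (if y < m then e t m * f m * S m y else 0) \<partial>lborel)"
    proof (rule nn_integral_cong_AE)
      show "AE m in lborel. (if y \<le> m then e t m * f m * S m y else 0) = (if y < m then e t m * f m * S m y else 0)"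
        using AE_lborel_singleton[of y] by eventually_elim simp
    qed
    finally have *: "e t y * excursion_weight f (Suc n) y y = \<dots>" .
    show ?thesis unfolding * IH[OF that]
      by (subst nn_integral_add[symmetric], measurable)
         (intro nn_integral_cong, use that in simp)
  qed
  have "excursion_weight f (Suc (Suc n)) t x =
     (\<integral>\<^sup>+y. k x y * (if t \<le> y then f y * excursion_weight f (Suc n) t y else 0) \<partial>lborel)"
    by (subst excursion_weight.simps) (simp only: k_def)
  also have "\<dots> = (\<integral>\<^sup>+y. (\<integral>\<^sup>+m. (if t \<le> m \<and> m \<le> y then e t m * f m * (k x y * (f y * S m y)) else 0) \<partial>lborel)
     + (if t \<le> y then e t y * f y * (k x y * excursion_weight f (Suc n) y y) else 0) \<partial>lborel)"
  proof (intro nn_integral_cong)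
    fix y :: real
    show "k x y * (if t \<le> y then f y * excursion_weight f (Suc n) t y else 0) =
      (\<integral>\<^sup>+m. (if t \<le> m \<and> m \<le> y then e t m * f m * (k x y * (f y * S m y)) else 0) \<partial>lborel)
     + (if t \<le> y then e t y * f y * (k x y * excursion_weight f (Suc n) y y) else 0)"
    proof (cases "t \<le> y")
      case True
      have "k x y * (f y * (\<integral>\<^sup>+m. (if t \<le> m \<and> m \<le> y then e t m * f m * S m y else 0) \<partial>lborel)) =
        (\<integral>\<^sup>+m. k x y * (f y * (if t \<le> m \<and> m \<le> y then e t m * f m * S m y else 0)) \<partial>lborel)"
        by (subst nn_integral_cmult, measurable)+
      also have "\<dots> = (\<integral>\<^sup>+m. (if t \<le> m \<and> m \<le> y then e t m * f m * (k x y * (f y * S m y)) else 0) \<partial>lborel)"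
        by (intro nn_integral_cong) (simp add: ac_simps)
      finally show ?thesis
        using True by (simp add: split distrib_left del: excursion_weight.simps) (simp add: ac_simps del: excursion_weight.simps)
    next
      case False
      then have "(if t \<le> m \<and> m \<le> y then z else 0 :: ennreal) = 0" for m z by auto
      with False show ?thesis by simp
    qed
  qed
  also have "\<dots> = (\<integral>\<^sup>+y. (\<integral>\<^sup>+m. (if t \<le> m \<and> m \<le> y then e t m * f m * (k x y * (f y * S m y)) else 0) \<partial>lborel) \<partial>lborel)
     + (\<integral>\<^sup>+y. (if t \<le> y then e t y * f y * (k x y * excursion_weight f (Suc n) y y) else 0) \<partial>lborel)"
    by (intro nn_integral_add) measurable
  also have "(\<integral>\<^sup>+y. (\<integral>\<^sup>+m. (if t \<le> m \<and> m \<le> y then e t m * f m * (k x y * (f y * S m y)) else 0) \<partial>lborel) \<partial>lborel)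
    = (\<integral>\<^sup>+m. (\<integral>\<^sup>+y. (if t \<le> m \<and> m \<le> y then e t m * f m * (k x y * (f y * S m y)) else 0) \<partial>lborel) \<partial>lborel)"
    by (intro lborel_pair.Fubini') measurable
  \<comment> \<open>For fixed \<open>m\<close>, integrating over the first point
    \<open>y \<ge> m\<close> prepends a step to the first piece, so \<open>i\<close> becomes
    \<open>Suc i\<close> while the second piece keeps its length.\<close>
  also have "\<dots> = (\<integral>\<^sup>+m. (if t \<le> m then e t m * f m * (\<Sum>i\<le>n. excursion_weight f (Suc i) m x * excursion_weight f (n - i) m m) else 0) \<partial>lborel)"
  proof (intro nn_integral_cong)
    fix m
    have "(\<Sum>i\<le>n. excursion_weight f (Suc i) m x * excursion_weight f (n - i) m m) =
      (\<Sum>i\<le>n. \<integral>\<^sup>+y. k x y * (if m \<le> y then f y * excursion_weight f i m y else 0) * excursion_weight f (n - i) m m \<partial>lborel)"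
      by (simp add: k_def nn_integral_multc)
    also have "\<dots> = (\<integral>\<^sup>+y. (\<Sum>i\<le>n. k x y * (if m \<le> y then f y * excursion_weight f i m y else 0) * excursion_weight f (n - i) m m) \<partial>lborel)"
      by (subst nn_integral_sum) measurable
    also have "\<dots> = (\<integral>\<^sup>+y. (if m \<le> y then k x y * (f y * S m y) else 0) \<partial>lborel)"
      by (intro nn_integral_cong) (simp add: S_def sum_distrib_left mult.assoc)
    finally have *: "(\<Sum>i\<le>n. excursion_weight f (Suc i) m x * excursion_weight f (n - i) m m) = \<dots>" .
    show "(\<integral>\<^sup>+y. (if t \<le> m \<and> m \<le> y then e t m * f m * (k x y * (f y * S m y)) else 0) \<partial>lborel) =
      (if t \<le> m then e t m * f m * (\<Sum>i\<le>n. excursion_weight f (Suc i) m x * excursion_weight f (n - i) m m) else 0)"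
      unfolding * by (cases "t \<le> m") (simp_all add: nn_integral_cmult[symmetric] if_distrib cong: if_cong)
  qed
  also have "\<dots> + (\<integral>\<^sup>+y. (if t \<le> y then e t y * f y * (k x y * excursion_weight f (Suc n) y y) else 0) \<partial>lborel) =
    (\<integral>\<^sup>+m. (if t \<le> m then e t m * f m * (\<Sum>i\<le>n. excursion_weight f (Suc i) m x * excursion_weight f (n - i) m m) else 0)
     + (if t \<le> m then e t m * f m * (k x m * excursion_weight f (Suc n) m m) else 0) \<partial>lborel)"
    by (intro nn_integral_add[symmetric]) measurable
  also have "\<dots> = (\<integral>\<^sup>+m. (if t \<le> m then ennreal (exp (- (m - t))) * f m *
      (\<Sum>i\<le>Suc n. excursion_weight f i m x * excursion_weight f (Suc n - i) m m) else 0) \<partial>lborel)"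
    by (intro nn_integral_cong, subst sum.atMost_Suc_shift)
       (simp add: k_def e_def distrib_left del: excursion_weight.simps(2))
  finally show ?case .
qed

text \<open>At \<open>x = t\<close> the discount appears twice: once for climbing from
  \<open>t\<close> to the level of the minimum, once for the final fall from below \<open>m\<close>
  to below \<open>t\<close>. Hence the rate 2.\<close>

lemma excursion_weight_diag_Suc:
  assumes [measurable]: "f \<in> borel_measurable borel"
  shows "excursion_weight f (Suc n) t t =
    (\<integral>\<^sup>+m. (if t \<le> m then ennreal (exp (- 2 * (m - t))) * f m *
      (\<Sum>i\<le>n. excursion_weight f i m m * excursion_weight f (n - i) m m) else 0) \<partial>lborel)"
proof -
  have "ennreal (exp (- (m - t))) * f m * (\<Sum>i\<le>n. excursion_weight f i m t * excursion_weight f (n - i) m m) =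
    ennreal (exp (- 2 * (m - t))) * f m * (\<Sum>i\<le>n. excursion_weight f i m m * excursion_weight f (n - i) m m)" if "t \<le> m" for m
  proof -
    have "(\<Sum>i\<le>n. excursion_weight f i m t * excursion_weight f (n - i) m m) =
      ennreal (exp (- (m - t))) * (\<Sum>i\<le>n. excursion_weight f i m m * excursion_weight f (n - i) m m)"
      by (simp add: sum_distrib_left excursion_weight_below[OF assms that] mult.assoc)
    moreover have "ennreal (exp (- 2 * (m - t))) = ennreal (exp (- (m - t))) * ennreal (exp (- (m - t)))"
      by (simp flip: ennreal_mult exp_add)
    ultimately show ?thesis by (simp add: ac_simps)
  qed
  then show ?thesis unfolding excursion_weight_Suc[OF assms order.refl] by (intro nn_integral_cong) simp
qed

section \<open>The law of the excursion length and its generating function\<close>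

lemma nn_integral_exp_tail:
  fixes t :: real
  shows "(\<integral>\<^sup>+m. (if t \<le> m then ennreal (exp (- 2 * (m - t))) else 0) \<partial>lborel) = ennreal (1 / 2)"
proof -
  have "(\<integral>\<^sup>+m. ennreal (exp (- 2 * (m - t))) * indicator {t..} m \<partial>lborel) = ennreal (0 - (- 1 / 2 * exp (- 2 * (t - t))))"
  proof (rule nn_integral_FTC_atLeast[where F = "\<lambda>m. - 1 / 2 * exp (- 2 * (m - t))"])
    show "((\<lambda>m. - 1 / 2 * exp (- 2 * (m - t))) \<longlongrightarrow> 0) at_top"
    proof -
      have "filterlim (\<lambda>m::real. - t + m) at_top at_top"
        by (rule filterlim_tendsto_add_at_top[OF tendsto_const filterlim_ident])
      moreover have "(\<lambda>m::real. - t + m) = (\<lambda>m. m - t)" by auto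
      ultimately have "filterlim (\<lambda>m. m - t) at_top at_top" by (simp only:)
      then have "filterlim (\<lambda>m. - 2 * (m - t)) at_bot at_top"
        by (intro filterlim_tendsto_neg_mult_at_bot[OF tendsto_const]) simp_all
      then show ?thesis
        by (intro tendsto_mult_right_zero filterlim_compose[OF exp_at_bot])
    qed
  qed (auto intro!: derivative_eq_intros)
  moreover have "(if t \<le> m then ennreal (exp (- 2 * (m - t))) else 0) = ennreal (exp (- 2 * (m - t))) * indicator {t..} m" for m
    by simp
  ultimately show ?thesis by simp
qed

text \<open>The closed form is the Catalan number of index \<open>n\<close> divided by
  \<open>2 ^ (2 * n + 1)\<close>. The factor 1/2 in the recursion is the integral of the rate 2
  exponential in \<open>excursion_weight_diag_Suc\<close>.\<close>

fun excursion_prob :: "nat \<Rightarrow> real" where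
  "excursion_prob 0 = 1 / 2"
| "excursion_prob (Suc n) = 1 / 2 * (\<Sum>i\<le>n. excursion_prob i * excursion_prob (n - i))"

lemma excursion_prob_nonneg [simp]: "0 \<le> excursion_prob n"
  by (induction n rule: excursion_prob.induct) (auto intro!: sum_nonneg)

text \<open>A partial sum \<open>s\<close> is followed by at most \<open>1 / 2 + s * s / 2\<close>,
  because the index triangle lies in a square, and 1 is a fixed point of this map.\<close>

lemma sum_excursion_prob_le_1: "(\<Sum>i<n. excursion_prob i) \<le> 1"
proof (induction n)
  case (Suc n)
  have "(\<Sum>i<Suc n. excursion_prob i) = 1 / 2 + 1 / 2 * (\<Sum>k<n. \<Sum>i\<le>k. excursion_prob i * excursion_prob (k - i))"
    by (subst sum.lessThan_Suc_shift) (simp add: sum_distrib_left)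
  also have "(\<Sum>k<n. \<Sum>i\<le>k. excursion_prob i * excursion_prob (k - i)) = (\<Sum>(i, j)\<in>{(i, j). i + j < n}. excursion_prob i * excursion_prob j)"
    by (rule sum.triangle_reindex[symmetric])
  also have "\<dots> \<le> (\<Sum>(i, j)\<in>{..<n} \<times> {..<n}. excursion_prob i * excursion_prob j)"
    by (intro sum_mono2) auto
  also have "\<dots> = (\<Sum>i<n. excursion_prob i) * (\<Sum>i<n. excursion_prob i)"
    by (simp add: sum_product sum.cartesian_product)
  also have "\<dots> \<le> 1 * 1"
    using Suc by (intro mult_mono sum_nonneg) auto
  finally show ?case by simp
qed simp

lemma summable_excursion_prob: "summable excursion_prob"
  by (rule bounded_imp_summable[where B = 1]) (use sum_excursion_prob_le_1[of "Suc _"] in \<open>auto simp: lessThan_Suc_atMost\<close>)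

text \<open>The recursion makes the shifted series a Cauchy square. The bound
  \<open>norm F \<le> 1\<close> is recorded because it selects the root of the quadratic
  equation.\<close>

lemma excursion_pgf_equation:
  fixes z :: complex
  assumes "norm z \<le> 1"
  defines "F \<equiv> \<Sum>n. of_real (excursion_prob n) * z ^ n"
  shows "summable (\<lambda>n. norm (of_real (excursion_prob n) * z ^ n))"
    and "F = 1 / 2 + 1 / 2 * z * F\<^sup>2"
    and "norm F \<le> 1"
proof -
  let ?a = "\<lambda>n. of_real (excursion_prob n) * z ^ n"
  have le: "norm (?a n) \<le> excursion_prob n" for n
    using mult_left_mono[OF power_le_one[OF norm_ge_zero assms(1), of n] excursion_prob_nonneg[of n]]
    by (simp add: norm_mult norm_power)
  show s: "summable (\<lambda>n. norm (?a n))"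
    by (rule summable_comparison_test'[OF summable_excursion_prob, of 0]) (use le in auto)
  have "(\<Sum>n. norm (?a n)) \<le> 1"
    by (rule suminf_le_const[OF s], rule order.trans[OF sum_mono[OF le] sum_excursion_prob_le_1])
  then show "norm F \<le> 1"
    unfolding F_def using summable_norm[OF s] by linarith
  have "F = ?a 0 + (\<Sum>n. ?a (Suc n))"
    unfolding F_def using suminf_split_head[OF summable_norm_cancel[OF s]] by simp
  also have "(\<lambda>n. ?a (Suc n)) = (\<lambda>n. 1 / 2 * z * (\<Sum>i\<le>n. ?a i * ?a (n - i)))"
  proof
    fix n
    have "(\<Sum>i\<le>n. ?a i * ?a (n - i)) = (\<Sum>i\<le>n. of_real (excursion_prob i) * of_real (excursion_prob (n - i)) * z ^ n)"
      by (intro sum.cong refl) (simp flip: power_add)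
    then show "?a (Suc n) = 1 / 2 * z * (\<Sum>i\<le>n. ?a i * ?a (n - i))"
      by (simp add: sum_distrib_left sum_distrib_right mult_ac)
  qed
  also have "(\<Sum>n. 1 / 2 * z * (\<Sum>i\<le>n. ?a i * ?a (n - i))) = 1 / 2 * z * (F * F)"
    unfolding F_def
    by (rule sums_unique[symmetric], intro sums_mult Cauchy_product_sums s)
  finally show "F = 1 / 2 + 1 / 2 * z * F\<^sup>2"
    by (simp add: power2_eq_square)
qed

text \<open>Completing the square gives \<open>(1 - z * F)\<^sup>2 = 1 - z\<close>. As
  \<open>norm (z * F) \<le> 1\<close>, the number \<open>1 - z * F\<close> has nonnegative real
  part, and if that part is 0 then so is the imaginary part. It is therefore the principal root, on
  the boundary of the disc as well.\<close>

lemma excursion_pgf: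
  fixes z :: complex
  assumes "norm z \<le> 1" "z \<noteq> 0"
  shows "(\<Sum>n. of_real (excursion_prob n) * z ^ n) = inverse z * (1 - csqrt (1 - z))"
proof -
  define F where "F = (\<Sum>n. of_real (excursion_prob n) * z ^ n)"
  have eq: "F = 1 / 2 + 1 / 2 * z * F\<^sup>2" and "norm F \<le> 1"
    unfolding F_def using excursion_pgf_equation[OF assms(1)] by auto
  have sq: "(1 - z * F)\<^sup>2 = 1 - z"
  proof -
    have "z * (2 * F) = z * (1 + z * F\<^sup>2)" using eq by (simp add: field_simps)
    then show ?thesis by (simp add: power2_eq_square algebra_simps)
  qed
  have n: "norm (z * F) \<le> 1"
    using mult_mono[OF assms(1) \<open>norm F \<le> 1\<close>] by (simp add: norm_mult)
  have "csqrt ((1 - z * F)\<^sup>2) = 1 - z * F"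
  proof (rule csqrt_square)
    have "Re (z * F) \<le> 1" using complex_Re_le_cmod n order.trans by blast
    moreover have "Im (z * F) = 0" if "Re (z * F) = 1"
      using n that cmod_power2[of "z * F"] abs_square_le_1[of "norm (z * F)"] by auto
    ultimately show "0 < Re (1 - z * F) \<or> Re (1 - z * F) = 0 \<and> 0 \<le> Im (1 - z * F)"
      by (cases "Re (z * F) = 1") auto
  qed
  then have "1 - csqrt (1 - z) = z * F" by (simp add: sq)
  then show ?thesis unfolding F_def[symmetric] using assms(2) by simp
qed

text \<open>The closed form at \<open>z = 1\<close> shows that no mass escapes; the almost sure end
  of the excursion comes from here.\<close>

lemma suminf_excursion_prob: "(\<Sum>n. excursion_prob n) = 1"
proof -
  have "complex_of_real (\<Sum>n. excursion_prob n) = (\<Sum>n. of_real (excursion_prob n) * 1 ^ n)"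
    by (simp add: bounded_linear.suminf[OF bounded_linear_of_real summable_excursion_prob])
  also have "\<dots> = 1"
    by (subst excursion_pgf) auto
  finally show ?thesis by simp
qed

text \<open>An excursion above a level \<open>t \<ge> T\<close> visits only points where
  \<open>f = 1\<close>, so its weights do not depend on the level and obey the recursion of
  \<open>excursion_prob\<close>. With \<open>f\<close> constantly 1 this is the law of the length;
  in general it is the terminal condition at \<open>T\<close>.\<close>

lemma excursion_weight_eq_prob:
  assumes [measurable]: "f \<in> borel_measurable borel" and f: "\<And>m. T \<le> m \<Longrightarrow> f m = 1" and "T \<le> t"
  shows "excursion_weight f n t t = ennreal (excursion_prob n)"
  using assms(3)
proof (induction n arbitrary: t rule: less_induct)
  case (less n)
  show ?case
  proof (cases n)
    case 0
    then show ?thesis by simp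
  next
    case (Suc k)
    have "excursion_weight f n t t = (\<integral>\<^sup>+m. ennreal (\<Sum>i\<le>k. excursion_prob i * excursion_prob (k - i)) *
       (if t \<le> m then ennreal (exp (- 2 * (m - t))) else 0) \<partial>lborel)"
      unfolding Suc excursion_weight_diag_Suc[OF assms(1)]
    proof (intro nn_integral_cong)
      fix m
      have "(\<Sum>i\<le>k. excursion_weight f i m m * excursion_weight f (k - i) m m) =
        ennreal (\<Sum>i\<le>k. excursion_prob i * excursion_prob (k - i))" if "t \<le> m"
        using that less.prems Suc by (simp add: less.IH flip: ennreal_mult)
      then show "(if t \<le> m then ennreal (exp (- 2 * (m - t))) * f m *
          (\<Sum>i\<le>k. excursion_weight f i m m * excursion_weight f (k - i) m m) else 0) =
        ennreal (\<Sum>i\<le>k. excursion_prob i * excursion_prob (k - i)) *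
          (if t \<le> m then ennreal (exp (- 2 * (m - t))) else 0)"
        using f less.prems by (auto simp: mult.commute)
    qed
    also have "\<dots> = ennreal (\<Sum>i\<le>k. excursion_prob i * excursion_prob (k - i)) * ennreal (1 / 2)"
      by (subst nn_integral_cmult, measurable) (simp only: nn_integral_exp_tail)
    also have "\<dots> = ennreal (excursion_prob n)"
      unfolding Suc excursion_prob.simps
      by (subst ennreal_mult[symmetric]) (auto intro!: sum_nonneg simp: mult.commute)
    finally show ?thesis .
  qed
qed

section \<open>The excursion functional and its integral equation\<close>

lemma excursion_weight_mono:
  assumes "\<And>x. f x \<le> g x"
  shows "excursion_weight f n t x \<le> excursion_weight g n t x"
  by (induction n arbitrary: x) (auto intro!: nn_integral_mono mult_mono assms)

text \<open>The \<open>W t\<close> of the overview. It is real valued because it will be compared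
  with the solution of a real differential equation; for measurable weights between 0 and 1
  \<open>enn2real\<close> loses nothing, the summands being bounded by
  \<open>excursion_prob n\<close>.\<close>

definition excursion_functional :: "(real \<Rightarrow> real) \<Rightarrow> real \<Rightarrow> real" where
  "excursion_functional f t = (\<Sum>n. enn2real (excursion_weight (\<lambda>x. ennreal (f x)) n t t))"

context
  fixes f :: "real \<Rightarrow> real"
  assumes f_measurable [measurable]: "f \<in> borel_measurable borel" and f_range: "\<And>x. 0 \<le> f x" "\<And>x. f x \<le> 1"
begin

lemma excursion_weight_le_prob: "excursion_weight (\<lambda>x. ennreal (f x)) n t t \<le> ennreal (excursion_prob n)"
proof -
  have "excursion_weight (\<lambda>x. ennreal (f x)) n t t \<le> excursion_weight (\<lambda>x. 1) n t t"
    by (rule excursion_weight_mono) (use f_range in \<open>simp flip: ennreal_1 add: ennreal_leI\<close>)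
  also have "\<dots> = ennreal (excursion_prob n)"
    by (rule excursion_weight_eq_prob[of _ t]) auto
  finally show ?thesis .
qed

lemma ennreal_excursion_weight:
  "ennreal (enn2real (excursion_weight (\<lambda>x. ennreal (f x)) n t t)) = excursion_weight (\<lambda>x. ennreal (f x)) n t t"
  using le_less_trans[OF excursion_weight_le_prob ennreal_less_top] by simp

lemma enn2real_excursion_weight_le: "enn2real (excursion_weight (\<lambda>x. ennreal (f x)) n t t) \<le> excursion_prob n"
  using excursion_weight_le_prob[of n t] by (simp add: enn2real_leI)

lemma summable_excursion_weight: "summable (\<lambda>n. enn2real (excursion_weight (\<lambda>x. ennreal (f x)) n t t))"
  by (rule summable_comparison_test'[OF summable_excursion_prob, of 0]) (simp add: enn2real_excursion_weight_le)

lemma excursion_functional_nonneg: "0 \<le> excursion_functional f t"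
  unfolding excursion_functional_def by (intro suminf_nonneg summable_excursion_weight) simp

lemma excursion_functional_le_1: "excursion_functional f t \<le> 1"
  unfolding excursion_functional_def suminf_excursion_prob[symmetric]
  by (intro suminf_le summable_excursion_weight summable_excursion_prob enn2real_excursion_weight_le)

lemma excursion_functional_measurable: "excursion_functional f \<in> borel_measurable borel"
  unfolding excursion_functional_def by measurable

lemma ennreal_excursion_functional:
  "ennreal (excursion_functional f t) = (\<Sum>n. excursion_weight (\<lambda>x. ennreal (f x)) n t t)"
  unfolding excursion_functional_def
  by (subst suminf_ennreal2[symmetric]) (simp_all add: summable_excursion_weight ennreal_excursion_weight)

lemma excursion_functional_eq_1:
  assumes "\<And>m. T \<le> m \<Longrightarrow> f m = 1" "T \<le> t"
  shows "excursion_functional f t = 1"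
  unfolding excursion_functional_def
  by (subst excursion_weight_eq_prob[of _ T]) (use assms in \<open>auto simp: suminf_excursion_prob\<close>)

text \<open>Summing the decomposition at the minimum over all lengths turns the convolution of the
  two pieces into a Cauchy product, hence the square. The summand of length 0 is the isolated
  1/2.\<close>

lemma excursion_functional_equation:
  "ennreal (excursion_functional f t) = ennreal (1 / 2) +
    (\<integral>\<^sup>+m. (if t \<le> m then ennreal (exp (- 2 * (m - t)) * f m * (excursion_functional f m)\<^sup>2) else 0) \<partial>lborel)"
proof -
  define w where "w n m = enn2real (excursion_weight (\<lambda>x. ennreal (f x)) n m m)" for n m
  have w0: "0 \<le> w n m" for n m by (simp add: w_def)
  have F: "excursion_functional f m = (\<Sum>n. w n m)" for m
    by (simp add: excursion_functional_def w_def)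
  have sw: "summable (\<lambda>n. w n m)" for m
    unfolding w_def by (rule summable_excursion_weight)
  have [measurable]: "w n \<in> borel_measurable borel" for n
    unfolding w_def by measurable
  have w00: "w 0 t = 1 / 2"
    unfolding w_def excursion_weight.simps by (subst enn2real_ennreal) simp_all
  have [simp]: "excursion_weight (\<lambda>x. ennreal (f x)) n m m = ennreal (w n m)" for n m
    by (simp add: w_def ennreal_excursion_weight)
  have conv: "(\<Sum>i\<le>n. ennreal (w i m) * ennreal (w (n - i) m)) = ennreal (\<Sum>i\<le>n. w i m * w (n - i) m)" for n m
    by (simp add: w0 flip: ennreal_mult)
  have "ennreal (excursion_functional f t) = (\<Sum>n. ennreal (w n t))"
    by (simp add: ennreal_excursion_functional)
  also have "\<dots> = ennreal (w 0 t) + (\<Sum>n. ennreal (w (Suc n) t))"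
    by (subst suminf_offset[of _ 1]) simp_all
  also have "ennreal (w 0 t) = ennreal (1 / 2)"
    by (simp only: w00)
  also have "(\<Sum>n. ennreal (w (Suc n) t)) = (\<Sum>n. \<integral>\<^sup>+m. (if t \<le> m then ennreal (exp (- 2 * (m - t)) * f m *
      (\<Sum>i\<le>n. w i m * w (n - i) m)) else 0) \<partial>lborel)"
  proof (intro suminf_cong)
    fix n
    have "ennreal (w (Suc n) t) = excursion_weight (\<lambda>x. ennreal (f x)) (Suc n) t t"
      by (simp del: excursion_weight.simps)
    also have "\<dots> = (\<integral>\<^sup>+m. (if t \<le> m then ennreal (exp (- 2 * (m - t)) * f m *
      (\<Sum>i\<le>n. w i m * w (n - i) m)) else 0) \<partial>lborel)"
      by (subst excursion_weight_diag_Suc, measurable, intro nn_integral_cong)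
         (simp add: ennreal_mult f_range w0 sum_nonneg conv)
    finally show "ennreal (w (Suc n) t) = \<dots>" .
  qed
  also have "\<dots> = (\<integral>\<^sup>+m. (\<Sum>n. (if t \<le> m then ennreal (exp (- 2 * (m - t)) * f m *
      (\<Sum>i\<le>n. w i m * w (n - i) m)) else 0)) \<partial>lborel)"
    by (subst nn_integral_suminf) auto
  also have "\<dots> = (\<integral>\<^sup>+m. (if t \<le> m then ennreal (exp (- 2 * (m - t)) * f m * (excursion_functional f m)\<^sup>2) else 0) \<partial>lborel)"
  proof (intro nn_integral_cong)
    fix m
    have "(\<lambda>n. exp (- 2 * (m - t)) * f m * (\<Sum>i\<le>n. w i m * w (n - i) m)) sums (exp (- 2 * (m - t)) * f m * (excursion_functional f m)\<^sup>2)"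
      unfolding F power2_eq_square using sw w0 by (intro sums_mult Cauchy_product_sums) auto
    then have "(\<Sum>n. ennreal (exp (- 2 * (m - t)) * f m * (\<Sum>i\<le>n. w i m * w (n - i) m))) =
      ennreal (exp (- 2 * (m - t)) * f m * (excursion_functional f m)\<^sup>2)"
      by (subst suminf_ennreal2) (auto simp: sums_iff f_range w0 sum_nonneg)
    then show "(\<Sum>n. (if t \<le> m then ennreal (exp (- 2 * (m - t)) * f m * (\<Sum>i\<le>n. w i m * w (n - i) m)) else 0)) =
      (if t \<le> m then ennreal (exp (- 2 * (m - t)) * f m * (excursion_functional f m)\<^sup>2) else 0)"
      by simp
  qed
  finally show ?thesis .
qed

end

section \<open>Integral equations with piecewise continuous coefficients\<close>

text \<open>Bridge between two integrals: expectations are nonnegative Lebesgue integrals, while the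
  fundamental theorem of calculus with finitely many exceptional points is used for the gauge
  integral.\<close>

lemma bounded_measurable_integrable_on:
  fixes \<phi> :: "real \<Rightarrow> real"
  assumes [measurable]: "\<phi> \<in> borel_measurable borel" and bd: "\<And>x. x \<in> {a..b} \<Longrightarrow> 0 \<le> \<phi> x \<and> \<phi> x \<le> B"
  shows "\<phi> integrable_on {a..b}"
    and "(\<integral>\<^sup>+x. (if a \<le> x \<and> x \<le> b then ennreal (\<phi> x) else 0) \<partial>lborel) = ennreal (integral {a..b} \<phi>)"
proof -
  have si: "set_integrable lborel {a..b} \<phi>"
    unfolding set_integrable_def
    by (rule integrableI_bounded_set[where A = "{a..b}" and B = B])
       (use bd in \<open>auto simp: emeasure_lborel_Icc_eq indicator_def\<close>)
  show "\<phi> integrable_on {a..b}"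
    using set_borel_integral_eq_integral(1)[OF si] .
  have "(\<integral>\<^sup>+x. (if a \<le> x \<and> x \<le> b then ennreal (\<phi> x) else 0) \<partial>lborel) = (\<integral>\<^sup>+x. ennreal (indicator {a..b} x *\<^sub>R \<phi> x) \<partial>lborel)"
    by (intro nn_integral_cong) auto
  also have "\<dots> = ennreal (LBINT x:{a..b}. \<phi> x)"
    unfolding set_lebesgue_integral_def
    by (rule nn_integral_eq_integral) (use si bd in \<open>auto simp: set_integrable_def indicator_def\<close>)
  also have "\<dots> = ennreal (integral {a..b} \<phi>)"
    by (simp add: set_borel_integral_eq_integral(2)[OF si])
  finally show "(\<integral>\<^sup>+x. (if a \<le> x \<and> x \<le> b then ennreal (\<phi> x) else 0) \<partial>lborel) = ennreal (integral {a..b} \<phi>)" .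
qed

text \<open>If each mark at time \<open>x\<close> is accepted with probability \<open>f x\<close>,
  an individual alive at \<open>x\<close> is killed at rate \<open>1 - f x\<close>. The finite set
  \<open>J\<close> holds the possible jumps of \<open>f\<close>; outside it derivatives exist in the
  classical sense.\<close>

locale killing_rate =
  fixes f :: "real \<Rightarrow> real" and J :: "real set" and T :: real
  assumes f_measurable [measurable]: "f \<in> borel_measurable borel"
    and f_range: "0 \<le> f x" "f x \<le> 1"
    and finite_J: "finite J"
    and f_cont: "x \<notin> J \<Longrightarrow> isCont f x"
    and f_end: "T \<le> x \<Longrightarrow> f x = 1"
begin

text \<open>The total killing after time \<open>s\<close>. Here \<open>T\<close> serves as infinity,
  and for \<open>s > T\<close> the interval is empty.\<close>

definition hazard :: "real \<Rightarrow> real" where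
  "hazard s = integral {s..T} (\<lambda>x. 1 - f x)"

lemma integrable_killing: "(\<lambda>x. 1 - f x) integrable_on {a..b}"
  by (rule bounded_measurable_integrable_on(1)[where B = 1]) (auto simp: f_range)

lemma hazard_end: "T \<le> s \<Longrightarrow> hazard s = 0"
  by (cases "s = T") (auto simp: hazard_def)

lemma hazard_diff: "s \<le> t \<Longrightarrow> hazard s - hazard t = integral {s..t} (\<lambda>x. 1 - f x)"
proof -
  assume st: "s \<le> t"
  show ?thesis
  proof (cases "t \<le> T")
    case True
    then show ?thesis
      using Henstock_Kurzweil_Integration.integral_combine[OF st True integrable_killing] by (simp add: hazard_def)
  next
    case False
    have z: "integral {a..t} (\<lambda>x. 1 - f x) = 0" if "T \<le> a" for a
    proof -
      have "integral {a..t} (\<lambda>x. 1 - f x) = integral {a..t} (\<lambda>x. 0)"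
        by (intro integral_cong) (use that f_end in auto)
      then show ?thesis by simp
    qed
    show ?thesis
    proof (cases "s \<le> T")
      case True
      have "integral {s..t} (\<lambda>x. 1 - f x) = integral {s..T} (\<lambda>x. 1 - f x) + integral {T..t} (\<lambda>x. 1 - f x)"
        using Henstock_Kurzweil_Integration.integral_combine[OF True _ integrable_killing, of t] False by simp
      then show ?thesis using False z[of T] by (simp add: hazard_end) (simp add: hazard_def)
    next
      case 2: False
      then show ?thesis using False z[of s] by (simp add: hazard_end)
    qed
  qed
qed

lemma hazard_antimono: "s \<le> t \<Longrightarrow> hazard t \<le> hazard s"
  using hazard_diff[of s t] integral_nonneg[OF integrable_killing, of s t] f_range by auto

lemma hazard_continuous: "continuous_on UNIV hazard"
proof -
  have "dist (hazard s) (hazard t) \<le> 1 * dist s t" for s t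
  proof (induction s t rule: linorder_wlog)
    case (le s t)
    have "integral {s..t} (\<lambda>x. 1 - f x) \<le> integral {s..t} (\<lambda>x. 1)"
      by (intro integral_le integrable_killing) (auto simp: f_range)
    then show ?case
      using le hazard_diff[OF le] hazard_antimono[OF le] by (simp add: dist_real_def)
  qed (simp add: dist_commute)
  then have "1-lipschitz_on UNIV hazard"
    by (intro lipschitz_onI) auto
  then show ?thesis by (rule lipschitz_on_continuous_on)
qed

lemma hazard_measurable [measurable]: "hazard \<in> borel_measurable borel"
  using hazard_continuous by (rule borel_measurable_continuous_onI)

lemma hazard_deriv:
  assumes "x \<notin> J"
  shows "(hazard has_real_derivative (f x - 1)) (at x)"
proof -
  have "((\<lambda>u. integral {x - 1..u} (\<lambda>x. 1 - f x)) has_vector_derivative 1 - f x) (at x within ({x - 1..x + 1} - {}))"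
  proof (rule integral_has_vector_derivative_continuous_at)
    have "isCont (\<lambda>x. 1 - f x) x" using f_cont[OF assms] by simp
    then show "continuous (at x within {x - 1..x + 1} - {}) (\<lambda>x. 1 - f x)"
      by (rule continuous_at_imp_continuous_at_within)
  qed (auto intro: integrable_killing)
  then have "((\<lambda>u. integral {x - 1..u} (\<lambda>x. 1 - f x)) has_real_derivative 1 - f x) (at x)"
    by (simp add: has_real_derivative_iff_has_vector_derivative at_within_Icc_at)
  then have "((\<lambda>u. hazard (x - 1) - integral {x - 1..u} (\<lambda>x. 1 - f x)) has_real_derivative (f x - 1)) (at x)"
    by (auto intro!: derivative_eq_intros)
  then show ?thesis
    by (rule has_field_derivative_transform_within[where d = 1])
       (auto simp: dist_real_def hazard_diff[symmetric] abs_if split: if_splits)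
qed

text \<open>The functional of the branching process satisfies \<open>V' = 2 V - f (1 + V)\<^sup>2 / 2\<close> off \<open>J\<close>, and so
  does \<open>2 W - 1\<close> for the excursion functional \<open>W\<close>; uniqueness is a contraction on \<open>[0, T]\<close>.\<close>

lemma branching_functional_eq_excursion_functional:
  fixes V :: "real \<Rightarrow> real"
  assumes [measurable]: "V \<in> borel_measurable borel" and V_range: "\<And>t. 0 \<le> V t" "\<And>t. V t \<le> 1"
    and V_end: "\<And>t. T \<le> t \<Longrightarrow> V t = 1"
    and V_eq: "\<And>t. ennreal (V t) = (\<integral>\<^sup>+x. (if t \<le> x then ennreal (exp (- (x - t)) *
        (f x * exp (hazard x - hazard t) * (1 / 2 + 1 / 2 * (V x)\<^sup>2))) else 0) \<partial>lborel)"
    and t: "t \<in> {0..T}"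
  shows "excursion_functional f t = (1 + V t) / 2"
proof -
  \<comment> \<open>Integrating factor: it absorbs the dependence of the kernel on \<open>t\<close>,
    so that \<open>E s * V s\<close> is a tail integral of the fixed function \<open>\<phi>\<close>.
    Continuity and differentiability of \<open>V\<close> are read off from that.\<close>
  define E where "E x = exp (hazard x - x)" for x
  define \<phi> where "\<phi> x = E x * (f x * (1 / 2 + 1 / 2 * (V x)\<^sup>2))" for x
  have E_pos: "0 < E x" for x by (simp add: E_def)
  have E_meas [measurable]: "E \<in> borel_measurable borel" unfolding E_def by measurable
  have \<phi>_meas [measurable]: "\<phi> \<in> borel_measurable borel" unfolding \<phi>_def by measurable
  have V2: "(V x)\<^sup>2 \<le> 1" for x using V_range[of x] by (simp add: power_le_one)
  have \<phi>_nonneg: "0 \<le> \<phi> x" for x unfolding \<phi>_def using E_pos[of x] f_range[of x] by simp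
  have \<phi>_bd: "0 \<le> \<phi> x \<and> \<phi> x \<le> E 0" if "x \<in> {0..T}" for x
  proof -
    have "\<phi> x \<le> E 0 * (1 * (1 / 2 + 1 / 2 * 1))"
      unfolding \<phi>_def using that f_range[of x] V2[of x] hazard_antimono[of 0 x]
      by (intro mult_mono add_mono) (auto simp: E_def intro!: mult_nonneg_nonneg add_nonneg_nonneg)
    then show ?thesis using \<phi>_nonneg by simp
  qed
  have G_eq: "ennreal (E s * V s) = (\<integral>\<^sup>+x. (if s \<le> x then ennreal (\<phi> x) else 0) \<partial>lborel)" for s
  proof -
    have "ennreal (E s * V s) = ennreal (E s) * ennreal (V s)"
      using E_pos[of s] V_range by (simp add: ennreal_mult)
    also have "\<dots> = (\<integral>\<^sup>+x. (if s \<le> x then ennreal (\<phi> x) else 0) \<partial>lborel)"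
      unfolding V_eq
    proof (subst nn_integral_cmult[symmetric], measurable, intro nn_integral_cong)
      fix x
      have "E s * (exp (- (x - s)) * (f x * exp (hazard x - hazard s) * (1 / 2 + 1 / 2 * (V x)\<^sup>2))) = \<phi> x"
        unfolding \<phi>_def E_def by (simp add: exp_diff exp_minus field_simps)
      then show "ennreal (E s) * (if s \<le> x then ennreal (exp (- (x - s)) *
        (f x * exp (hazard x - hazard s) * (1 / 2 + 1 / 2 * (V x)\<^sup>2))) else 0) = (if s \<le> x then ennreal (\<phi> x) else 0)"
        using E_pos[of s] by (auto simp flip: ennreal_mult')
    qed
    finally show ?thesis .
  qed
  have G: "E s * V s = integral {s..T} \<phi> + E T" if s: "s \<in> {0..T}" for s
  proof -
    have "ennreal (E s * V s) = (\<integral>\<^sup>+x. (if s \<le> x \<and> x \<le> T then ennreal (\<phi> x) else 0) + (if T \<le> x then ennreal (\<phi> x) else 0) \<partial>lborel)"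
      unfolding G_eq
    proof (rule nn_integral_cong_AE)
      show "AE x in lborel. (if s \<le> x then ennreal (\<phi> x) else 0) = (if s \<le> x \<and> x \<le> T then ennreal (\<phi> x) else 0) + (if T \<le> x then ennreal (\<phi> x) else 0)"
        using AE_lborel_singleton[of T] by eventually_elim (use s in auto)
    qed
    also have "\<dots> = ennreal (integral {s..T} \<phi>) + ennreal (E T * V T)"
      unfolding G_eq[of T]
      by (subst nn_integral_add, measurable, subst bounded_measurable_integrable_on(2)[of \<phi> s T "E 0"])
         (use \<phi>_bd s in auto)
    also have "\<dots> = ennreal (integral {s..T} \<phi> + E T * V T)"
      using E_pos[of T] V_range[of T] bounded_measurable_integrable_on(1)[of \<phi> s T "E 0"] \<phi>_bd s
      by (intro ennreal_plus[symmetric] integral_nonneg) (auto simp: \<phi>_nonneg)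
    finally show ?thesis
      using E_pos[of s] E_pos[of T] V_range[of s] V_end[of T] bounded_measurable_integrable_on(1)[of \<phi> s T "E 0"] \<phi>_bd s
      by (subst (asm) ennreal_inj) (auto intro!: add_nonneg_nonneg integral_nonneg mult_nonneg_nonneg simp: \<phi>_nonneg less_imp_le)
  qed
  have \<phi>_int: "\<phi> integrable_on {0..T}"
    by (rule bounded_measurable_integrable_on(1)[where B = "E 0"]) (use \<phi>_bd in auto)
  have E_cont: "continuous_on UNIV E"
    unfolding E_def by (intro continuous_intros hazard_continuous)
  have V_form: "V s = (integral {s..T} \<phi> + E T) / E s" if "s \<in> {0..T}" for s
    using G[OF that] E_pos[of s] by (simp add: field_simps)
  have V_cont: "continuous_on {0..T} V"
  proof (subst continuous_on_cong[OF refl V_form])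
    show "continuous_on {0..T} (\<lambda>s. (integral {s..T} \<phi> + E T) / E s)"
      using E_pos by (intro continuous_intros indefinite_integral_continuous_1' \<phi>_int continuous_on_subset[OF E_cont])
        (auto simp: less_imp_neq[symmetric])
  qed
  have V_deriv: "(V has_real_derivative (2 * V x - 1 / 2 * f x * (1 + V x)\<^sup>2)) (at x)"
    if x: "x \<in> {0<..<T} - J" for x
  proof -
    have Vx: "isCont V x" using V_cont x by (simp add: continuous_on_interior interior_atLeastAtMost_real)
    have E': "(E has_real_derivative (E x * (f x - 2))) (at x)"
      unfolding E_def using x by (auto intro!: derivative_eq_intros hazard_deriv)
    have "isCont \<phi> x"
      unfolding \<phi>_def using DERIV_isCont[OF E'] f_cont[of x] Vx x by (intro continuous_intros) auto
    then have "((\<lambda>u. integral {0..u} \<phi>) has_vector_derivative \<phi> x) (at x within ({0..T} - {}))"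
      using x by (intro integral_has_vector_derivative_continuous_at[OF \<phi>_int] continuous_at_imp_continuous_at_within[of x \<phi> "{0..T} - {}"]) auto
    then have I': "((\<lambda>u. integral {0..u} \<phi>) has_real_derivative \<phi> x) (at x)"
      using x by (simp add: has_real_derivative_iff_has_vector_derivative at_within_Icc_at)
    have V0: "V x * E x = integral {0..T} \<phi> - integral {0..x} \<phi> + E T"
      using G[of x] Henstock_Kurzweil_Integration.integral_combine[of 0 x T \<phi>] \<phi>_int x by (simp add: algebra_simps)
    have "((\<lambda>u. (integral {0..T} \<phi> - integral {0..u} \<phi> + E T) / E u) has_real_derivative
        ((- \<phi> x) * E x - (V x * E x) * (E x * (f x - 2))) / (E x * E x)) (at x)"
      using E_pos[of x] by (auto intro!: derivative_eq_intros I' E' simp: V0)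
    also have "((- \<phi> x) * E x - (V x * E x) * (E x * (f x - 2))) / (E x * E x) = 2 * V x - 1 / 2 * f x * (1 + V x)\<^sup>2"
      using E_pos[of x] by (simp add: \<phi>_def field_simps power2_eq_square)
    finally show ?thesis
    proof (rule has_field_derivative_transform_within_open[of _ _ _ "{0<..<T}"])
      fix u assume "u \<in> {0<..<T}"
      then show "(integral {0..T} \<phi> - integral {0..u} \<phi> + E T) / E u = V u"
        using V_form[of u] Henstock_Kurzweil_Integration.integral_combine[of 0 u T \<phi>] \<phi>_int by (simp add: algebra_simps)
    qed (use x in auto)
  qed
  define U where "U s = (1 + V s) / 2" for s
  define W where "W = excursion_functional f"
  have U_range: "0 \<le> U s" "U s \<le> 1" for s using V_range[of s] by (auto simp: U_def)
  note W_range = excursion_functional_nonneg[OF f_measurable f_range, folded W_def]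
    excursion_functional_le_1[OF f_measurable f_range, folded W_def]
  have [measurable]: "W \<in> borel_measurable borel"
    unfolding W_def by (rule excursion_functional_measurable[OF f_measurable f_range])
  have [measurable]: "U \<in> borel_measurable borel" unfolding U_def by measurable
  define \<psi> where "\<psi> s Y x = exp (- 2 * (x - s)) * f x * (Y x)\<^sup>2" for s x and Y :: "real \<Rightarrow> real"
  have \<psi>_meas [measurable]: "\<psi> s Y \<in> borel_measurable borel" if [measurable]: "Y \<in> borel_measurable borel" for s Y
    unfolding \<psi>_def by measurable
  have \<psi>_bd: "0 \<le> \<psi> s Y x \<and> \<psi> s Y x \<le> 1" if "s \<le> x" "0 \<le> Y x" "Y x \<le> 1" for s Y x
    unfolding \<psi>_def using that f_range[of x] by (auto intro!: mult_le_one power_le_one mult_nonneg_nonneg)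
  have \<psi>_int: "\<psi> s Y integrable_on {s..T}" if "Y \<in> borel_measurable borel" "\<And>x. 0 \<le> Y x" "\<And>x. Y x \<le> 1" for s Y
    by (rule bounded_measurable_integrable_on(1)[where B = 1]) (use that \<psi>_bd in auto)
  \<comment> \<open>With \<open>U = (1 + V) / 2\<close> the differential equation reads
    \<open>V' - 2 * V = - 2 * f * U\<^sup>2\<close>; multiplied by
    \<open>exp (- 2 * (x - s))\<close> it integrates to the equation of the excursion
    functional.\<close>
  have U_eq: "U s = 1 / 2 + 1 / 2 * exp (- 2 * (T - s)) + integral {s..T} (\<psi> s U)" if s: "s \<in> {0..T}" for s
  proof -
    have "((\<lambda>x. exp (- 2 * (x - s)) * (2 * V x - 1 / 2 * f x * (1 + V x)\<^sup>2) - 2 * exp (- 2 * (x - s)) * V x)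
      has_integral (exp (- 2 * (T - s)) * V T - exp (- 2 * (s - s)) * V s)) {s..T}"
    proof (rule fundamental_theorem_of_calculus_interior_strong[OF finite_J])
      fix x assume x: "x \<in> {s<..<T} - J"
      have "((\<lambda>x. exp (- 2 * (x - s)) * V x) has_real_derivative
        (exp (- 2 * (x - s)) * (2 * V x - 1 / 2 * f x * (1 + V x)\<^sup>2) - 2 * exp (- 2 * (x - s)) * V x)) (at x)"
        using x s by (auto intro!: derivative_eq_intros V_deriv)
      then show "((\<lambda>x. exp (- 2 * (x - s)) * V x) has_vector_derivative
        (exp (- 2 * (x - s)) * (2 * V x - 1 / 2 * f x * (1 + V x)\<^sup>2) - 2 * exp (- 2 * (x - s)) * V x)) (at x)"
        by (simp add: has_real_derivative_iff_has_vector_derivative)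
    next
      show "continuous_on {s..T} (\<lambda>x. exp (- 2 * (x - s)) * V x)"
        using s by (intro continuous_intros continuous_on_subset[OF V_cont]) auto
    qed (use s in auto)
    moreover have "exp (- 2 * (x - s)) * (2 * V x - 1 / 2 * f x * (1 + V x)\<^sup>2) - 2 * exp (- 2 * (x - s)) * V x = - 2 * \<psi> s U x" for x
      by (simp add: \<psi>_def U_def power2_eq_square field_simps)
    ultimately have "((\<lambda>x. - 2 * \<psi> s U x) has_integral (exp (- 2 * (T - s)) - V s)) {s..T}"
      using V_end[of T] by simp
    moreover have "((\<lambda>x. - 2 * \<psi> s U x) has_integral (- 2 * integral {s..T} (\<psi> s U))) {s..T}"
      by (intro has_integral_mult_right integrable_integral \<psi>_int) (use U_range in auto)
    ultimately have "exp (- 2 * (T - s)) - V s = - 2 * integral {s..T} (\<psi> s U)"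
      by (rule has_integral_unique)
    then show ?thesis by (simp add: U_def field_simps)
  qed
  \<comment> \<open>Cutting the integral at \<open>T\<close>, beyond which \<open>f\<close> and
    \<open>W\<close> are 1, produces the same boundary term that \<open>V T = 1\<close> produced for
    \<open>U\<close>.\<close>
  have W_eq: "W s = 1 / 2 + 1 / 2 * exp (- 2 * (T - s)) + integral {s..T} (\<psi> s W)" if s: "s \<in> {0..T}" for s
  proof -
    have "ennreal (W s) = ennreal (1 / 2) + (\<integral>\<^sup>+x. (if s \<le> x then ennreal (\<psi> s W x) else 0) \<partial>lborel)"
      unfolding W_def \<psi>_def by (rule excursion_functional_equation[OF f_measurable f_range])
    also have "(\<integral>\<^sup>+x. (if s \<le> x then ennreal (\<psi> s W x) else 0) \<partial>lborel) =
       (\<integral>\<^sup>+x. (if s \<le> x \<and> x \<le> T then ennreal (\<psi> s W x) else 0) + ennreal (exp (- 2 * (T - s))) * (if T \<le> x then ennreal (exp (- 2 * (x - T))) else 0) \<partial>lborel)"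
    proof (rule nn_integral_cong_AE)
      have "\<psi> s W x = exp (- 2 * (T - s)) * exp (- 2 * (x - T))" if "T \<le> x" for x
      proof -
        have "f x = 1" "W x = 1"
          using that f_end excursion_functional_eq_1[OF f_measurable f_range f_end that] by (auto simp: W_def)
        then show ?thesis by (simp add: \<psi>_def flip: exp_add)
      qed
      then have conv: "ennreal (\<psi> s W x) = ennreal (exp (- 2 * (T - s))) * ennreal (exp (- 2 * (x - T)))" if "T \<le> x" for x
        using that by (simp flip: ennreal_mult)
      show "AE x in lborel. (if s \<le> x then ennreal (\<psi> s W x) else 0) = (if s \<le> x \<and> x \<le> T then ennreal (\<psi> s W x) else 0) +
          ennreal (exp (- 2 * (T - s))) * (if T \<le> x then ennreal (exp (- 2 * (x - T))) else 0)"
        using AE_lborel_singleton[of T] by eventually_elim (use s conv in auto)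
    qed
    also have "\<dots> = ennreal (integral {s..T} (\<psi> s W)) + ennreal (exp (- 2 * (T - s))) * ennreal (1 / 2)"
    proof (subst nn_integral_add)
      show "(\<integral>\<^sup>+x. (if s \<le> x \<and> x \<le> T then ennreal (\<psi> s W x) else 0) \<partial>lborel) + (\<integral>\<^sup>+x. ennreal (exp (- 2 * (T - s))) * (if T \<le> x then ennreal (exp (- 2 * (x - T))) else 0) \<partial>lborel)
        = ennreal (integral {s..T} (\<psi> s W)) + ennreal (exp (- 2 * (T - s))) * ennreal (1 / 2)"
        by (subst bounded_measurable_integrable_on(2)[where B = 1], (measurable; fail), (use \<psi>_bd W_range in auto)[1],
            subst nn_integral_cmult, measurable) (simp only: nn_integral_exp_tail)
    qed measurable
    finally have eq: "ennreal (W s) = ennreal (1 / 2) + (ennreal (integral {s..T} (\<psi> s W)) + ennreal (exp (- 2 * (T - s))) * ennreal (1 / 2))" .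
    have "ennreal (W s) = ennreal (1 / 2 + (integral {s..T} (\<psi> s W) + exp (- 2 * (T - s)) * (1 / 2)))"
    proof -
      have I0: "0 \<le> integral {s..T} (\<psi> s W)"
        using integral_nonneg[OF \<psi>_int[of W s]] W_range \<psi>_bd by auto
      have 1: "ennreal (exp (- 2 * (T - s))) * ennreal (1 / 2) = ennreal (exp (- 2 * (T - s)) * (1 / 2))"
        by (rule ennreal_mult[symmetric]) auto
      have 2: "ennreal (integral {s..T} (\<psi> s W)) + ennreal (exp (- 2 * (T - s)) * (1 / 2)) = ennreal (integral {s..T} (\<psi> s W) + exp (- 2 * (T - s)) * (1 / 2))"
        by (rule ennreal_plus[symmetric]) (use I0 in auto)
      have 3: "ennreal (1 / 2) + ennreal (integral {s..T} (\<psi> s W) + exp (- 2 * (T - s)) * (1 / 2)) = ennreal (1 / 2 + (integral {s..T} (\<psi> s W) + exp (- 2 * (T - s)) * (1 / 2)))"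
        by (rule ennreal_plus[symmetric]) (use I0 in auto)
      show ?thesis unfolding eq by (simp only: 1 2 3)
    qed
    then show ?thesis
      using integral_nonneg[OF \<psi>_int[of W s]] W_range \<psi>_bd
      by (subst (asm) ennreal_inj) (auto)
  qed
  define \<delta> where "\<delta> = (SUP s\<in>{0..T}. \<bar>W s - U s\<bar>)"
  have D1: "\<bar>W s - U s\<bar> \<le> 1" for s
    using W_range[of s] U_range[of s] by (simp add: abs_le_iff)
  have bdd: "bdd_above ((\<lambda>s. \<bar>W s - U s\<bar>) ` {0..T})"
    using D1 by (auto intro!: bdd_aboveI2)
  have D\<delta>: "\<bar>W s - U s\<bar> \<le> \<delta>" if "s \<in> {0..T}" for s
    unfolding \<delta>_def using bdd that by (rule cSUP_upper2) auto
  have \<delta>0: "0 \<le> \<delta>" using D\<delta>[OF t] by (rule order.trans[rotated]) simp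
  \<comment> \<open>\<open>W\<close> and \<open>U\<close> lie in \<open>[0, 1]\<close>, so their
    squares differ by at most \<open>2 * \<delta>\<close>; the kernel has mass
    \<open>(1 - exp (- 2 * (T - s))) / 2\<close>, which leaves a factor below 1 uniformly on
    \<open>[0, T]\<close>.\<close>
  have "\<bar>W s - U s\<bar> \<le> \<delta> * (1 - exp (- 2 * T))" if s: "s \<in> {0..T}" for s
  proof -
    have "W s - U s = integral {s..T} (\<lambda>x. \<psi> s W x - \<psi> s U x)"
      using \<psi>_int[of W s] \<psi>_int[of U s] W_range U_range
      by (subst Henstock_Kurzweil_Integration.integral_diff) (auto simp: U_eq[OF s] W_eq[OF s])
    also have "norm \<dots> \<le> integral {s..T} (\<lambda>x. exp (- 2 * (x - s)) * (2 * \<delta>))"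
    proof (rule integral_norm_bound_integral)
      show "(\<lambda>x. \<psi> s W x - \<psi> s U x) integrable_on {s..T}"
        using \<psi>_int[of W s] \<psi>_int[of U s] W_range U_range by (intro integrable_diff) auto
      show "(\<lambda>x. exp (- 2 * (x - s)) * (2 * \<delta>)) integrable_on {s..T}"
        by (intro integrable_continuous_real continuous_intros)
      fix x assume x: "x \<in> {s..T}"
      have "\<bar>(W x)\<^sup>2 - (U x)\<^sup>2\<bar> = \<bar>W x - U x\<bar> * (W x + U x)"
        using W_range[of x] U_range[of x] by (simp add: power2_eq_square square_diff_square_factored abs_mult mult.commute)
      also have "\<dots> \<le> \<delta> * 2"
        using x s W_range[of x] U_range[of x] D\<delta>[of x] \<delta>0 by (intro mult_mono) auto
      finally have "\<bar>(W x)\<^sup>2 - (U x)\<^sup>2\<bar> \<le> \<delta> * 2" .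
      have "\<psi> s W x - \<psi> s U x = exp (- 2 * (x - s)) * (f x * ((W x)\<^sup>2 - (U x)\<^sup>2))"
        unfolding \<psi>_def by (simp only: right_diff_distrib mult.assoc)
      then have "norm (\<psi> s W x - \<psi> s U x) = exp (- 2 * (x - s)) * (f x * \<bar>(W x)\<^sup>2 - (U x)\<^sup>2\<bar>)"
        using f_range[of x] by (simp only: real_norm_def abs_mult abs_of_nonneg exp_ge_zero)
      also have "\<dots> \<le> exp (- 2 * (x - s)) * (1 * (\<delta> * 2))"
        using f_range[of x] \<open>\<bar>(W x)\<^sup>2 - (U x)\<^sup>2\<bar> \<le> \<delta> * 2\<close> by (intro mult_left_mono mult_mono) auto
      finally show "norm (\<psi> s W x - \<psi> s U x) \<le> exp (- 2 * (x - s)) * (2 * \<delta>)" by simp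
    qed
    also have "integral {s..T} (\<lambda>x. exp (- 2 * (x - s)) * (2 * \<delta>)) = (- exp (- 2 * (T - s)) * \<delta>) - (- exp (- 2 * (s - s)) * \<delta>)"
      by (intro integral_unique fundamental_theorem_of_calculus)
         (use s in \<open>auto intro!: derivative_eq_intros simp: has_real_derivative_iff_has_vector_derivative[symmetric]\<close>)
    also have "\<dots> = \<delta> * (1 - exp (- 2 * (T - s)))" by (simp add: algebra_simps)
    also have "\<dots> \<le> \<delta> * (1 - exp (- 2 * T))"
      using s \<delta>0 by (intro mult_left_mono) auto
    finally show ?thesis by simp
  qed
  then have "\<delta> \<le> \<delta> * (1 - exp (- 2 * T))"
    unfolding \<delta>_def using t by (intro cSUP_least) (auto simp: \<delta>_def)
  then have "\<delta> * exp (- 2 * T) \<le> 0" by (simp add: algebra_simps)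
  then have "\<delta> = 0" using \<delta>0 by (simp add: mult_le_0_iff)
  then show ?thesis using D\<delta>[OF t] by (simp add: W_def U_def)
qed

end

section \<open>Random walks with independent increments\<close>

context prob_space
begin

text \<open>Fubini for one variable: \<open>X i\<close> is replaced by an integration over its law,
  while the block \<open>A\<close> stays under the expectation. \<open>X i\<close> is treated as the
  block \<open>{i}\<close>, so that independence of disjoint blocks applies.\<close>

lemma nn_integral_indep_split:
  fixes X :: "'i \<Rightarrow> 'a \<Rightarrow> real"
  assumes ind: "indep_vars (\<lambda>_. borel) X I" and A: "A \<subseteq> I" "i \<in> I" "i \<notin> A"
    and [measurable]: "F \<in> borel_measurable (PiM A (\<lambda>_. borel) \<Otimes>\<^sub>M borel)"
  shows "(\<integral>\<^sup>+\<omega>. F (restrict (\<lambda>j. X j \<omega>) A, X i \<omega>) \<partial>M) =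
    (\<integral>\<^sup>+\<omega>. \<integral>\<^sup>+x. F (restrict (\<lambda>j. X j \<omega>) A, x) \<partial>distr M borel (X i) \<partial>M)"
proof -
  let ?A = "\<lambda>\<omega>. restrict (\<lambda>j. X j \<omega>) A" and ?B = "\<lambda>\<omega>. restrict (\<lambda>j. X j \<omega>) {i}"
  let ?SA = "PiM A (\<lambda>_. borel :: real measure)" and ?SB = "PiM {i} (\<lambda>_. borel :: real measure)"
  have "indep_var ?SA ?A ?SB ?B"
    by (rule indep_var_restrict[OF ind]) (use A in auto)
  then have [measurable]: "random_variable ?SA ?A" "random_variable ?SB ?B"
    and eq: "distr M ?SA ?A \<Otimes>\<^sub>M distr M ?SB ?B = distr M (?SA \<Otimes>\<^sub>M ?SB) (\<lambda>\<omega>. (?A \<omega>, ?B \<omega>))"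
    by (auto simp: indep_var_distribution_eq)
  have [measurable]: "random_variable borel (X i)"
    using ind A(2) by (auto simp: indep_vars_def)
  interpret B: prob_space "distr M ?SB ?B" by (rule prob_space_distr) simp
  have "(\<integral>\<^sup>+\<omega>. F (?A \<omega>, X i \<omega>) \<partial>M) = (\<integral>\<^sup>+\<omega>. F (?A \<omega>, ?B \<omega> i) \<partial>M)"
    by simp
  also have "\<dots> = (\<integral>\<^sup>+p. F (fst p, snd p i) \<partial>distr M (?SA \<Otimes>\<^sub>M ?SB) (\<lambda>\<omega>. (?A \<omega>, ?B \<omega>)))"
    by (subst nn_integral_distr) auto
  also have "\<dots> = (\<integral>\<^sup>+a. \<integral>\<^sup>+b. F (a, b i) \<partial>distr M ?SB ?B \<partial>distr M ?SA ?A)"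
    unfolding eq[symmetric] by (subst B.nn_integral_fst[symmetric]) auto
  also have "\<dots> = (\<integral>\<^sup>+\<omega>. \<integral>\<^sup>+b. F (?A \<omega>, b i) \<partial>distr M ?SB ?B \<partial>M)"
    by (subst nn_integral_distr) (auto intro!: B.borel_measurable_nn_integral)
  also have "\<dots> = (\<integral>\<^sup>+\<omega>. \<integral>\<^sup>+x. F (?A \<omega>, x) \<partial>distr M borel (X i) \<partial>M)"
  proof (rule nn_integral_cong)
    fix \<omega> assume [measurable]: "\<omega> \<in> space M"
    have "?A \<omega> \<in> space ?SA" by (auto simp: space_PiM)
    then have [measurable]: "(\<lambda>x. F (?A \<omega>, x)) \<in> borel_measurable borel"
      by (rule measurable_Pair2[OF assms(5)])
    show "(\<integral>\<^sup>+b. F (?A \<omega>, b i) \<partial>distr M ?SB ?B) = (\<integral>\<^sup>+x. F (?A \<omega>, x) \<partial>distr M borel (X i))"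
    proof -
      have "(\<integral>\<^sup>+b. F (?A \<omega>, b i) \<partial>distr M ?SB ?B) = (\<integral>\<^sup>+\<omega>'. F (?A \<omega>, ?B \<omega>' i) \<partial>M)"
        by (rule nn_integral_distr) measurable
      moreover have "(\<integral>\<^sup>+x. F (?A \<omega>, x) \<partial>distr M borel (X i)) = (\<integral>\<^sup>+\<omega>'. F (?A \<omega>, X i \<omega>') \<partial>M)"
        by (rule nn_integral_distr) measurable
      ultimately show ?thesis by simp
    qed
  qed
  finally show ?thesis .
qed

text \<open>Given the other summands, a variable with a density avoids the one value that solves the
  equation. This yields distinct walk values, distinct death times, and marks that miss the
  deaths.\<close>

lemma AE_linear_combination_neq:
  fixes X :: "'i \<Rightarrow> 'a \<Rightarrow> real"
  assumes ind: "indep_vars (\<lambda>_. borel) X I" and J: "finite J" "J \<subseteq> I" "i \<in> J" and c: "c i \<noteq> (0::real)"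
    and D: "distributed M lborel (X i) p"
  shows "AE \<omega> in M. (\<Sum>j\<in>J. c j * X j \<omega>) \<noteq> r"
proof -
  have [measurable]: "random_variable borel (X j)" if "j \<in> J" for j
    using ind J that by (auto simp: indep_vars_def)
  note [measurable] = distributed_borel_measurable[OF D]
  have Xi: "distr M borel (X i) = density lborel p"
    using distributed_distr_eq_density[OF D] by (simp cong: distr_cong)
  define F where "F = (\<lambda>(y, x). indicator {0} ((\<Sum>j\<in>J - {i}. c j * y j) + c i * x - r) :: ennreal)"
  have [measurable]: "F \<in> borel_measurable (PiM (J - {i}) (\<lambda>_. borel) \<Otimes>\<^sub>M borel)"
    unfolding F_def by measurable
  have "(\<integral>\<^sup>+\<omega>. indicator {0} ((\<Sum>j\<in>J. c j * X j \<omega>) - r) \<partial>M) = (\<integral>\<^sup>+\<omega>. F (restrict (\<lambda>j. X j \<omega>) (J - {i}), X i \<omega>) \<partial>M)"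
    unfolding F_def using J by (intro nn_integral_cong) (simp add: sum.remove[of J i] add.commute)
  also have "\<dots> = (\<integral>\<^sup>+\<omega>. \<integral>\<^sup>+x. F (restrict (\<lambda>j. X j \<omega>) (J - {i}), x) \<partial>distr M borel (X i) \<partial>M)"
    by (rule nn_integral_indep_split[OF ind]) (use J in auto)
  also have "\<dots> = (\<integral>\<^sup>+\<omega>. 0 \<partial>M)"
  proof (intro nn_integral_cong)
    fix \<omega> assume "\<omega> \<in> space M"
    define a where "a = (r - (\<Sum>j\<in>J - {i}. c j * X j \<omega>)) / c i"
    have "(\<integral>\<^sup>+x. F (restrict (\<lambda>j. X j \<omega>) (J - {i}), x) \<partial>distr M borel (X i)) = (\<integral>\<^sup>+x. p x * indicator {0} ((\<Sum>j\<in>J - {i}. c j * X j \<omega>) + c i * x - r) \<partial>lborel)"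
      unfolding Xi F_def by (subst nn_integral_density) auto
    also have "\<dots> = (\<integral>\<^sup>+(x::real). 0 \<partial>lborel)"
    proof (rule nn_integral_cong_AE)
      show "AE x in lborel. p x * indicator {0} ((\<Sum>j\<in>J - {i}. c j * X j \<omega>) + c i * x - r) = 0"
        using AE_lborel_singleton[of a]
      proof eventually_elim
        case (elim x)
        then have "(\<Sum>j\<in>J - {i}. c j * X j \<omega>) + c i * x - r \<noteq> 0"
          using c by (auto simp: a_def field_simps)
        then show ?case by simp
      qed
    qed
    finally show "(\<integral>\<^sup>+x. F (restrict (\<lambda>j. X j \<omega>) (J - {i}), x) \<partial>distr M borel (X i)) = 0" by simp
  qed
  finally have "(\<integral>\<^sup>+\<omega>. indicator {0} ((\<Sum>j\<in>J. c j * X j \<omega>) - r) \<partial>M) = 0" by simp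
  then have "AE \<omega> in M. indicator {0} ((\<Sum>j\<in>J. c j * X j \<omega>) - r) = (0::ennreal)"
    by (subst (asm) nn_integral_0_iff_AE) (use J in auto)
  then show ?thesis by eventually_elim (auto simp: indicator_def split: if_splits)
qed

lemma nn_integral_walk_step:
  fixes X :: "nat \<Rightarrow> 'a \<Rightarrow> real"
  assumes ind: "indep_vars (\<lambda>_. borel) X UNIV" and D: "\<And>i. distributed M lborel (X i) p"
    and [measurable]: "g \<in> borel_measurable borel" "\<phi> \<in> borel_measurable borel"
  shows "(\<integral>\<^sup>+\<omega>. (\<Prod>k=1..n. g (walk X k \<omega>)) * \<phi> (walk X (Suc n) \<omega>) \<partial>M) =
    (\<integral>\<^sup>+\<omega>. (\<Prod>k=1..n. g (walk X k \<omega>)) * (\<integral>\<^sup>+y. p y * \<phi> (walk X n \<omega> + y) \<partial>lborel) \<partial>M)"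
proof -
  note [measurable] = distributed_borel_measurable[OF D]
  have Xn: "distr M borel (X n) = density lborel p"
    using distributed_distr_eq_density[OF D[of n]] by (simp cong: distr_cong)
  define F where "F = (\<lambda>(y, x). (\<Prod>k=1..n. g (\<Sum>i<k. y i)) * \<phi> ((\<Sum>i<n. y i) + x) :: ennreal)"
  have [measurable]: "(\<lambda>p. \<Sum>i<k. fst p i) \<in> borel_measurable (PiM {..<n} (\<lambda>_. borel :: real measure) \<Otimes>\<^sub>M borel)" if "k \<le> n" for k
  proof -
    have m: "(\<lambda>p. fst p i) \<in> borel_measurable (PiM {..<n} (\<lambda>_. borel :: real measure) \<Otimes>\<^sub>M borel)" if "i < k" for i
      using that \<open>k \<le> n\<close> by (intro measurable_compose[OF measurable_fst measurable_component_singleton]) auto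
    show ?thesis by (rule borel_measurable_sum[of "{..<k}" "\<lambda>i p. fst p i"]) (simp add: m)
  qed
  have [measurable]: "F \<in> borel_measurable (PiM {..<n} (\<lambda>_. borel) \<Otimes>\<^sub>M borel)"
    unfolding F_def case_prod_beta by (intro borel_measurable_times_ennreal borel_measurable_prod_ennreal measurable_compose[OF _ assms(3)] measurable_compose[OF _ assms(4)] borel_measurable_add) (simp_all, measurable)
  have F: "F (restrict (\<lambda>j. X j \<omega>) {..<n}, x) = (\<Prod>k=1..n. g (walk X k \<omega>)) * \<phi> (walk X n \<omega> + x)" for \<omega> x
  proof -
    have "(\<Sum>i<k. restrict (\<lambda>j. X j \<omega>) {..<n} i) = walk X k \<omega>" if "k \<le> n" for k
      unfolding walk_def by (intro sum.cong) (use that in auto)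
    then show ?thesis unfolding F_def by (auto intro!: arg_cong2[where f = "(*)"] prod.cong)
  qed
  have "(\<integral>\<^sup>+\<omega>. (\<Prod>k=1..n. g (walk X k \<omega>)) * \<phi> (walk X (Suc n) \<omega>) \<partial>M) = (\<integral>\<^sup>+\<omega>. F (restrict (\<lambda>j. X j \<omega>) {..<n}, X n \<omega>) \<partial>M)"
    unfolding F by (intro nn_integral_cong) (simp add: walk_def)
  also have "\<dots> = (\<integral>\<^sup>+\<omega>. \<integral>\<^sup>+x. F (restrict (\<lambda>j. X j \<omega>) {..<n}, x) \<partial>distr M borel (X n) \<partial>M)"
    by (rule nn_integral_indep_split[OF ind]) auto
  also have "\<dots> = (\<integral>\<^sup>+\<omega>. (\<Prod>k=1..n. g (walk X k \<omega>)) * (\<integral>\<^sup>+y. p y * \<phi> (walk X n \<omega> + y) \<partial>lborel) \<partial>M)"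
    unfolding F Xn
    by (intro nn_integral_cong, subst nn_integral_density, measurable, subst nn_integral_cmult[symmetric], measurable)
       (simp add: mult_ac)
  finally show ?thesis .
qed

text \<open>The last step is integrated out first, so the kernel acts on \<open>\<phi>\<close>
  before the induction hypothesis applies, and the path expectation becomes an iterate of a
  kernel.\<close>

lemma nn_integral_walk:
  fixes X :: "nat \<Rightarrow> 'a \<Rightarrow> real"
  assumes ind: "indep_vars (\<lambda>_. borel) X UNIV" and D: "\<And>i. distributed M lborel (X i) p"
    and [measurable]: "g \<in> borel_measurable borel" "\<phi> \<in> borel_measurable borel"
  shows "(\<integral>\<^sup>+\<omega>. (\<Prod>k=1..n. g (walk X k \<omega>)) * \<phi> (walk X n \<omega>) \<partial>M) =
    ((\<lambda>\<phi> x. \<integral>\<^sup>+y. p y * (g (x + y) * \<phi> (x + y)) \<partial>lborel) ^^ n) \<phi> 0"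
  using assms(4)
proof (induction n arbitrary: \<phi>)
  case 0
  then show ?case by (simp add: walk_def emeasure_space_1)
next
  case (Suc n)
  note [measurable] = Suc.prems distributed_borel_measurable[OF D]
  define T where "T = (\<lambda>\<phi> x. \<integral>\<^sup>+y. p y * (g (x + y) * \<phi> (x + y)) \<partial>lborel)"
  have T\<phi> [measurable]: "T \<phi> \<in> borel_measurable borel"
    unfolding T_def by measurable
  have "(\<integral>\<^sup>+\<omega>. (\<Prod>k=1..Suc n. g (walk X k \<omega>)) * \<phi> (walk X (Suc n) \<omega>) \<partial>M) =
    (\<integral>\<^sup>+\<omega>. (\<Prod>k=1..n. g (walk X k \<omega>)) * (g (walk X (Suc n) \<omega>) * \<phi> (walk X (Suc n) \<omega>)) \<partial>M)"
    by (intro nn_integral_cong) (simp add: mult.assoc)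
  also have "\<dots> = (\<integral>\<^sup>+\<omega>. (\<Prod>k=1..n. g (walk X k \<omega>)) * T \<phi> (walk X n \<omega>) \<partial>M)"
    unfolding T_def by (rule nn_integral_walk_step[OF ind D]) measurable
  also have "\<dots> = (T ^^ n) (T \<phi>) 0"
    unfolding T_def using Suc.IH[OF T\<phi>] by (simp add: T_def)
  finally show ?case
    by (simp only: T_def funpow_Suc_right comp_def)
qed

end

section \<open>The Laplace functional of a Poisson process\<close>

lemma nn_integral_exp_tail1:
  fixes t :: real
  shows "(\<integral>\<^sup>+m. (if t \<le> m then ennreal (exp (- (m - t))) else 0) \<partial>lborel) = 1"
proof -
  have "(\<integral>\<^sup>+m. (if t \<le> m then ennreal (exp (- (m - t))) else 0) \<partial>lborel) = (\<integral>\<^sup>+m. ennreal (exponential_density 1 (m - t)) \<partial>lborel)"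
    by (intro nn_integral_cong) (auto simp: exponential_density_def)
  also have "\<dots> = (\<integral>\<^sup>+m. ennreal (exponential_density 1 m) \<partial>lborel)"
    using nn_integral_real_affine[of "\<lambda>m. ennreal (exponential_density 1 m)" 1 "- t"] by simp
  also have "\<dots> = 1"
    using prob_space.emeasure_space_1[OF prob_space_exponential_density[of 1]]
    by (simp add: emeasure_density)
  finally show ?thesis .
qed

text \<open>\<open>exp (- hazard x)\<close> is the Laplace functional of the points of a unit rate
  Poisson process after \<open>x\<close>; conditioning on the first point shows that it is
  invariant. Analytically, \<open>- exp (- (z - x)) * exp (- hazard z)\<close> is an antiderivative
  of the integrand off \<open>J\<close>.\<close>

lemma (in killing_rate) exponential_step:
  "(\<integral>\<^sup>+y. ennreal (exponential_density 1 y) * (ennreal (f (x + y)) * ennreal (exp (- hazard (x + y)))) \<partial>lborel)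
    = ennreal (exp (- hazard x))"
proof -
  define \<phi> where "\<phi> z = exp (- (z - x)) * (f z * exp (- hazard z))" for z
  have [measurable]: "\<phi> \<in> borel_measurable borel" unfolding \<phi>_def by measurable
  have \<phi>0: "0 \<le> \<phi> z" for z by (simp add: \<phi>_def f_range)
  have "(\<integral>\<^sup>+y. ennreal (exponential_density 1 y) * (ennreal (f (x + y)) * ennreal (exp (- hazard (x + y)))) \<partial>lborel)
    = (\<integral>\<^sup>+y. (if x \<le> x + y then ennreal (\<phi> (x + y)) else 0) \<partial>lborel)"
    by (intro nn_integral_cong) (auto simp: exponential_density_def \<phi>_def ennreal_mult f_range)
  also have "\<dots> = (\<integral>\<^sup>+z. (if x \<le> z then ennreal (\<phi> z) else 0) \<partial>lborel)"
    using nn_integral_real_affine[of "\<lambda>z. (if x \<le> z then ennreal (\<phi> z) else 0)" 1 x] by (simp cong: if_cong)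
  also have "\<dots> = ennreal (exp (- hazard x))"
  proof (cases "T \<le> x")
    case True
    then have "(\<integral>\<^sup>+z. (if x \<le> z then ennreal (\<phi> z) else 0) \<partial>lborel) = (\<integral>\<^sup>+z. (if x \<le> z then ennreal (exp (- (z - x))) else 0) \<partial>lborel)"
      by (intro nn_integral_cong) (auto simp: \<phi>_def f_end hazard_end)
    then show ?thesis using True by (simp add: nn_integral_exp_tail1 hazard_end)
  next
    case False
    then have xT: "x \<le> T" by simp
    define \<Phi> where "\<Phi> z = - exp (- (z - x)) * exp (- hazard z)" for z
    have "(\<phi> has_integral (\<Phi> T - \<Phi> x)) {x..T}"
    proof (rule fundamental_theorem_of_calculus_interior_strong[OF finite_J xT])
      fix z assume z: "z \<in> {x<..<T} - J"
      have "(\<Phi> has_real_derivative \<phi> z) (at z)"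
        unfolding \<Phi>_def \<phi>_def using z by (auto intro!: derivative_eq_intros hazard_deriv simp: algebra_simps)
      then show "(\<Phi> has_vector_derivative \<phi> z) (at z)"
        by (simp add: has_real_derivative_iff_has_vector_derivative)
    next
      show "continuous_on {x..T} \<Phi>"
        unfolding \<Phi>_def by (intro continuous_intros continuous_on_subset[OF hazard_continuous]) auto
    qed
    then have I: "integral {x..T} \<phi> = exp (- hazard x) - exp (- (T - x))"
      by (auto dest!: integral_unique simp: \<Phi>_def hazard_end)
    have \<phi>1: "0 \<le> \<phi> z \<and> \<phi> z \<le> 1" if "z \<in> {x..T}" for z
    proof -
      have "0 \<le> hazard z" using hazard_antimono[of z T] that hazard_end[of T] by auto
      then show ?thesis unfolding \<phi>_def using that f_range[of z] by (auto intro!: mult_le_one)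
    qed
    have "(\<integral>\<^sup>+z. (if x \<le> z then ennreal (\<phi> z) else 0) \<partial>lborel) =
      (\<integral>\<^sup>+z. (if x \<le> z \<and> z \<le> T then ennreal (\<phi> z) else 0) + ennreal (exp (- (T - x))) * (if T \<le> z then ennreal (exp (- (z - T))) else 0) \<partial>lborel)"
    proof (rule nn_integral_cong_AE)
      have e: "ennreal (\<phi> z) = ennreal (exp (- (T - x))) * ennreal (exp (- (z - T)))" if "T \<le> z" for z
        using that by (simp add: \<phi>_def f_end hazard_end flip: ennreal_mult exp_add)
      show "AE z in lborel. (if x \<le> z then ennreal (\<phi> z) else 0) = (if x \<le> z \<and> z \<le> T then ennreal (\<phi> z) else 0) + ennreal (exp (- (T - x))) * (if T \<le> z then ennreal (exp (- (z - T))) else 0)"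
        using AE_lborel_singleton[of T] by eventually_elim (use xT e in auto)
    qed
    also have "\<dots> = ennreal (integral {x..T} \<phi>) + ennreal (exp (- (T - x))) * 1"
      by (subst nn_integral_add, measurable, subst nn_integral_cmult, measurable,
          subst bounded_measurable_integrable_on(2)[of \<phi> x T 1])
         (use \<phi>1 in \<open>auto simp: nn_integral_exp_tail1[simplified]\<close>)
    also have "\<dots> = ennreal (integral {x..T} \<phi> + exp (- (T - x)))"
      using integral_nonneg[OF bounded_measurable_integrable_on(1)[of \<phi> x T 1]] \<phi>1 by simp
    finally show ?thesis by (simp add: I)
  qed
  finally show ?thesis .
qed

text \<open>The product of these weights over finitely many points equals the product over
  \<open>s\<close> of \<open>q s\<close> to the number of points up to \<open>a s\<close>. Levels
  are kept apart from indices because \<open>a\<close> will also be the population clock, which need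
  not be injective.\<close>

definition step_weight :: "real set \<Rightarrow> (real \<Rightarrow> real) \<Rightarrow> (real \<Rightarrow> real) \<Rightarrow> real \<Rightarrow> real" where
  "step_weight J a q x = (\<Prod>s\<in>J. if x \<le> a s then q s else 1)"

lemma killing_rate_step_weight:
  assumes J: "finite J" and q: "\<And>s. s \<in> J \<Longrightarrow> 0 \<le> q s \<and> q s \<le> 1" and T: "\<And>s. s \<in> J \<Longrightarrow> a s < T"
  shows "killing_rate (step_weight J a q) (a ` J) T"
proof
  show "step_weight J a q \<in> borel_measurable borel"
    unfolding step_weight_def by measurable
  show "0 \<le> step_weight J a q x" for x
    unfolding step_weight_def using q by (intro prod_nonneg) auto
  show "step_weight J a q x \<le> 1" for x
    unfolding step_weight_def using q by (intro prod_le_1) auto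
  show "finite (a ` J)" using J by simp
  show "isCont (step_weight J a q) x" if "x \<notin> a ` J" for x
    unfolding step_weight_def
  proof (rule continuous_prod)
    fix s assume "s \<in> J"
    then have "x < a s \<or> a s < x" using that by force
    then show "isCont (\<lambda>x. if x \<le> a s then q s else 1) x"
    proof
      assume x: "x < a s"
      have "continuous_on {..<a s} (\<lambda>x. if x \<le> a s then q s else 1)"
        by (rule continuous_on_eq[of _ "\<lambda>_. q s"]) auto
      then show ?thesis using x by (simp add: continuous_on_eq_continuous_at)
    next
      assume x: "a s < x"
      have "continuous_on {a s<..} (\<lambda>x. if x \<le> a s then q s else 1)"
        by (rule continuous_on_eq[of _ "\<lambda>_. 1"]) auto
      then show ?thesis using x by (simp add: continuous_on_eq_continuous_at)
    qed
  qed
  show "step_weight J a q x = 1" if "T \<le> x" for x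
    unfolding step_weight_def using T that by (intro prod.neutral) force
qed

text \<open>The mean of \<open>exp (- walk E n)\<close> is \<open>(1 / 2) ^ n\<close>, so the sum
  over \<open>n\<close> is almost surely finite and its terms tend to 0.\<close>

lemma (in prob_space) exponential_walk_at_top:
  assumes ind: "indep_vars (\<lambda>_. borel) E UNIV" and D: "\<And>i. distributed M lborel (E i) (exponential_density 1)"
  shows "AE \<omega> in M. (\<forall>i. 0 < E i \<omega>) \<and> filterlim (\<lambda>n. walk E n \<omega>) at_top sequentially"
proof -
  have E_pos: "AE \<omega> in M. \<forall>i. 0 < E i \<omega>"
    unfolding AE_all_countable
  proof
    fix i
    have "AE x in distr M lborel (E i). 0 < x"
      unfolding distributed_distr_eq_density[OF D[of i]]
      by (subst AE_density) (use AE_lborel_singleton[of "0::real"] in \<open>auto simp: exponential_density_def elim!: eventually_mono\<close>)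
    then show "AE \<omega> in M. 0 < E i \<omega>"
      by (subst (asm) AE_distr_iff) (use distributed_measurable[OF D[of i]] in auto)
  qed
  have [measurable]: "E i \<in> borel_measurable M" for i
    using distributed_measurable[OF D[of i]] by simp
  have [measurable]: "walk E n \<in> borel_measurable M" for n
    unfolding walk_def[abs_def] by measurable
  have step: "(\<integral>\<^sup>+y. ennreal (exponential_density 1 y) * ennreal (exp (- (x + y))) \<partial>lborel) = ennreal (1 / 2) * ennreal (exp (- x))" for x
  proof -
    have "(\<integral>\<^sup>+y. ennreal (exponential_density 1 y) * ennreal (exp (- (x + y))) \<partial>lborel) =
      (\<integral>\<^sup>+y. ennreal (exp (- x)) * (if 0 \<le> y then ennreal (exp (- 2 * (y - 0))) else 0) \<partial>lborel)"
      by (intro nn_integral_cong) (auto simp: exponential_density_def simp flip: ennreal_mult exp_add)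
    also have "\<dots> = ennreal (exp (- x)) * ennreal (1 / 2)"
      by (subst nn_integral_cmult, measurable) (simp only: nn_integral_exp_tail)
    finally show ?thesis by (simp add: mult.commute)
  qed
  have "(\<integral>\<^sup>+\<omega>. ennreal (exp (- walk E n \<omega>)) \<partial>M) = ennreal ((1 / 2) ^ n)" for n
  proof -
    have "((\<lambda>\<phi> x. \<integral>\<^sup>+y. ennreal (exponential_density 1 y) * \<phi> (x + y) \<partial>lborel) ^^ n) (\<lambda>x. ennreal (exp (- x))) = (\<lambda>x. ennreal ((1 / 2) ^ n) * ennreal (exp (- x)))"
    proof (induction n)
      case (Suc n)
      have "(\<integral>\<^sup>+y. ennreal (exponential_density 1 y) * (ennreal ((1 / 2) ^ n) * ennreal (exp (- (x + y)))) \<partial>lborel)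
        = ennreal ((1 / 2) ^ n) * (ennreal (1 / 2) * ennreal (exp (- x)))" for x
        unfolding step[symmetric] by (subst nn_integral_cmult[symmetric], measurable) (simp only: mult_ac)
      moreover have "ennreal ((1 / 2) ^ Suc n) = ennreal ((1 / 2) ^ n) * ennreal (1 / 2)"
        by (subst ennreal_mult[symmetric]) simp_all
      ultimately show ?case
        unfolding funpow.simps comp_def Suc by (simp only: mult.assoc)
    qed simp
    then show ?thesis
      using nn_integral_walk[OF ind D, of "\<lambda>_. 1" "\<lambda>x. ennreal (exp (- x))" n] by simp
  qed
  then have "(\<integral>\<^sup>+\<omega>. (\<Sum>n. ennreal (exp (- walk E n \<omega>))) \<partial>M) = (\<Sum>n. ennreal ((1 / 2) ^ n))"
    by (subst nn_integral_suminf) auto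
  also have "\<dots> = ennreal (\<Sum>n. (1 / 2) ^ n)"
    by (intro suminf_ennreal2 summable_geometric) auto
  finally have "(\<integral>\<^sup>+\<omega>. (\<Sum>n. ennreal (exp (- walk E n \<omega>))) \<partial>M) \<noteq> \<infinity>" by simp
  then have "AE \<omega> in M. (\<Sum>n. ennreal (exp (- walk E n \<omega>))) \<noteq> \<infinity>"
    by (intro nn_integral_PInf_AE) auto
  with E_pos show ?thesis
  proof eventually_elim
    case (elim \<omega>)
    then have "summable (\<lambda>n. exp (- walk E n \<omega>))"
      by (intro summable_suminf_not_top) auto
    then have "(\<lambda>n. exp (- walk E n \<omega>)) \<longlonglongrightarrow> 0" by (rule summable_LIMSEQ_zero)
    then have "filterlim (\<lambda>n. exp (- walk E n \<omega>)) (at_right 0) sequentially"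
      by (auto simp: filterlim_at)
    then have "filterlim (\<lambda>n. ln (exp (- walk E n \<omega>))) at_bot sequentially"
      by (rule filterlim_compose[OF ln_at_0])
    then show ?case using elim by (simp add: filterlim_uminus_at_top)
  qed
qed

text \<open>By \<open>exponential_step\<close> the weight of the first \<open>n\<close> points times
  \<open>exp (- hazard)\<close> at the last one has the same expectation for every \<open>n\<close>.
  Once the walk has passed \<open>T\<close> for good the product no longer changes, so dominated
  convergence identifies the limit with the value at \<open>n = 0\<close>.\<close>

lemma (in prob_space) poisson_pgf:
  assumes ind: "indep_vars (\<lambda>_. borel) E UNIV" and D: "\<And>i. distributed M lborel (E i) (exponential_density 1)"
    and J: "finite J" and q: "\<And>s. s \<in> J \<Longrightarrow> 0 \<le> q s \<and> q s \<le> 1" and T: "\<And>s. s \<in> J \<Longrightarrow> a s < T"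
  shows "(\<integral>\<^sup>+\<omega>. ennreal (\<Prod>s\<in>J. q s ^ card {n. walk E (Suc n) \<omega> \<le> a s}) \<partial>M) =
    ennreal (exp (- integral {0..T} (\<lambda>y. 1 - step_weight J a q y)))"
proof -
  interpret killing_rate "step_weight J a q" "a ` J" T
    by (rule killing_rate_step_weight[OF J q T])
  let ?f = "step_weight J a q"
  have [measurable]: "E i \<in> borel_measurable M" for i
    using distributed_measurable[OF D[of i]] by simp
  have [measurable]: "walk E n \<in> borel_measurable M" for n
    unfolding walk_def[abs_def] by measurable
  define U where "U y = ennreal (exp (- hazard y))" for y
  have [measurable]: "U \<in> borel_measurable borel" unfolding U_def by measurable
  have "((\<lambda>\<phi> x. \<integral>\<^sup>+y. ennreal (exponential_density 1 y) * (ennreal (?f (x + y)) * \<phi> (x + y)) \<partial>lborel) ^^ n) U = U" for n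
    by (induction n) (simp_all add: U_def[abs_def] exponential_step)
  then have W: "(\<integral>\<^sup>+\<omega>. (\<Prod>k=1..n. ennreal (?f (walk E k \<omega>))) * U (walk E n \<omega>) \<partial>M) = U 0" for n
    using nn_integral_walk[OF ind D, of "\<lambda>x. ennreal (?f x)" U n] by simp
  have "(\<lambda>n. \<integral>\<^sup>+\<omega>. (\<Prod>k=1..n. ennreal (?f (walk E k \<omega>))) * U (walk E n \<omega>) \<partial>M) \<longlonglongrightarrow>
    (\<integral>\<^sup>+\<omega>. ennreal (\<Prod>s\<in>J. q s ^ card {n. walk E (Suc n) \<omega> \<le> a s}) \<partial>M)"
  proof (rule nn_integral_dominated_convergence[where w = "\<lambda>_. 1"])
    have fin: "AE \<omega> in M. \<exists>N. \<forall>n\<ge>N. T < walk E n \<omega>"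
      using exponential_walk_at_top[OF ind D]
      by eventually_elim (auto simp: filterlim_at_top_dense eventually_sequentially)
    have lim: "(\<Prod>k=1..n. ennreal (?f (walk E k \<omega>))) * U (walk E n \<omega>) = ennreal (\<Prod>s\<in>J. q s ^ card {n. walk E (Suc n) \<omega> \<le> a s})"
      if N: "\<forall>n\<ge>N. T < walk E n \<omega>" and n: "n \<ge> N" for N n \<omega>
    proof -
      have "U (walk E n \<omega>) = 1" using N n by (simp add: U_def hazard_end less_imp_le)
      moreover have "(\<Prod>k=1..n. ?f (walk E k \<omega>)) = (\<Prod>s\<in>J. \<Prod>k=1..n. if walk E k \<omega> \<le> a s then q s else 1)"
        unfolding step_weight_def by (rule prod.swap)
      moreover have "(\<Prod>k=1..n. if walk E k \<omega> \<le> a s then q s else 1) = q s ^ card {n. walk E (Suc n) \<omega> \<le> a s}" if s: "s \<in> J" for s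
      proof -
        have "(\<Prod>k=1..n. if walk E k \<omega> \<le> a s then q s else 1) = (\<Prod>k\<in>{k\<in>{1..n}. walk E k \<omega> \<le> a s}. q s)"
          by (rule prod.inter_filter[symmetric]) simp
        also have "{k\<in>{1..n}. walk E k \<omega> \<le> a s} = Suc ` {n. walk E (Suc n) \<omega> \<le> a s}"
        proof safe
          fix k assume "k \<in> {1..n}" "walk E k \<omega> \<le> a s"
          then show "k \<in> Suc ` {n. walk E (Suc n) \<omega> \<le> a s}" by (cases k) auto
        next
          fix k assume k: "walk E (Suc k) \<omega> \<le> a s"
          have "\<not> Suc k \<ge> N"
          proof
            assume "Suc k \<ge> N"
            then have "T < walk E (Suc k) \<omega>" using N by blast
            then show False using T[OF s] k by linarith
          qed
          then show "Suc k \<in> {1..n}" using n by simp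
        qed
        finally show ?thesis by (simp add: card_image)
      qed
      ultimately show ?thesis
        using q by (simp add: prod_ennreal f_range)
    qed
    show "AE \<omega> in M. (\<lambda>n. (\<Prod>k=1..n. ennreal (?f (walk E k \<omega>))) * U (walk E n \<omega>)) \<longlonglongrightarrow> ennreal (\<Prod>s\<in>J. q s ^ card {n. walk E (Suc n) \<omega> \<le> a s})"
      using fin
    proof eventually_elim
      case (elim \<omega>)
      then obtain N where "\<forall>n\<ge>N. T < walk E n \<omega>" by blast
      from lim[OF this] show ?case
        by (intro tendsto_eventually) (auto simp: eventually_sequentially)
    qed
    have "hazard y \<ge> 0" for y
      using hazard_antimono[of y "max y T"] hazard_end[of "max y T"] by simp
    then have U1: "U y \<le> 1" for y by (simp add: U_def)
    have "(\<Prod>k=1..n. ennreal (?f (walk E k \<omega>))) * U (walk E n \<omega>) \<le> 1 * 1" for n \<omega>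
      by (intro mult_mono prod_le_1 U1) (auto simp: f_range)
    then show "AE \<omega> in M. (\<Prod>k=1..n. ennreal (?f (walk E k \<omega>))) * U (walk E n \<omega>) \<le> 1" for n
      by simp
  qed (auto simp: emeasure_space_1)
  then have "(\<integral>\<^sup>+\<omega>. ennreal (\<Prod>s\<in>J. q s ^ card {n. walk E (Suc n) \<omega> \<le> a s}) \<partial>M) = U 0"
    unfolding W by (simp add: LIMSEQ_const_iff)
  then show ?thesis by (simp add: U_def hazard_def)
qed

section \<open>Joint generating functions and counting functions\<close>

text \<open>After removing the vanishing lower coefficients and dividing by \<open>x ^ n\<close>,
  letting \<open>x\<close> decrease to 0 isolates the next coefficient; knowledge on
  \<open>(0, 1)\<close> is enough.\<close>

lemma power_series_zero_imp_coeff_zero: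
  fixes c :: "nat \<Rightarrow> real"
  assumes bd: "\<And>n. \<bar>c n\<bar> \<le> B" and z: "\<And>x. 0 < x \<Longrightarrow> x < 1 \<Longrightarrow> (\<Sum>n. c n * x ^ n) = 0"
  shows "c n = 0"
proof (induction n rule: less_induct)
  case (less n)
  have sm: "summable (\<lambda>i. c (i + k) * x ^ i)" if "norm x < 1" for x k
  proof (rule summable_comparison_test')
    show "summable (\<lambda>i. B * norm x ^ i)" using that by (intro summable_mult summable_geometric) simp
    show "norm (c (i + k) * x ^ i) \<le> B * norm x ^ i" if "i \<ge> 0" for i
      using bd[of "i + k"] by (simp add: abs_mult power_abs mult_right_mono)
  qed
  define g where "g x = (\<Sum>i. c (i + n) * x ^ i)" for x
  have g0: "g x = 0" if x: "0 < x" "x < 1" for x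
  proof -
    have "(\<Sum>i. c i * x ^ i) = (\<Sum>i. c (i + n) * x ^ (i + n)) + (\<Sum>i<n. c i * x ^ i)"
      by (rule suminf_split_initial_segment) (use sm[of x 0] x in auto)
    also have "(\<Sum>i<n. c i * x ^ i) = 0" using less.IH by (intro sum.neutral) auto
    also have "(\<Sum>i. c (i + n) * x ^ (i + n)) = x ^ n * g x"
      unfolding g_def using suminf_mult[OF sm[of x n], of "x ^ n"] x by (simp add: power_add mult_ac)
    finally show ?thesis using z[OF x] x by simp
  qed
  have "(g \<longlongrightarrow> c (0 + n)) (at 0)"
  proof (rule powser_limit_0[where s = 1 and a = "\<lambda>i. c (i + n)"])
    show "(\<lambda>i. c (i + n) * x ^ i) sums g x" if "norm x < 1" for x
      unfolding g_def using summable_sums[OF sm[OF that]] .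
  qed simp
  then have "(g \<longlongrightarrow> c n) (at_right 0)"
    by (simp add: filterlim_at_split)
  moreover have "(g \<longlongrightarrow> 0) (at_right 0)"
    by (rule tendsto_eventually) (auto simp: eventually_at_right_field intro!: exI[of _ 1] g0)
  ultimately show ?case by (intro tendsto_unique[of "at_right (0::real)"]) auto
qed

text \<open>Induction on \<open>J\<close>, comparing coefficients in the variable
  \<open>q j\<close>. The weights \<open>w\<close> and \<open>v\<close> carry the indicators of the
  coordinates already fixed.\<close>

lemma joint_pgf_unique:
  fixes Y :: "'i \<Rightarrow> 'a \<Rightarrow> nat" and Z :: "'i \<Rightarrow> 'b \<Rightarrow> nat"
  assumes P: "prob_space P" and Q: "prob_space Q" and J: "finite J"
    and [measurable]: "\<And>i. Y i \<in> P \<rightarrow>\<^sub>M count_space UNIV" "\<And>i. Z i \<in> Q \<rightarrow>\<^sub>M count_space UNIV"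
    and [measurable]: "w \<in> borel_measurable P" "v \<in> borel_measurable Q" and le: "\<And>\<omega>. w \<omega> \<le> 1" "\<And>\<omega>. v \<omega> \<le> (1::ennreal)"
    and eq: "\<And>q. (\<And>i. 0 \<le> q i \<and> q i \<le> (1::real)) \<Longrightarrow>
      (\<integral>\<^sup>+\<omega>. w \<omega> * ennreal (\<Prod>i\<in>J. q i ^ Y i \<omega>) \<partial>P) = (\<integral>\<^sup>+\<omega>. v \<omega> * ennreal (\<Prod>i\<in>J. q i ^ Z i \<omega>) \<partial>Q)"
  shows "(\<integral>\<^sup>+\<omega>. w \<omega> * of_bool (\<forall>i\<in>J. Y i \<omega> \<in> A i) \<partial>P) = (\<integral>\<^sup>+\<omega>. v \<omega> * of_bool (\<forall>i\<in>J. Z i \<omega> \<in> A i) \<partial>Q)"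
  using J assms(6-)
proof (induction J arbitrary: w v)
  case empty
  show ?case using empty.prems(5)[of "\<lambda>_. 1"] by simp
next
  case (insert j J)
  note [measurable] = insert.prems(1,2)
  have step: "(\<integral>\<^sup>+\<omega>. w \<omega> * of_bool (Y j \<omega> = n) * of_bool (\<forall>i\<in>J. Y i \<omega> \<in> A i) \<partial>P) = (\<integral>\<^sup>+\<omega>. v \<omega> * of_bool (Z j \<omega> = n) * of_bool (\<forall>i\<in>J. Z i \<omega> \<in> A i) \<partial>Q)" for n
  proof (rule insert.IH)
    show "w \<omega> * of_bool (Y j \<omega> = n) \<le> 1" for \<omega> using insert.prems(3)[of \<omega>] by (simp add: of_bool_def)
    show "v \<omega> * of_bool (Z j \<omega> = n) \<le> 1" for \<omega> using insert.prems(4)[of \<omega>] by (simp add: of_bool_def)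
    fix q :: "'i \<Rightarrow> real" assume q: "\<And>i. 0 \<le> q i \<and> q i \<le> 1"
    define a where "a n = (\<integral>\<^sup>+\<omega>. w \<omega> * of_bool (Y j \<omega> = n) * ennreal (\<Prod>i\<in>J. q i ^ Y i \<omega>) \<partial>P)" for n
    define b where "b n = (\<integral>\<^sup>+\<omega>. v \<omega> * of_bool (Z j \<omega> = n) * ennreal (\<Prod>i\<in>J. q i ^ Z i \<omega>) \<partial>Q)" for n
    have p1: "ennreal (\<Prod>i\<in>J. q i ^ y i) \<le> 1" for y :: "'i \<Rightarrow> nat"
      using q by (auto intro!: prod_le_1 power_le_one)
    have a1: "a n \<le> 1" for n
    proof -
      have "w \<omega> * of_bool (Y j \<omega> = n) * ennreal (\<Prod>i\<in>J. q i ^ Y i \<omega>) \<le> 1 * 1 * 1" for \<omega>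
        using insert.prems(3)[of \<omega>] p1 by (intro mult_mono) (auto simp: of_bool_def)
      then have "a n \<le> (\<integral>\<^sup>+\<omega>. 1 \<partial>P)" unfolding a_def by (intro nn_integral_mono) simp
      then show ?thesis by (simp add: prob_space.emeasure_space_1[OF P])
    qed
    have b1: "b n \<le> 1" for n
    proof -
      have "v \<omega> * of_bool (Z j \<omega> = n) * ennreal (\<Prod>i\<in>J. q i ^ Z i \<omega>) \<le> 1 * 1 * 1" for \<omega>
        using insert.prems(4)[of \<omega>] p1 by (intro mult_mono) (auto simp: of_bool_def)
      then have "b n \<le> (\<integral>\<^sup>+\<omega>. 1 \<partial>Q)" unfolding b_def by (intro nn_integral_mono) simp
      then show ?thesis by (simp add: prob_space.emeasure_space_1[OF Q])
    qed
    have ra: "ennreal (enn2real (a n)) = a n" "enn2real (a n) \<le> 1" for n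
      using a1[of n] by (auto simp: enn2real_leI intro!: ennreal_enn2real le_less_trans[OF a1])
    have rb: "ennreal (enn2real (b n)) = b n" "enn2real (b n) \<le> 1" for n
      using b1[of n] by (auto simp: enn2real_leI intro!: ennreal_enn2real le_less_trans[OF b1])
    have "enn2real (a n) - enn2real (b n) = 0" for n
    proof (rule power_series_zero_imp_coeff_zero)
      show "\<bar>enn2real (a n) - enn2real (b n)\<bar> \<le> 1" for n
        using ra[of n] rb[of n] enn2real_nonneg[of "a n"] enn2real_nonneg[of "b n"] by linarith
      fix x :: real assume x: "0 < x" "x < 1"
      have split: "u * ennreal (\<Prod>i\<in>insert j J. (q(j := x)) i ^ y i) =
        (\<Sum>n. ennreal (x ^ n) * (u * of_bool (y j = n) * ennreal (\<Prod>i\<in>J. q i ^ y i)))" for u and y :: "'i \<Rightarrow> nat"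
      proof -
        have "(\<Sum>n. ennreal (x ^ n) * (u * of_bool (y j = n) * ennreal (\<Prod>i\<in>J. q i ^ y i))) =
          (\<Sum>n\<in>{y j}. ennreal (x ^ n) * (u * of_bool (y j = n) * ennreal (\<Prod>i\<in>J. q i ^ y i)))"
          by (rule suminf_finite) auto
        moreover have "(\<Prod>i\<in>J. (q(j := x)) i ^ y i) = (\<Prod>i\<in>J. q i ^ y i)"
          using insert.hyps(2) by (intro prod.cong) auto
        ultimately show ?thesis
          using insert.hyps x q by (simp add: ennreal_mult prod_nonneg mult_ac)
      qed
      have sa: "summable (\<lambda>n. x ^ n * enn2real (a n))"
        by (rule summable_comparison_test'[OF summable_geometric[of x], of 0]) (use x ra in \<open>auto simp: mult_left_le\<close>)
      have sb: "summable (\<lambda>n. x ^ n * enn2real (b n))"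
        by (rule summable_comparison_test'[OF summable_geometric[of x], of 0]) (use x rb in \<open>auto simp: mult_left_le\<close>)
      have "(\<Sum>n. ennreal (x ^ n) * a n) = (\<Sum>n. ennreal (x ^ n) * b n)"
        using insert.prems(5)[of "q(j := x)"] q x unfolding split a_def b_def
        by (simp add: nn_integral_suminf nn_integral_cmult)
      also have "(\<Sum>n. ennreal (x ^ n) * a n) = ennreal (\<Sum>n. x ^ n * enn2real (a n))"
        using sa x by (subst suminf_ennreal2[symmetric]) (auto simp: ennreal_mult ra)
      also have "(\<Sum>n. ennreal (x ^ n) * b n) = ennreal (\<Sum>n. x ^ n * enn2real (b n))"
        using sb x by (subst suminf_ennreal2[symmetric]) (auto simp: ennreal_mult rb)
      finally have "(\<Sum>n. x ^ n * enn2real (a n)) = (\<Sum>n. x ^ n * enn2real (b n))"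
        using sa sb x by (subst (asm) ennreal_inj) (auto intro!: suminf_nonneg)
      then show "(\<Sum>n. (enn2real (a n) - enn2real (b n)) * x ^ n) = 0"
        using suminf_diff[OF sa sb] by (simp add: algebra_simps)
    qed
    then have "a n = b n" for n by (metis ra(1) rb(1) eq_iff_diff_eq_0)
    then show "(\<integral>\<^sup>+\<omega>. w \<omega> * of_bool (Y j \<omega> = n) * ennreal (\<Prod>i\<in>J. q i ^ Y i \<omega>) \<partial>P) = (\<integral>\<^sup>+\<omega>. v \<omega> * of_bool (Z j \<omega> = n) * ennreal (\<Prod>i\<in>J. q i ^ Z i \<omega>) \<partial>Q)"
      by (simp add: a_def b_def)
  qed measurable
  have split: "u * of_bool (\<forall>i\<in>insert j J. y i \<in> A i) = (\<Sum>n. of_bool (n \<in> A j) * (u * of_bool (y j = n) * of_bool (\<forall>i\<in>J. y i \<in> A i)))"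
    for u :: ennreal and y :: "'i \<Rightarrow> nat"
  proof -
    have "(\<Sum>n. of_bool (n \<in> A j) * (u * of_bool (y j = n) * of_bool (\<forall>i\<in>J. y i \<in> A i))) =
      (\<Sum>n\<in>{y j}. of_bool (n \<in> A j) * (u * of_bool (y j = n) * of_bool (\<forall>i\<in>J. y i \<in> A i)))"
      by (rule suminf_finite) auto
    then show ?thesis by simp
  qed
  have [measurable]: "Measurable.pred P (\<lambda>\<omega>. \<forall>i\<in>J. Y i \<omega> \<in> A i)" "Measurable.pred Q (\<lambda>\<omega>. \<forall>i\<in>J. Z i \<omega> \<in> A i)"
    using insert.hyps(1) by (intro pred_intros_finite; measurable)+
  have "(\<integral>\<^sup>+\<omega>. w \<omega> * of_bool (\<forall>i\<in>insert j J. Y i \<omega> \<in> A i) \<partial>P) =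
    (\<Sum>n. of_bool (n \<in> A j) * (\<integral>\<^sup>+\<omega>. w \<omega> * of_bool (Y j \<omega> = n) * of_bool (\<forall>i\<in>J. Y i \<omega> \<in> A i) \<partial>P))"
    unfolding split[of "w _" "\<lambda>i. Y i _"]
    by (subst nn_integral_suminf, measurable) (subst nn_integral_cmult, measurable)
  also have "\<dots> = (\<Sum>n. of_bool (n \<in> A j) * (\<integral>\<^sup>+\<omega>. v \<omega> * of_bool (Z j \<omega> = n) * of_bool (\<forall>i\<in>J. Z i \<omega> \<in> A i) \<partial>Q))"
    by (simp only: step)
  also have "\<dots> = (\<integral>\<^sup>+\<omega>. v \<omega> * of_bool (\<forall>i\<in>insert j J. Z i \<omega> \<in> A i) \<partial>Q)"
    unfolding split[of "v _" "\<lambda>i. Z i _"]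
    by (subst nn_integral_suminf, measurable) (subst nn_integral_cmult, measurable)
  finally show ?case .
qed

lemma distr_counts_eqI:
  fixes Y :: "'i \<Rightarrow> 'a \<Rightarrow> nat" and Z :: "'i \<Rightarrow> 'b \<Rightarrow> nat"
  assumes P: "prob_space P" and Q: "prob_space Q"
    and [measurable]: "\<And>i. Y i \<in> P \<rightarrow>\<^sub>M count_space UNIV" "\<And>i. Z i \<in> Q \<rightarrow>\<^sub>M count_space UNIV"
    and eq: "\<And>J q. finite J \<Longrightarrow> (\<And>i. 0 \<le> q i \<and> q i \<le> (1::real)) \<Longrightarrow>
      (\<integral>\<^sup>+\<omega>. ennreal (\<Prod>i\<in>J. q i ^ Y i \<omega>) \<partial>P) = (\<integral>\<^sup>+\<omega>. ennreal (\<Prod>i\<in>J. q i ^ Z i \<omega>) \<partial>Q)"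
  shows "distr P (\<Pi>\<^sub>M i\<in>UNIV. count_space UNIV) (\<lambda>\<omega> i. Y i \<omega>) = distr Q (\<Pi>\<^sub>M i\<in>UNIV. count_space UNIV) (\<lambda>\<omega> i. Z i \<omega>)"
proof (rule measure_eqI_PiM_infinite)
  let ?S = "(\<Pi>\<^sub>M i\<in>UNIV. count_space UNIV) :: ('i \<Rightarrow> nat) measure"
  have [measurable]: "(\<lambda>\<omega> i. Y i \<omega>) \<in> P \<rightarrow>\<^sub>M ?S" "(\<lambda>\<omega> i. Z i \<omega>) \<in> Q \<rightarrow>\<^sub>M ?S"
    by (auto intro!: measurable_PiM_single')
  interpret D: prob_space "distr P ?S (\<lambda>\<omega> i. Y i \<omega>)"
    by (rule prob_space.prob_space_distr[OF P]) simp
  show "finite_measure (distr P ?S (\<lambda>\<omega> i. Y i \<omega>))" by unfold_locales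
  fix A :: "'i \<Rightarrow> nat set" and J :: "'i set"
  assume J: "finite J"
  let ?C = "prod_emb UNIV (\<lambda>_. count_space UNIV) J (Pi\<^sub>E J A)"
  have [measurable]: "?C \<in> sets ?S" using J by (intro sets_PiM_I) auto
  have C: "indicator ?C y = (of_bool (\<forall>i\<in>J. y i \<in> A i) :: ennreal)" for y
    by (auto simp: prod_emb_def indicator_def PiE_iff)
  have "emeasure (distr P ?S (\<lambda>\<omega> i. Y i \<omega>)) ?C = (\<integral>\<^sup>+\<omega>. 1 * of_bool (\<forall>i\<in>J. Y i \<omega> \<in> A i) \<partial>P)"
    by (subst nn_integral_indicator[symmetric], simp, subst nn_integral_distr) (simp_all add: C)
  also have "\<dots> = (\<integral>\<^sup>+\<omega>. 1 * of_bool (\<forall>i\<in>J. Z i \<omega> \<in> A i) \<partial>Q)"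
    by (rule joint_pgf_unique[OF P Q J]) (use eq[OF J] in auto)
  also have "\<dots> = emeasure (distr Q ?S (\<lambda>\<omega> i. Z i \<omega>)) ?C"
    by (subst nn_integral_indicator[symmetric], simp, subst nn_integral_distr) (simp_all add: C)
  finally show "emeasure (distr P ?S (\<lambda>\<omega> i. Y i \<omega>)) ?C = emeasure (distr Q ?S (\<lambda>\<omega> i. Z i \<omega>)) ?C" .
qed simp_all

section \<open>Recovering a finite ordered set from its counting function\<close>

definition ordered_seq :: "real set \<Rightarrow> nat \<times> (nat \<Rightarrow> real)" where
  "ordered_seq E = fin_seq (card E) (\<lambda>k. if k = 0 then 0 else kth_element E k)"

text \<open>Only operations that are measurable on the product space are used: the total number is a
  limit along the naturals, and the \<open>k\<close>-th point is an infimum over the positive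
  rationals at which the count has reached \<open>k\<close>, with \<open>\<top>\<close> for those
  where it has not.\<close>

definition seq_of_counts :: "(real \<Rightarrow> nat) \<Rightarrow> nat \<times> (nat \<Rightarrow> real)" where
  "seq_of_counts c = fin_seq (nat \<lfloor>lim (\<lambda>n. real (c (real n)))\<rfloor>)
     (\<lambda>k. if k = 0 then 0 else enn2real (INF r\<in>\<rat> \<inter> {0<..}. if k \<le> c r then ennreal r else \<top>))"

lemma measurable_fin_seq [measurable (raw)]:
  assumes [measurable]: "n \<in> M \<rightarrow>\<^sub>M count_space UNIV" "\<And>k. (\<lambda>x. m x k) \<in> borel_measurable M"
  shows "(\<lambda>x. fin_seq (n x) (m x)) \<in> M \<rightarrow>\<^sub>M fin_seq_space"
  unfolding fin_seq_def fin_seq_space_def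
  by (intro measurable_Pair measurable_PiM_single') (auto)

lemma measurable_seq_of_counts [measurable]:
  "seq_of_counts \<in> (\<Pi>\<^sub>M t\<in>UNIV. count_space UNIV) \<rightarrow>\<^sub>M fin_seq_space"
proof -
  have [measurable]: "(\<lambda>c. c t) \<in> (\<Pi>\<^sub>M t\<in>UNIV. count_space UNIV :: nat measure) \<rightarrow>\<^sub>M count_space UNIV" for t :: real
    by (rule measurable_component_singleton) simp
  have cnt: "countable (\<rat> \<inter> {0<..} :: real set)" by (intro countable_Int1 countable_rat)
  show ?thesis
    unfolding seq_of_counts_def[abs_def]
  proof (rule measurable_fin_seq)
    have "(\<lambda>x::int. nat x) \<in> count_space UNIV \<rightarrow>\<^sub>M count_space UNIV" by simp
    then show "(\<lambda>c. nat \<lfloor>lim (\<lambda>n. real (c (real n)))\<rfloor>) \<in> (\<Pi>\<^sub>M t\<in>UNIV. count_space UNIV) \<rightarrow>\<^sub>M count_space UNIV"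
      by (rule measurable_compose[rotated]) measurable
    show "(\<lambda>c. if k = 0 then 0 else enn2real (INF r\<in>\<rat> \<inter> {0<..}. if k \<le> c r then ennreal r else \<top>)) \<in> borel_measurable (\<Pi>\<^sub>M t\<in>UNIV. count_space UNIV)" for k
    proof -
      have [measurable]: "(\<lambda>c. INF r\<in>\<rat> \<inter> {0<..}. if k \<le> c r then ennreal r else \<top>) \<in> borel_measurable (\<Pi>\<^sub>M t\<in>UNIV. count_space UNIV)"
        by (intro borel_measurable_INF[OF cnt]) measurable
      show ?thesis by measurable
    qed
  qed
qed

lemma strict_mono_card_le:
  fixes E :: "real set"
  assumes "finite E" "t \<in> E" "s < t"
  shows "card {x\<in>E. x \<le> s} < card {x\<in>E. x \<le> t}"
proof (rule psubset_card_mono)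
  have "t \<in> {x\<in>E. x \<le> t} - {x\<in>E. x \<le> s}" using assms by simp
  moreover have "{x\<in>E. x \<le> s} \<subseteq> {x\<in>E. x \<le> t}" using assms by auto
  ultimately show "{x\<in>E. x \<le> s} \<subset> {x\<in>E. x \<le> t}" by blast
qed (use assms in simp)

lemma kth_element_eqI:
  assumes "finite E" "t \<in> E" "card {s\<in>E. s \<le> t} = k"
  shows "kth_element E k = t"
  unfolding kth_element_def
proof (rule the_equality)
  fix s assume "s \<in> E \<and> card {x\<in>E. x \<le> s} = k"
  then show "s = t"
    using strict_mono_card_le[OF assms(1), of s t] strict_mono_card_le[OF assms(1), of t s] assms
    by (cases s t rule: linorder_cases) auto
qed (use assms in auto)

lemma card_le_nth:
  fixes xs :: "real list"
  assumes "sorted_wrt (<) xs" "i < length xs"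
  shows "card {s\<in>set xs. s \<le> xs ! i} = Suc i"
proof -
  have "{s\<in>set xs. s \<le> xs ! i} = (\<lambda>j. xs ! j) ` {..i}"
  proof safe
    fix s assume "s \<in> set xs" "s \<le> xs ! i"
    then obtain j where "j < length xs" "s = xs ! j" by (auto simp: in_set_conv_nth)
    moreover have "\<not> i < j" using \<open>s \<le> xs ! i\<close> calculation sorted_wrt_nth_less[OF assms(1), of i j] by auto
    ultimately show "s \<in> (\<lambda>j. xs ! j) ` {..i}" by auto
  next
    fix j assume "j \<le> i"
    then show "xs ! j \<in> set xs" "xs ! j \<le> xs ! i"
      using assms sorted_wrt_nth_less[OF assms(1), of j i] by (auto simp: le_less)
  qed
  moreover have "inj_on (\<lambda>j. xs ! j) {..i}"
    using assms by (auto simp: inj_on_def nth_eq_iff_index_eq strict_sorted_iff)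
  ultimately show ?thesis by (simp add: card_image)
qed

lemma kth_element_nth:
  assumes "sorted_wrt (<) xs" "i < length xs"
  shows "kth_element (set xs) (Suc i) = xs ! i"
  by (rule kth_element_eqI) (use assms card_le_nth in auto)

lemma seq_of_counts_card:
  assumes E: "finite E" "E \<subseteq> {0<..}"
  shows "seq_of_counts (\<lambda>t. card (E \<inter> {..t})) = ordered_seq E"
proof -
  obtain N where N: "\<forall>x\<in>E. x \<le> real N"
  proof -
    obtain b where "\<forall>x\<in>E. x \<le> b" using bdd_above_finite[OF E(1)] by (auto simp: bdd_above_def)
    moreover obtain N where "b \<le> real N" using real_arch_simple by blast
    ultimately show ?thesis by (intro that[of N]) force
  qed
  have "(\<lambda>n. real (card (E \<inter> {..real n}))) \<longlonglongrightarrow> real (card E)"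
  proof (rule tendsto_eventually)
    have "E \<inter> {..real n} = E" if "n \<ge> N" for n
      using N that by (force intro: order.trans)
    then show "\<forall>\<^sub>F n in sequentially. real (card (E \<inter> {..real n})) = real (card E)"
      by (auto simp: eventually_sequentially intro!: exI[of _ N])
  qed
  then have total: "nat \<lfloor>lim (\<lambda>n. real (card (E \<inter> {..real n})))\<rfloor> = card E"
    by (simp add: limI)
  have kth: "enn2real (INF r\<in>\<rat> \<inter> {0<..}. if k \<le> card (E \<inter> {..r}) then ennreal r else \<top>) = kth_element E k"
    if k: "0 < k" "k \<le> card E" for k
  proof -
    define xs where "xs = sorted_list_of_set E"
    have xs: "sorted_wrt (<) xs" "set xs = E" "length xs = card E"
      using E by (simp_all add: xs_def)
    obtain i where i: "k = Suc i" "i < length xs" using k xs by (cases k) auto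
    define t where "t = xs ! i"
    have t: "t \<in> E" "0 < t" "card {s\<in>E. s \<le> t} = k" "kth_element E k = t"
      using i xs card_le_nth[OF xs(1) i(2)] kth_element_nth[OF xs(1) i(2)] E nth_mem[OF i(2)] by (auto simp: t_def)
    have int: "E \<inter> {..r} = {s\<in>E. s \<le> r}" for r by auto
    have iff: "k \<le> card (E \<inter> {..r}) \<longleftrightarrow> t \<le> r" for r
    proof
      assume "t \<le> r"
      then have "{s\<in>E. s \<le> t} \<subseteq> {s\<in>E. s \<le> r}" by auto
      from card_mono[OF _ this] show "k \<le> card (E \<inter> {..r})" using t(3) E by (simp add: int)
    next
      assume "k \<le> card (E \<inter> {..r})"
      then show "t \<le> r" using strict_mono_card_le[OF E(1) t(1), of r] t(3) by (force simp: int)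
    qed
    have "(INF r\<in>\<rat> \<inter> {0<..}. if k \<le> card (E \<inter> {..r}) then ennreal r else \<top>) = ennreal t"
    proof (rule antisym)
      show "ennreal t \<le> (INF r\<in>\<rat> \<inter> {0<..}. if k \<le> card (E \<inter> {..r}) then ennreal r else \<top>)"
        by (rule INF_greatest) (auto simp: iff intro: ennreal_leI)
      show "(INF r\<in>\<rat> \<inter> {0<..}. if k \<le> card (E \<inter> {..r}) then ennreal r else \<top>) \<le> ennreal t"
      proof (rule ennreal_le_epsilon)
        fix e :: real assume e: "0 < e"
        obtain r where r: "r \<in> \<rat>" "t < r" "r < t + e" using Rats_dense_in_real[of t "t + e"] e by auto
        then have "(INF r\<in>\<rat> \<inter> {0<..}. if k \<le> card (E \<inter> {..r}) then ennreal r else \<top>) \<le> ennreal r"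
          using t by (intro INF_lower2[of r]) (auto simp: iff)
        also have "\<dots> \<le> ennreal t + ennreal e" using r t e by (simp flip: ennreal_plus add: ennreal_leI)
        finally show "(INF r\<in>\<rat> \<inter> {0<..}. if k \<le> card (E \<inter> {..r}) then ennreal r else \<top>) \<le> ennreal t + ennreal e" .
      qed
    qed
    then show ?thesis using t by simp
  qed
  show ?thesis
    unfolding seq_of_counts_def ordered_seq_def total fin_seq_def
  proof (intro arg_cong2[where f = Pair] refl ext)
    fix k
    show "(if k \<le> card E then if k = 0 then 0 else enn2real (INF r\<in>\<rat> \<inter> {0<..}. if k \<le> card (E \<inter> {..r}) then ennreal r else \<top>) else 0) =
      (if k \<le> card E then if k = 0 then 0 else kth_element E k else 0)"
      using kth[of k] by (cases "k = 0"; cases "k \<le> card E") simp_all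
  qed
qed

lemma measurable_completion_AE:
  assumes g: "g \<in> M \<rightarrow>\<^sub>M N" and ae: "AE x in M. f x = g x" and sp: "f \<in> space M \<rightarrow> space N"
  shows "f \<in> completion M \<rightarrow>\<^sub>M N" "distr (completion M) N f = distr M N g"
proof -
  have ae': "AE x in completion M. f x = g x" using ae by (rule AE_completion)
  have g': "g \<in> completion M \<rightarrow>\<^sub>M N" using g by (rule measurable_completion)
  show f: "f \<in> completion M \<rightarrow>\<^sub>M N"
  proof (rule measurableI)
    fix A assume A: "A \<in> sets N"
    show "f -` A \<inter> space (completion M) \<in> sets (completion M)"
    proof (rule completion.in_sets_AE)
      show "g -` A \<inter> space (completion M) \<in> sets (completion M)" using g' A by (rule measurable_sets)
      show "AE x in completion M. (x \<in> g -` A \<inter> space (completion M)) = (x \<in> f -` A \<inter> space (completion M))"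
        using ae' by eventually_elim auto
    qed auto
  qed (use sp in auto)
  have "distr (completion M) N f = distr (completion M) N g"
    using ae' f g' by (intro distr_cong_AE) auto
  then show "distr (completion M) N f = distr M N g"
    using distr_completion[OF g] by simp
qed

text \<open>\<open>C\<close> and \<open>D\<close> are measurable everywhere but count the points
  only almost surely. Equality of the laws is reduced to joint generating functions of counts at
  finitely many levels, and the null sets are absorbed by the completions.\<close>

lemma same_law_ordered_seqI:
  fixes C :: "real \<Rightarrow> 'a \<Rightarrow> nat" and D :: "real \<Rightarrow> 'b \<Rightarrow> nat"
  assumes P: "prob_space P" and Q: "prob_space Q"
    and [measurable]: "\<And>t. C t \<in> P \<rightarrow>\<^sub>M count_space UNIV" "\<And>t. D t \<in> Q \<rightarrow>\<^sub>M count_space UNIV"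
    and C: "AE \<omega> in P. finite (E \<omega>) \<and> E \<omega> \<subseteq> {0<..} \<and> (\<forall>t. C t \<omega> = card (E \<omega> \<inter> {..t})) \<and> f \<omega> = ordered_seq (E \<omega>)"
    and D: "AE \<omega> in Q. finite (F \<omega>) \<and> F \<omega> \<subseteq> {0<..} \<and> (\<forall>t. D t \<omega> = card (F \<omega> \<inter> {..t})) \<and> g \<omega> = ordered_seq (F \<omega>)"
    and eq: "\<And>J q. finite J \<Longrightarrow> (\<And>i. 0 \<le> q i \<and> q i \<le> (1::real)) \<Longrightarrow>
      (\<integral>\<^sup>+\<omega>. ennreal (\<Prod>t\<in>J. q t ^ C t \<omega>) \<partial>P) = (\<integral>\<^sup>+\<omega>. ennreal (\<Prod>t\<in>J. q t ^ D t \<omega>) \<partial>Q)"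
  shows "same_law P f Q g fin_seq_space"
proof -
  let ?S = "(\<Pi>\<^sub>M i\<in>UNIV. count_space UNIV) :: (real \<Rightarrow> nat) measure"
  have m1 [measurable]: "(\<lambda>\<omega> t. C t \<omega>) \<in> P \<rightarrow>\<^sub>M ?S"
    by (auto intro!: measurable_PiM_single')
  have m2 [measurable]: "(\<lambda>\<omega> t. D t \<omega>) \<in> Q \<rightarrow>\<^sub>M ?S"
    by (auto intro!: measurable_PiM_single')
  have sp: "space fin_seq_space = UNIV"
    by (simp add: fin_seq_space_def space_pair_measure space_PiM)
  have aeP: "AE \<omega> in P. f \<omega> = seq_of_counts (\<lambda>t. C t \<omega>)"
    using C by eventually_elim (auto simp: seq_of_counts_card)
  have aeQ: "AE \<omega> in Q. g \<omega> = seq_of_counts (\<lambda>t. D t \<omega>)"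
    using D by eventually_elim (auto simp: seq_of_counts_card)
  have mP: "(\<lambda>\<omega>. seq_of_counts (\<lambda>t. C t \<omega>)) \<in> P \<rightarrow>\<^sub>M fin_seq_space"
    using measurable_compose[OF m1 measurable_seq_of_counts] .
  have mQ: "(\<lambda>\<omega>. seq_of_counts (\<lambda>t. D t \<omega>)) \<in> Q \<rightarrow>\<^sub>M fin_seq_space"
    using measurable_compose[OF m2 measurable_seq_of_counts] .
  have "distr P fin_seq_space (\<lambda>\<omega>. seq_of_counts (\<lambda>t. C t \<omega>)) = distr (distr P ?S (\<lambda>\<omega> t. C t \<omega>)) fin_seq_space seq_of_counts"
    by (subst distr_distr[OF measurable_seq_of_counts m1]) (simp add: comp_def)
  also have "\<dots> = distr (distr Q ?S (\<lambda>\<omega> t. D t \<omega>)) fin_seq_space seq_of_counts"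
    by (subst distr_counts_eqI[OF P Q]) (use eq in auto)
  also have "\<dots> = distr Q fin_seq_space (\<lambda>\<omega>. seq_of_counts (\<lambda>t. D t \<omega>))"
    by (subst distr_distr[OF measurable_seq_of_counts m2]) (simp add: comp_def)
  finally show ?thesis
    unfolding same_law_def
    using measurable_completion_AE[OF mP aeP] measurable_completion_AE[OF mQ aeQ] by (simp add: sp)
qed

section \<open>The order statistics of the walk\<close>

definition walk_excursion :: "(nat \<Rightarrow> 'a \<Rightarrow> real) \<Rightarrow> nat \<Rightarrow> 'a \<Rightarrow> bool" where
  "walk_excursion X n \<omega> \<longleftrightarrow> (\<forall>k\<in>{1..n}. 0 \<le> walk X k \<omega>) \<and> walk X (Suc n) \<omega> < 0"

text \<open>The start \<open>walk X 0 = 0\<close> is left out: it has rank 0, and the points listed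
  here receive the ranks from 1 on.\<close>

definition walk_points :: "(nat \<Rightarrow> 'a \<Rightarrow> real) \<Rightarrow> 'a \<Rightarrow> real set" where
  "walk_points X \<omega> = (\<lambda>k. walk X k \<omega>) ` {1..walk_nu X \<omega>}"

text \<open>A sum over indices is measurable and turns into a product in generating functions; on an
  excursion without ties it agrees with the cardinality of \<open>walk_points\<close> up to
  \<open>t\<close>.\<close>

definition walk_count :: "(nat \<Rightarrow> 'a \<Rightarrow> real) \<Rightarrow> real \<Rightarrow> 'a \<Rightarrow> nat" where
  "walk_count X t \<omega> = (\<Sum>k=1..walk_nu X \<omega>. of_bool (walk X k \<omega> \<le> t))"

lemma walk_excursion_imp:
  assumes "walk_excursion X n \<omega>"
  shows "tau_minus X \<omega> = Suc n" "walk_nu X \<omega> = n"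
proof -
  have "Suc n \<le> k" if "1 \<le> k" "walk X k \<omega> < 0" for k
  proof (rule ccontr)
    assume "\<not> Suc n \<le> k"
    then have "k \<in> {1..n}" using that by auto
    then have "0 \<le> walk X k \<omega>" using assms unfolding walk_excursion_def by blast
    then show False using that by simp
  qed
  then show "tau_minus X \<omega> = Suc n"
    unfolding tau_minus_def using assms
    by (intro cInf_eq_minimum) (auto simp: walk_excursion_def)
  then show "walk_nu X \<omega> = n" by (simp add: walk_nu_def)
qed

lemma walk_excursion_unique: "walk_excursion X n \<omega> \<Longrightarrow> walk_excursion X m \<omega> \<Longrightarrow> n = m"
  using walk_excursion_imp(2) by metis

text \<open>Without ties every point after the start is strictly positive, being nonnegative and
  different from \<open>walk X 0\<close>. Sorting then puts the start in front of the sorted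
  points.\<close>

lemma walk_excursion_order_stat:
  assumes n: "walk_excursion X n \<omega>" and d: "\<And>i j. i < j \<Longrightarrow> walk X i \<omega> \<noteq> walk X j \<omega>"
  shows "walk_order_stat X 0 \<omega> = 0"
    and "\<And>k. k < n \<Longrightarrow> walk_order_stat X k \<omega> < walk_order_stat X (Suc k) \<omega>"
    and "finite (walk_points X \<omega>)" "walk_points X \<omega> \<subseteq> {0<..}"
    and "walk_seq X \<omega> = ordered_seq (walk_points X \<omega>)"
    and "\<And>t. walk_count X t \<omega> = card (walk_points X \<omega> \<inter> {..t})"
proof -
  note nu = walk_excursion_imp(2)[OF n]
  let ?S = "\<lambda>k. walk X k \<omega>"
  have S0: "?S 0 = 0" by (simp add: walk_def)
  have inj: "inj ?S"
    using d by (auto simp: inj_def) (metis linorder_neqE_nat)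
  show fin: "finite (walk_points X \<omega>)" by (simp add: walk_points_def)
  show pos: "walk_points X \<omega> \<subseteq> {0<..}"
  proof
    fix x assume "x \<in> walk_points X \<omega>"
    then obtain k where k: "k \<in> {1..n}" "x = ?S k" by (auto simp: walk_points_def nu)
    then have "0 \<le> x" using n unfolding walk_excursion_def by blast
    moreover have "x \<noteq> 0" using d[of 0 k] k S0 by auto
    ultimately show "x \<in> {0<..}" by simp
  qed
  define ys where "ys = sorted_list_of_set (walk_points X \<omega>)"
  have ys: "sorted_wrt (<) ys" "set ys = walk_points X \<omega>" "length ys = card (walk_points X \<omega>)"
    using fin by (simp_all add: ys_def)
  have card: "card (walk_points X \<omega>) = n"
    unfolding walk_points_def nu using inj by (subst card_image) (auto simp: inj_on_def)
  have srt: "sorted_wrt (<) (0 # ys)" using ys pos by auto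
  have "sort (map ?S [0..<Suc n]) = 0 # ys"
  proof (rule sorted_distinct_set_unique)
    show "distinct (sort (map ?S [0..<Suc n]))"
      using inj by (simp add: distinct_map inj_on_def del: upt_Suc)
    have "{0..<Suc n} = insert 0 {1..n}" by auto
    then show "set (sort (map ?S [0..<Suc n])) = set (0 # ys)"
      by (simp add: ys walk_points_def nu S0 del: upt_Suc)
  qed (use srt in \<open>auto simp: strict_sorted_iff\<close>)
  then have os: "walk_order_stat X k \<omega> = (0 # ys) ! k" for k
    by (simp add: walk_order_stat_def nu)
  show "walk_order_stat X 0 \<omega> = 0" by (simp add: os)
  show "walk_order_stat X k \<omega> < walk_order_stat X (Suc k) \<omega>" if "k < n" for k
    unfolding os by (rule sorted_wrt_nth_less[OF srt]) (use that ys card in auto)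
  have "walk_order_stat X k \<omega> = kth_element (walk_points X \<omega>) k" if "k \<noteq> 0" "k \<le> n" for k
    using that kth_element_nth[OF ys(1), of "k - 1"] by (cases k) (auto simp: os ys card)
  then show "walk_seq X \<omega> = ordered_seq (walk_points X \<omega>)"
    by (auto simp: walk_seq_def ordered_seq_def fin_seq_def nu card os fun_eq_iff)
  show "walk_count X t \<omega> = card (walk_points X \<omega> \<inter> {..t})" for t
  proof -
    have "walk_points X \<omega> \<inter> {..t} = ?S ` {k\<in>{1..n}. ?S k \<le> t}"
      by (auto simp: walk_points_def nu)
    also have "card \<dots> = card {k\<in>{1..n}. ?S k \<le> t}"
      using inj by (intro card_image) (auto simp: inj_on_def)
    also have "\<dots> = walk_count X t \<omega>"
      unfolding walk_count_def nu of_bool_def card_eq_sum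
      by (rule sum.inter_filter) simp
    finally show ?thesis by simp
  qed
qed

text \<open>The tail of the Laplace law beyond \<open>x \<ge> 0\<close> equals its density there.
  Hence \<open>excursion_weight f 0 0\<close> is a genuine exit probability at nonnegative
  positions.\<close>

lemma laplace_tail:
  assumes "0 \<le> x"
  shows "(\<integral>\<^sup>+y. ennreal (1 / 2 * exp (- \<bar>y\<bar>)) * of_bool (x + y < 0) \<partial>lborel) = ennreal (1 / 2 * exp (- x))"
proof -
  have "(\<integral>\<^sup>+y. ennreal (1 / 2 * exp (- \<bar>y\<bar>)) * of_bool (x + y < 0) \<partial>lborel) =
    (\<integral>\<^sup>+z. ennreal (1 / 2 * exp (- \<bar>- z\<bar>)) * of_bool (x + (- z) < 0) \<partial>lborel)"
    using nn_integral_real_affine[of "\<lambda>y. ennreal (1 / 2 * exp (- \<bar>y\<bar>)) * of_bool (x + y < 0)" "- 1" 0] by simp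
  also have "\<dots> = (\<integral>\<^sup>+z. ennreal (1 / 2 * exp (- x)) * (if x \<le> z then ennreal (exp (- (z - x))) else 0) \<partial>lborel)"
  proof (rule nn_integral_cong_AE)
    have e: "ennreal (1 / 2 * exp (- \<bar>- z\<bar>)) = ennreal (1 / 2 * exp (- x)) * ennreal (exp (- (z - x)))" if "x < z" for z
      using that assms by (subst ennreal_mult[symmetric]) (simp_all flip: exp_add)
    show "AE z in lborel. ennreal (1 / 2 * exp (- \<bar>- z\<bar>)) * of_bool (x + (- z) < 0) = ennreal (1 / 2 * exp (- x)) * (if x \<le> z then ennreal (exp (- (z - x))) else 0)"
      using AE_lborel_singleton[of x]
    proof eventually_elim
      case (elim z)
      then show ?case using e[of z] by (cases "x < z") (simp_all only: mult_1_right of_bool_eq if_True, simp_all)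
    qed
  qed
  also have "\<dots> = ennreal (1 / 2 * exp (- x)) * 1"
    by (subst nn_integral_cmult, measurable) (simp only: nn_integral_exp_tail1)
  finally show ?thesis by simp
qed

context prob_space
begin

context
  fixes X :: "nat \<Rightarrow> 'a \<Rightarrow> real"
  assumes ind: "indep_vars (\<lambda>_. borel) X UNIV"
    and D: "\<And>i. distributed M lborel (X i) (\<lambda>x. ennreal (1 / 2 * exp (- \<bar>x\<bar>)))"
begin

lemma measurable_X: "X i \<in> borel_measurable M"
  using distributed_measurable[OF D[of i]] by simp

lemma measurable_walk: "walk X n \<in> borel_measurable M"
  using measurable_X unfolding walk_def[abs_def] by measurable

lemma measurable_walk_excursion: "Measurable.pred M (walk_excursion X n)"
  using measurable_walk unfolding walk_excursion_def[abs_def] by measurable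

lemma measurable_walk_nu: "walk_nu X \<in> M \<rightarrow>\<^sub>M count_space UNIV"
proof -
  note [measurable] = measurable_walk
  have "walk_nu X = (\<lambda>\<omega>. (LEAST k. 1 \<le> k \<and> walk X k \<omega> < 0) - 1)"
    by (simp add: walk_nu_def tau_minus_def Inf_nat_def fun_eq_iff)
  then show ?thesis by simp
qed

lemma measurable_walk_count: "walk_count X t \<in> M \<rightarrow>\<^sub>M count_space UNIV"
proof -
  note [measurable] = measurable_walk measurable_walk_nu
  have "(\<lambda>\<omega>. (\<lambda>n \<omega>. \<Sum>k=1..n. of_bool (walk X k \<omega> \<le> t) :: nat) (walk_nu X \<omega>) \<omega>) \<in> M \<rightarrow>\<^sub>M count_space UNIV"
    by (rule measurable_compose_countable) measurable
  then show ?thesis by (simp add: walk_count_def[abs_def])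
qed

text \<open>The sign constraints are moved into the weight \<open>g\<close>, which vanishes on the
  negative half line; the restriction to an excursion thus becomes part of the product and the
  kernel iteration applies.\<close>

lemma nn_integral_walk_excursion:
  assumes [measurable]: "f \<in> borel_measurable borel"
  shows "(\<integral>\<^sup>+\<omega>. (\<Prod>k=1..n. f (walk X k \<omega>)) * of_bool (walk_excursion X n \<omega>) \<partial>M) = excursion_weight f n 0 0"
proof -
  note [measurable] = measurable_walk measurable_walk_excursion
  define g where "g x = f x * of_bool (0 \<le> x)" for x
  have [measurable]: "g \<in> borel_measurable borel" unfolding g_def by measurable
  have "(\<Prod>k=1..n. f (walk X k \<omega>)) * of_bool (walk_excursion X n \<omega>) =
    (\<Prod>k=1..n. g (walk X k \<omega>)) * of_bool (walk X (Suc n) \<omega> < 0)" for \<omega>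
  proof (cases "\<forall>k\<in>{1..n}. 0 \<le> walk X k \<omega>")
    case True
    then show ?thesis unfolding g_def walk_excursion_def by (auto intro!: prod.cong)
  next
    case False
    then have "(\<Prod>k=1..n. g (walk X k \<omega>)) = 0" unfolding g_def by (intro prod_zero) auto
    then show ?thesis using False unfolding walk_excursion_def by auto
  qed
  then have "(\<integral>\<^sup>+\<omega>. (\<Prod>k=1..n. f (walk X k \<omega>)) * of_bool (walk_excursion X n \<omega>) \<partial>M) =
    (\<integral>\<^sup>+\<omega>. (\<Prod>k=1..n. g (walk X k \<omega>)) * of_bool (walk X (Suc n) \<omega> < 0) \<partial>M)"
    by simp
  also have "\<dots> = (\<integral>\<^sup>+\<omega>. (\<Prod>k=1..n. g (walk X k \<omega>)) *
      (\<integral>\<^sup>+y. ennreal (1 / 2 * exp (- \<bar>y\<bar>)) * of_bool (walk X n \<omega> + y < 0) \<partial>lborel) \<partial>M)"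
    by (rule nn_integral_walk_step[OF ind D]) measurable
  also have "\<dots> = (\<integral>\<^sup>+\<omega>. (\<Prod>k=1..n. g (walk X k \<omega>)) * excursion_weight f 0 0 (walk X n \<omega>) \<partial>M)"
  proof (rule nn_integral_cong)
    fix \<omega>
    show "(\<Prod>k=1..n. g (walk X k \<omega>)) * (\<integral>\<^sup>+y. ennreal (1 / 2 * exp (- \<bar>y\<bar>)) * of_bool (walk X n \<omega> + y < 0) \<partial>lborel)
       = (\<Prod>k=1..n. g (walk X k \<omega>)) * excursion_weight f 0 0 (walk X n \<omega>)"
    proof (cases "0 \<le> walk X n \<omega>")
      case True
      have "excursion_weight f 0 0 (walk X n \<omega>) = ennreal (1 / 2 * exp (- walk X n \<omega>))"
        unfolding excursion_weight.simps using True by simp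
      then show ?thesis by (simp only: laplace_tail[OF True])
    next
      case False
      \<comment> \<open>A negative position excludes \<open>n = 0\<close>, as the walk starts at 0,
        so the factor \<open>k = n\<close> occurs in the product and vanishes.\<close>
      then have "n \<in> {1..n}" by (cases n) (auto simp: walk_def)
      then have z: "(\<Prod>k=1..n. g (walk X k \<omega>)) = 0"
        using False by (intro prod_zero) (auto simp: g_def intro!: bexI[of _ n])
      show ?thesis by (simp only: z mult_zero_left)
    qed
  qed
  also have "\<dots> = ((\<lambda>\<phi> x. \<integral>\<^sup>+y. ennreal (1 / 2 * exp (- \<bar>y\<bar>)) * (g (x + y) * \<phi> (x + y)) \<partial>lborel) ^^ n) (excursion_weight f 0 0) 0"
    by (rule nn_integral_walk[OF ind D]) measurable
  also have "((\<lambda>\<phi> x. \<integral>\<^sup>+y. ennreal (1 / 2 * exp (- \<bar>y\<bar>)) * (g (x + y) * \<phi> (x + y)) \<partial>lborel) ^^ n) (excursion_weight f 0 0) = excursion_weight f n 0"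
  proof (induction n)
    case (Suc n)
    have "(\<integral>\<^sup>+y. ennreal (1 / 2 * exp (- \<bar>y\<bar>)) * (g (x + y) * excursion_weight f n 0 (x + y)) \<partial>lborel) = excursion_weight f (Suc n) 0 x" for x
    proof -
      have "excursion_weight f (Suc n) 0 x = (\<integral>\<^sup>+z. ennreal (1 / 2 * exp (- \<bar>x - z\<bar>)) * (g z * excursion_weight f n 0 z) \<partial>lborel)"
        unfolding excursion_weight.simps by (intro nn_integral_cong) (auto simp: g_def)
      also have "\<dots> = (\<integral>\<^sup>+y. ennreal (1 / 2 * exp (- \<bar>y\<bar>)) * (g (x + y) * excursion_weight f n 0 (x + y)) \<partial>lborel)"
        using nn_integral_real_affine[of "\<lambda>z. ennreal (1 / 2 * exp (- \<bar>x - z\<bar>)) * (g z * excursion_weight f n 0 z)" 1 x] by simp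
      finally show ?thesis by simp
    qed
    then show ?case unfolding funpow.simps comp_def Suc by (intro ext)
  qed simp
  finally show ?thesis .
qed

lemma emeasure_walk_excursion: "emeasure M {\<omega>\<in>space M. walk_excursion X n \<omega>} = ennreal (excursion_prob n)"
proof -
  note [measurable] = measurable_walk measurable_walk_excursion
  have "emeasure M {\<omega>\<in>space M. walk_excursion X n \<omega>} = (\<integral>\<^sup>+\<omega>. (\<Prod>k=1..n. (\<lambda>_. 1) (walk X k \<omega>)) * of_bool (walk_excursion X n \<omega>) \<partial>M)"
  proof -
    have "(\<integral>\<^sup>+\<omega>. (\<Prod>k=1..n. (\<lambda>_. 1) (walk X k \<omega>)) * of_bool (walk_excursion X n \<omega>) \<partial>M) =
      (\<integral>\<^sup>+\<omega>. indicator {\<omega>\<in>space M. walk_excursion X n \<omega>} \<omega> \<partial>M)"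
      by (intro nn_integral_cong) (auto simp: indicator_def)
    then show ?thesis by simp
  qed
  also have "\<dots> = excursion_weight (\<lambda>_. 1) n 0 0"
    by (rule nn_integral_walk_excursion) simp
  also have "\<dots> = ennreal (excursion_prob n)"
    by (rule excursion_weight_eq_prob[of _ 0]) auto
  finally show ?thesis .
qed

text \<open>Excursions of different lengths are disjoint events, and their probabilities
  \<open>excursion_prob n\<close> sum to 1; this takes the place of a recurrence theorem for the
  walk.\<close>

lemma AE_walk_excursion: "AE \<omega> in M. \<exists>n. walk_excursion X n \<omega>"
proof -
  note [measurable] = measurable_walk measurable_walk_excursion
  let ?R = "\<lambda>n. {\<omega>\<in>space M. walk_excursion X n \<omega>}"
  have "emeasure M (\<Union>n. ?R n) = (\<Sum>n. emeasure M (?R n))"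
    by (rule suminf_emeasure[symmetric]) (auto simp: disjoint_family_on_def dest: walk_excursion_unique)
  also have "\<dots> = 1"
    unfolding emeasure_walk_excursion
    by (subst suminf_ennreal2) (auto simp: summable_excursion_prob suminf_excursion_prob)
  finally have "prob (\<Union>n. ?R n) = 1" by (simp add: measure_def)
  then have "AE \<omega> in M. \<omega> \<in> (\<Union>n. ?R n)"
    by (subst (asm) prob_eq_1) auto
  then show ?thesis by eventually_elim auto
qed

lemma AE_walk_distinct: "AE \<omega> in M. \<forall>i j. i < j \<longrightarrow> walk X i \<omega> \<noteq> walk X j \<omega>"
proof -
  have "AE \<omega> in M. walk X i \<omega> \<noteq> walk X j \<omega>" if "i < j" for i j
  proof -
    have "AE \<omega> in M. (\<Sum>k\<in>{i..<j}. 1 * X k \<omega>) \<noteq> 0"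
      by (rule AE_linear_combination_neq[OF ind, of _ i, OF _ _ _ _ D]) (use that in auto)
    then show ?thesis
    proof eventually_elim
      case (elim \<omega>)
      have "walk X j \<omega> = walk X i \<omega> + (\<Sum>k\<in>{i..<j}. X k \<omega>)"
        unfolding walk_def using that
        by (subst sum.union_disjoint[symmetric]) (auto intro!: sum.cong)
      then show ?case using elim by simp
    qed
  qed
  then show ?thesis by (simp add: AE_all_countable)
qed

lemma AE_walk_order_stat:
  "AE \<omega> in M. (\<exists>n. walk_excursion X n \<omega>) \<and> walk_order_stat X 0 \<omega> = 0 \<and>
     (\<forall>k<walk_nu X \<omega>. walk_order_stat X k \<omega> < walk_order_stat X (Suc k) \<omega>) \<and>
     finite (walk_points X \<omega>) \<and> walk_points X \<omega> \<subseteq> {0<..} \<and>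
     (\<forall>t. walk_count X t \<omega> = card (walk_points X \<omega> \<inter> {..t})) \<and> walk_seq X \<omega> = ordered_seq (walk_points X \<omega>)"
  using AE_walk_excursion AE_walk_distinct
proof eventually_elim
  case (elim \<omega>)
  then obtain n where n: "walk_excursion X n \<omega>" by blast
  show ?case
    using n walk_excursion_order_stat[OF n] elim walk_excursion_imp(2)[OF n] by blast
qed

text \<open>Interchanging the product over levels with the product over steps turns the counts into
  \<open>step_weight\<close> along the path; the sum over lengths is then the functional.\<close>

lemma nn_integral_walk_count:
  assumes J: "finite J" and q: "\<And>t. 0 \<le> q t \<and> q t \<le> (1::real)"
  shows "(\<integral>\<^sup>+\<omega>. ennreal (\<Prod>t\<in>J. q t ^ walk_count X t \<omega>) \<partial>M) = ennreal (excursion_functional (step_weight J (\<lambda>t. t) q) 0)"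
proof -
  note [measurable] = measurable_walk measurable_walk_excursion measurable_walk_count
  let ?f = "step_weight J (\<lambda>t. t) q"
  have [measurable]: "?f \<in> borel_measurable borel" unfolding step_weight_def by measurable
  have f: "0 \<le> ?f x" "?f x \<le> 1" for x
    unfolding step_weight_def using q by (auto intro!: prod_nonneg prod_le_1)
  have "(\<integral>\<^sup>+\<omega>. ennreal (\<Prod>t\<in>J. q t ^ walk_count X t \<omega>) \<partial>M) =
    (\<integral>\<^sup>+\<omega>. (\<Sum>n. (\<Prod>k=1..n. ennreal (?f (walk X k \<omega>))) * of_bool (walk_excursion X n \<omega>)) \<partial>M)"
  proof (rule nn_integral_cong_AE)
    show "AE \<omega> in M. ennreal (\<Prod>t\<in>J. q t ^ walk_count X t \<omega>) = (\<Sum>n. (\<Prod>k=1..n. ennreal (?f (walk X k \<omega>))) * of_bool (walk_excursion X n \<omega>))"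
      using AE_walk_excursion
    proof eventually_elim
      case (elim \<omega>)
      then obtain n where n: "walk_excursion X n \<omega>" by blast
      have "(\<Sum>n. (\<Prod>k=1..n. ennreal (?f (walk X k \<omega>))) * of_bool (walk_excursion X n \<omega>)) =
        (\<Sum>n\<in>{n}. (\<Prod>k=1..n. ennreal (?f (walk X k \<omega>))) * of_bool (walk_excursion X n \<omega>))"
        by (rule suminf_finite) (use n in \<open>auto dest: walk_excursion_unique\<close>)
      also have "\<dots> = ennreal (\<Prod>k=1..n. ?f (walk X k \<omega>))"
        using n by (simp add: prod_ennreal f)
      also have "(\<Prod>k=1..n. ?f (walk X k \<omega>)) = (\<Prod>t\<in>J. \<Prod>k=1..n. if walk X k \<omega> \<le> t then q t else 1)"
        unfolding step_weight_def by (rule prod.swap)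
      also have "\<dots> = (\<Prod>t\<in>J. q t ^ walk_count X t \<omega>)"
        unfolding walk_count_def walk_excursion_imp(2)[OF n] power_sum
        by (intro prod.cong refl) simp
      finally show ?case by simp
    qed
  qed
  also have "\<dots> = (\<Sum>n. \<integral>\<^sup>+\<omega>. (\<Prod>k=1..n. ennreal (?f (walk X k \<omega>))) * of_bool (walk_excursion X n \<omega>) \<partial>M)"
    by (rule nn_integral_suminf) measurable
  also have "\<dots> = (\<Sum>n. excursion_weight (\<lambda>x. ennreal (?f x)) n 0 0)"
    by (intro suminf_cong nn_integral_walk_excursion) measurable
  also have "\<dots> = ennreal (excursion_functional ?f 0)"
    by (rule ennreal_excursion_functional[symmetric]) (use f in auto)
  finally show ?thesis .
qed

lemma walk_nu_pgf:
  fixes z :: complex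
  assumes "z \<noteq> 0" "norm z \<le> 1"
  shows "(LINT \<omega>|M. z ^ walk_nu X \<omega>) = inverse z * (1 - csqrt (1 - z))"
proof -
  note [measurable] = measurable_walk measurable_walk_excursion measurable_walk_nu
  let ?R = "\<lambda>n. {\<omega>\<in>space M. walk_excursion X n \<omega>}"
  have R: "measure M (?R n) = excursion_prob n" for n
    using emeasure_walk_excursion[of n] by (simp add: measure_def)
  let ?g = "\<lambda>n \<omega>. indicator (?R n) \<omega> *\<^sub>R z ^ n"
  have zn: "norm (z ^ n) \<le> 1" for n using assms by (simp add: norm_power power_le_one)
  have int: "integrable M (?g n)" for n
    by (intro integrable_scaleR_left integrable_real_indicator) (auto simp: emeasure_walk_excursion)
  have "(\<lambda>n. LINT \<omega>|M. ?g n \<omega>) sums (LINT \<omega>|M. (\<Sum>n. ?g n \<omega>))"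
  proof (rule sums_integral[OF int])
    show "AE \<omega> in M. summable (\<lambda>n. norm (?g n \<omega>))"
      using AE_walk_excursion
    proof eventually_elim
      case (elim \<omega>)
      then obtain n where n: "walk_excursion X n \<omega>" by blast
      have "?g m \<omega> = 0" if "m \<noteq> n" for m
        using walk_excursion_unique[OF n, of m] that by (auto simp: indicator_def)
      then show ?case
        by (intro summable_finite[of "{n}"]) auto
    qed
    have "(LINT \<omega>|M. norm (?g n \<omega>)) = excursion_prob n * norm (z ^ n)" for n
      using R[of n] by auto
    then show "summable (\<lambda>n. LINT \<omega>|M. norm (?g n \<omega>))"
      unfolding \<open>\<And>n. (LINT \<omega>|M. norm (?g n \<omega>)) = excursion_prob n * norm (z ^ n)\<close>
      using zn by (intro summable_comparison_test'[OF summable_excursion_prob, of 0]) (simp add: mult_left_le)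
  qed
  moreover have "(LINT \<omega>|M. (\<Sum>n. ?g n \<omega>)) = (LINT \<omega>|M. z ^ walk_nu X \<omega>)"
  proof (rule integral_cong_AE)
    show "AE \<omega> in M. (\<Sum>n. ?g n \<omega>) = z ^ walk_nu X \<omega>"
      using AE_walk_excursion AE_space
    proof eventually_elim
      case (elim \<omega>)
      then obtain n where n: "walk_excursion X n \<omega>" by blast
      have "?g m \<omega> = 0" if "m \<noteq> n" for m
        using walk_excursion_unique[OF n, of m] that by (auto simp: indicator_def)
      then have "(\<Sum>n. ?g n \<omega>) = (\<Sum>n\<in>{n}. ?g n \<omega>)"
        by (intro suminf_finite) auto
      then show ?case using n elim by (simp add: walk_excursion_imp(2)[OF n])
    qed
  qed measurable
  moreover have "(LINT \<omega>|M. ?g n \<omega>) = of_real (excursion_prob n) * z ^ n" for n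
    using R[of n] by (simp add: scaleR_conv_of_real)
  ultimately show ?thesis
    using excursion_pgf[OF assms(2,1)] by (simp add: sums_iff)
qed

end

end

section \<open>The law of a labelled family tree\<close>

definition node_space :: "(real \<times> nat) measure" where
  "node_space = borel \<Otimes>\<^sub>M count_space UNIV"

definition node_law :: "(real \<times> nat) measure" where
  "node_law = density lborel (\<lambda>l. ennreal (exponential_density 2 l)) \<Otimes>\<^sub>M measure_pmf (pmf_of_set {0, 2})"

type_synonym tree = "nat list \<Rightarrow> real \<times> nat"

definition tree_space :: "tree measure" where
  "tree_space = (\<Pi>\<^sub>M w\<in>UNIV. node_space)"

definition tree_law :: "tree measure" where
  "tree_law = (\<Pi>\<^sub>M w\<in>UNIV. node_law)"

definition subtree :: "nat \<Rightarrow> tree \<Rightarrow> tree" where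
  "subtree c x = (\<lambda>w. x (c # w))"

text \<open>A tree is put together from its root, the subtrees at the children 0 and 1, and all labels
  below the children \<open>c \<ge> 2\<close>, which never matter since nobody has more than two children.\<close>

definition join_tree :: "(real \<times> nat) \<times> tree \<times> tree \<times> tree \<Rightarrow> tree" where
  "join_tree p = (\<lambda>w. case w of [] \<Rightarrow> fst p | c # v \<Rightarrow>
     if c = 0 then fst (snd p) v else if c = 1 then fst (snd (snd p)) v else snd (snd (snd p)) w)"

lemma sets_node_law [measurable_cong]: "sets node_law = sets node_space"
  unfolding node_law_def node_space_def by (intro sets_pair_measure_cong) auto

lemma space_node_law [simp]: "space node_law = UNIV"
  by (simp add: node_law_def space_pair_measure)

lemma space_node_space [simp]: "space node_space = UNIV"
  by (simp add: node_space_def space_pair_measure)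

lemma sets_tree_law [measurable_cong]: "sets tree_law = sets tree_space"
  unfolding tree_law_def tree_space_def by (intro sets_PiM_cong) (auto simp: sets_node_law)

lemma space_tree_law [simp]: "space tree_law = UNIV" and space_tree_space [simp]: "space tree_space = UNIV"
  by (simp_all add: tree_law_def tree_space_def space_PiM)

lemma prob_space_exp2: "prob_space (density lborel (\<lambda>l. ennreal (exponential_density 2 l)))"
  by (rule prob_space_exponential_density) simp

lemma prob_space_node_law: "prob_space node_law"
proof -
  interpret A: prob_space "density lborel (\<lambda>l. ennreal (exponential_density 2 l))" by (rule prob_space_exp2)
  interpret pair_prob_space "density lborel (\<lambda>l. ennreal (exponential_density 2 l))" "measure_pmf (pmf_of_set {0, 2 :: nat})"
    by unfold_locales
  show ?thesis unfolding node_law_def by unfold_locales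
qed

lemma prob_space_tree_law: "prob_space tree_law"
  unfolding tree_law_def by (intro prob_space_PiM prob_space_node_law)

lemma measurable_node_fst [measurable]: "fst \<in> borel_measurable node_space"
  and measurable_node_snd [measurable]: "snd \<in> node_space \<rightarrow>\<^sub>M count_space UNIV"
  by (simp_all add: node_space_def)

lemma measurable_tree_apply [measurable]: "(\<lambda>x. x w) \<in> tree_space \<rightarrow>\<^sub>M node_space"
  unfolding tree_space_def by (rule measurable_component_singleton) simp

lemma measurable_subtree [measurable]: "subtree c \<in> tree_space \<rightarrow>\<^sub>M tree_space"
proof -
  have "(\<lambda>x w. x (c # w)) \<in> tree_space \<rightarrow>\<^sub>M (\<Pi>\<^sub>M w\<in>UNIV. node_space)"
    by (rule measurable_PiM_single') auto
  then show ?thesis by (simp add: subtree_def[abs_def] tree_space_def[symmetric])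
qed

lemma nn_integral_node_law:
  assumes g [measurable]: "g \<in> borel_measurable node_space"
  shows "(\<integral>\<^sup>+a. g a \<partial>node_law) = (\<integral>\<^sup>+l. ennreal (exponential_density 2 l) * (ennreal (1 / 2) * (g (l, 0) + g (l, 2))) \<partial>lborel)"
proof -
  have [measurable]: "g \<in> borel_measurable (borel \<Otimes>\<^sub>M count_space UNIV)"
    using g by (simp add: node_space_def)
  have mp: "sets (density lborel (\<lambda>l. ennreal (exponential_density 2 l)) \<Otimes>\<^sub>M measure_pmf (pmf_of_set {0, 2})) = sets (borel \<Otimes>\<^sub>M count_space (UNIV :: nat set))"
    by (intro sets_pair_measure_cong) auto
  have [measurable]: "g \<in> borel_measurable (density lborel (\<lambda>l. ennreal (exponential_density 2 l)) \<Otimes>\<^sub>M measure_pmf (pmf_of_set {0, 2}))"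
    by (subst measurable_cong_sets[OF mp refl]) measurable
  have "(\<integral>\<^sup>+k. g (l, k) \<partial>measure_pmf (pmf_of_set {0, 2})) = ennreal (1 / 2) * (g (l, 0) + g (l, 2))" for l
    by (subst nn_integral_pmf_of_set) (auto simp: divide_ennreal_def mult.commute)
  then show ?thesis
    unfolding node_law_def
    by (subst measure_pmf.nn_integral_fst[symmetric], measurable) (subst nn_integral_density, auto)
qed

lemma measurable_join_tree [measurable]:
  "join_tree \<in> node_space \<Otimes>\<^sub>M (tree_space \<Otimes>\<^sub>M (tree_space \<Otimes>\<^sub>M tree_space)) \<rightarrow>\<^sub>M tree_space"
proof -
  have "(\<lambda>p. join_tree p w) \<in> node_space \<Otimes>\<^sub>M (tree_space \<Otimes>\<^sub>M (tree_space \<Otimes>\<^sub>M tree_space)) \<rightarrow>\<^sub>M node_space" for w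
    by (cases w) (simp_all add: join_tree_def)
  then have "(\<lambda>p w. join_tree p w) \<in> node_space \<Otimes>\<^sub>M (tree_space \<Otimes>\<^sub>M (tree_space \<Otimes>\<^sub>M tree_space)) \<rightarrow>\<^sub>M (\<Pi>\<^sub>M w\<in>UNIV. node_space)"
    by (intro measurable_PiM_single') auto
  then show ?thesis by (simp add: tree_space_def[symmetric])
qed

lemma prod_words_split:
  fixes g :: "nat list \<Rightarrow> 'a :: comm_monoid_mult"
  assumes J: "finite J"
  shows "(\<Prod>w\<in>J. g w) = (if [] \<in> J then g [] else 1) * ((\<Prod>v\<in>(#) 0 -` J. g (0 # v)) *
    ((\<Prod>v\<in>(#) 1 -` J. g (1 # v)) * (\<Prod>w\<in>{w\<in>J. \<exists>c v. w = Suc (Suc c) # v}. g w)))"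
proof -
  let ?A = "J \<inter> {[]}" and ?B = "(#) 0 ` ((#) 0 -` J)" and ?C = "(#) 1 ` ((#) 1 -` J)" and ?D = "{w\<in>J. \<exists>c v. w = Suc (Suc c) # v}"
  have fin: "finite ((#) c -` J)" for c :: nat
    using J by (intro finite_vimageI) auto
  have "J = ?A \<union> (?B \<union> (?C \<union> ?D))"
  proof (intro set_eqI iffI)
    fix w assume w: "w \<in> J"
    consider "w = []" | v where "w = 0 # v" | v where "w = 1 # v" | c v where "w = Suc (Suc c) # v"
      by (metis One_nat_def list.exhaust old.nat.exhaust)
    then show "w \<in> ?A \<union> (?B \<union> (?C \<union> ?D))" using w by cases auto
  qed auto
  then have "prod g J = prod g (?A \<union> (?B \<union> (?C \<union> ?D)))" by simp
  also have "\<dots> = prod g ?A * (prod g ?B * (prod g ?C * prod g ?D))"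
    using J fin by (subst prod.union_disjoint; force?)+
  also have "prod g ?B = (\<Prod>v\<in>(#) 0 -` J. g (0 # v))"
    by (subst prod.reindex) auto
  also have "prod g ?C = (\<Prod>v\<in>(#) 1 -` J. g (1 # v))"
    by (subst prod.reindex) auto
  also have "prod g ?A = (if [] \<in> J then g [] else 1)" by auto
  finally show ?thesis .
qed

text \<open>The branching property in distribution. The preimage of a cylinder set under
  \<open>join_tree\<close> is the product of a root event and cylinder events of the three other
  blocks, so a root and independent trees reassemble to the same law.\<close>

lemma distr_join_tree:
  "distr (node_law \<Otimes>\<^sub>M (tree_law \<Otimes>\<^sub>M (tree_law \<Otimes>\<^sub>M tree_law))) tree_space join_tree = tree_law"
proof -
  let ?P = "node_law \<Otimes>\<^sub>M (tree_law \<Otimes>\<^sub>M (tree_law \<Otimes>\<^sub>M tree_law))"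
  interpret N: prob_space node_law by (rule prob_space_node_law)
  interpret T: prob_space tree_law by (rule prob_space_tree_law)
  interpret TT: pair_prob_space tree_law tree_law by unfold_locales
  interpret TTT: pair_prob_space tree_law "tree_law \<Otimes>\<^sub>M tree_law" by unfold_locales
  interpret P: pair_prob_space node_law "tree_law \<Otimes>\<^sub>M (tree_law \<Otimes>\<^sub>M tree_law)" by unfold_locales
  have [measurable]: "join_tree \<in> ?P \<rightarrow>\<^sub>M tree_space" by measurable
  have "distr ?P tree_space join_tree = (\<Pi>\<^sub>M w\<in>UNIV. node_law)"
  proof (rule measure_eqI_PiM_infinite)
    show "sets (distr ?P tree_space join_tree) = sets (\<Pi>\<^sub>M w\<in>UNIV. node_law)"
      using sets_tree_law by (simp add: tree_law_def)
    interpret D: prob_space "distr ?P tree_space join_tree" by (rule P.prob_space_distr) simp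
    show "finite_measure (distr ?P tree_space join_tree)" by unfold_locales
    fix A :: "nat list \<Rightarrow> (real \<times> nat) set" and J :: "nat list set"
    assume J: "finite J" and A: "\<And>w. w \<in> J \<Longrightarrow> A w \<in> sets node_law"
    define E where "E J A = prod_emb UNIV (\<lambda>_. node_law) J (Pi\<^sub>E J A)" for J :: "nat list set" and A
    have E_iff: "x \<in> E J A \<longleftrightarrow> (\<forall>w\<in>J. x w \<in> A w)" for x J A
      by (auto simp: E_def prod_emb_def PiE_iff)
    have em: "emeasure tree_law (E J A) = (\<Prod>w\<in>J. emeasure node_law (A w))" "E J A \<in> sets tree_law"
      if "finite J" "\<And>w. w \<in> J \<Longrightarrow> A w \<in> sets node_law" for J A
      unfolding tree_law_def E_def using that
      by (auto intro!: emeasure_PiM_emb prob_space_node_law sets_PiM_I)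
    let ?J0 = "(#) 0 -` J" and ?J1 = "(#) 1 -` J" and ?J2 = "{w\<in>J. \<exists>c v. w = Suc (Suc c) # v}"
    let ?B = "if [] \<in> J then A [] else UNIV"
    let ?C0 = "E ?J0 (\<lambda>v. A (0 # v))" and ?C1 = "E ?J1 (\<lambda>v. A (1 # v))" and ?C2 = "E ?J2 A"
    have fin: "finite ?J0" "finite ?J1" "finite ?J2"
      using J by (auto intro!: finite_vimageI)
    have B: "?B \<in> sets node_law" using A sets.top[of node_law] by auto
    have "join_tree -` E J A \<inter> space ?P = ?B \<times> (?C0 \<times> (?C1 \<times> ?C2))"
    proof (intro set_eqI)
      fix p :: "(real \<times> nat) \<times> tree \<times> tree \<times> tree"
      obtain a y0 y1 y2 where p: "p = (a, y0, y1, y2)" by (cases p)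
      have "(\<forall>w\<in>J. join_tree p w \<in> A w) \<longleftrightarrow> ([] \<in> J \<longrightarrow> a \<in> A []) \<and> (\<forall>v. 0 # v \<in> J \<longrightarrow> y0 v \<in> A (0 # v)) \<and>
          (\<forall>v. 1 # v \<in> J \<longrightarrow> y1 v \<in> A (1 # v)) \<and> (\<forall>c v. Suc (Suc c) # v \<in> J \<longrightarrow> y2 (Suc (Suc c) # v) \<in> A (Suc (Suc c) # v))"
        (is "?L \<longleftrightarrow> ?R")
      proof
        assume L: ?L
        show ?R
          using L[rule_format, of "[]"] L[rule_format, of "0 # _"] L[rule_format, of "1 # _"] L[rule_format, of "Suc (Suc _) # _"]
          by (auto simp: join_tree_def p)
      next
        assume R: ?R
        show ?L
        proof
          fix w assume w: "w \<in> J"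
          consider "w = []" | v where "w = 0 # v" | v where "w = 1 # v" | c v where "w = Suc (Suc c) # v"
            by (metis One_nat_def list.exhaust old.nat.exhaust)
          then show "join_tree p w \<in> A w" using w R by cases (auto simp: join_tree_def p)
        qed
      qed
      then show "p \<in> join_tree -` E J A \<inter> space ?P \<longleftrightarrow> p \<in> ?B \<times> (?C0 \<times> (?C1 \<times> ?C2))"
        by (auto simp: E_iff p space_pair_measure)
    qed
    moreover have "emeasure ?P (?B \<times> (?C0 \<times> (?C1 \<times> ?C2))) = emeasure node_law ?B * (emeasure tree_law ?C0 * (emeasure tree_law ?C1 * emeasure tree_law ?C2))"
      using B em(2) fin A
      by (subst TTT.P.emeasure_pair_measure_Times TT.P.emeasure_pair_measure_Times T.emeasure_pair_measure_Times; (intro pair_measureI)?; auto)+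
    moreover have "\<dots> = (\<Prod>w\<in>J. emeasure node_law (A w))"
      unfolding prod_words_split[OF J] using N.emeasure_space_1
      by (subst (1 2 3) em(1)) (use fin A in auto)
    moreover have "emeasure (distr ?P tree_space join_tree) (E J A) = emeasure ?P (join_tree -` E J A \<inter> space ?P)"
      using em(2)[OF J A] by (intro emeasure_distr) (auto simp: sets_tree_law)
    ultimately show "emeasure (distr ?P tree_space join_tree) (prod_emb UNIV (\<lambda>_. node_law) J (Pi\<^sub>E J A)) =
        emeasure (\<Pi>\<^sub>M w\<in>UNIV. node_law) (prod_emb UNIV (\<lambda>_. node_law) J (Pi\<^sub>E J A))"
      using em(1)[OF J A] by (simp add: E_def tree_law_def)
  qed simp
  then show ?thesis by (simp add: tree_law_def)
qed

text \<open>\<open>F t s\<close> is the contribution of an individual born at time \<open>t\<close> of the process \<open>Z (t / 2)\<close> with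
  lifetime \<open>s\<close> in the time of \<open>Z\<close>, whence the factor 2; \<open>h\<close> is the value of each individual of
  generation \<open>n\<close>, where the recursion stops.\<close>

fun tree_functional :: "(real \<Rightarrow> real \<Rightarrow> ennreal) \<Rightarrow> ennreal \<Rightarrow> nat \<Rightarrow> real \<Rightarrow> tree \<Rightarrow> ennreal" where
  "tree_functional F h 0 t x = h"
| "tree_functional F h (Suc n) t x = F t (fst (x [])) *
     (if snd (x []) = 2 then tree_functional F h n (t + 2 * fst (x [])) (subtree 0 x) *
        tree_functional F h n (t + 2 * fst (x [])) (subtree 1 x) else 1)"

lemma measurable_tree_functional:
  assumes [measurable]: "case_prod F \<in> borel_measurable (borel \<Otimes>\<^sub>M borel)"
  shows "(\<lambda>(t, x). tree_functional F h n t x) \<in> borel_measurable (borel \<Otimes>\<^sub>M tree_space)"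
proof (induction n)
  case (Suc n)
  have [measurable (raw)]: "(\<lambda>p. tree_functional F h n (a p) (b p)) \<in> borel_measurable M"
    if "a \<in> borel_measurable M" "b \<in> M \<rightarrow>\<^sub>M tree_space" for a b and M :: "'z measure"
    using measurable_compose[OF measurable_Pair[OF that] Suc] by simp
  show ?case
    by (simp add: case_prod_beta)
qed simp

lemma measurable_tree_functional' [measurable (raw)]:
  assumes "case_prod F \<in> borel_measurable (borel \<Otimes>\<^sub>M borel)" "a \<in> borel_measurable M" "b \<in> M \<rightarrow>\<^sub>M tree_space"
  shows "(\<lambda>p. tree_functional F h n (a p) (b p)) \<in> borel_measurable M"
  using measurable_compose[OF measurable_Pair[OF assms(2,3)] measurable_tree_functional[OF assms(1), of h n]] by simp

text \<open>By \<open>distr_join_tree\<close> the two subtrees are independent copies started at the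
  death of the root, hence the square; a root without children contributes 1, and the fair coin
  gives the halves.\<close>

lemma nn_integral_tree_functional:
  fixes h :: ennreal and F :: "real \<Rightarrow> real \<Rightarrow> ennreal"
  assumes [measurable]: "case_prod F \<in> borel_measurable (borel \<Otimes>\<^sub>M borel)"
  defines "V \<equiv> \<lambda>n t. \<integral>\<^sup>+x. tree_functional F h n t x \<partial>tree_law"
  shows "V n \<in> borel_measurable borel"
    and "V 0 t = h"
    and "V (Suc n) t = (\<integral>\<^sup>+s. ennreal (exponential_density 2 s) * (F t s * (ennreal (1 / 2) + ennreal (1 / 2) * (V n (t + 2 * s))\<^sup>2)) \<partial>lborel)"
proof -
  interpret T: prob_space tree_law by (rule prob_space_tree_law)
  interpret TT: pair_prob_space tree_law tree_law by unfold_locales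
  interpret TTT: pair_prob_space tree_law "tree_law \<Otimes>\<^sub>M tree_law" by unfold_locales
  interpret N: prob_space node_law by (rule prob_space_node_law)
  have S2: "sigma_finite_measure (tree_law \<Otimes>\<^sub>M tree_law)" by unfold_locales
  have S3: "sigma_finite_measure (tree_law \<Otimes>\<^sub>M (tree_law \<Otimes>\<^sub>M tree_law))" by unfold_locales
  show V [measurable]: "V n \<in> borel_measurable borel" for n
    unfolding V_def by measurable
  have "tree_functional F h 0 t = (\<lambda>_. h)" by (simp add: fun_eq_iff)
  then show "V 0 t = h" using T.emeasure_space_1 by (simp add: V_def)
  let ?P = "node_law \<Otimes>\<^sub>M (tree_law \<Otimes>\<^sub>M (tree_law \<Otimes>\<^sub>M tree_law))"
  let ?R = "tree_functional F h n"
  define G where "G a y0 y1 = F t (fst a) * (if snd a = 2 then ?R (t + 2 * fst a) y0 * ?R (t + 2 * fst a) y1 else 1)" for a :: "real \<times> nat" and y0 y1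
  have sub: "subtree 0 (join_tree p) = fst (snd p)" "subtree 1 (join_tree p) = fst (snd (snd p))" for p
    by (simp_all add: subtree_def join_tree_def fun_eq_iff)
  have root: "join_tree p [] = fst p" for p by (simp add: join_tree_def)
  have "V (Suc n) t = (\<integral>\<^sup>+p. tree_functional F h (Suc n) t (join_tree p) \<partial>?P)"
    unfolding V_def by (subst distr_join_tree[symmetric], subst nn_integral_distr) measurable
  also have "\<dots> = (\<integral>\<^sup>+p. G (fst p) (fst (snd p)) (fst (snd (snd p))) \<partial>?P)"
    by (simp only: tree_functional.simps sub root G_def)
  also have "\<dots> = (\<integral>\<^sup>+a. (\<integral>\<^sup>+q. G a (fst q) (fst (snd q)) \<partial>(tree_law \<Otimes>\<^sub>M (tree_law \<Otimes>\<^sub>M tree_law))) \<partial>node_law)"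
    by (subst sigma_finite_measure.nn_integral_fst[OF S3, symmetric]) (simp_all add: G_def)
  also have "\<dots> = (\<integral>\<^sup>+a. F t (fst a) * (if snd a = 2 then (V n (t + 2 * fst a))\<^sup>2 else 1) \<partial>node_law)"
  proof (rule nn_integral_cong)
    fix a :: "real \<times> nat"
    have [measurable]: "(\<lambda>q. G a (f q) (g q)) \<in> borel_measurable M" if [measurable]: "f \<in> M \<rightarrow>\<^sub>M tree_space" "g \<in> M \<rightarrow>\<^sub>M tree_space" for f g and M :: "'z measure"
      unfolding G_def by measurable
    have "(\<integral>\<^sup>+q. G a (fst q) (fst (snd q)) \<partial>(tree_law \<Otimes>\<^sub>M (tree_law \<Otimes>\<^sub>M tree_law))) =
      (\<integral>\<^sup>+y0. (\<integral>\<^sup>+r. G a y0 (fst r) \<partial>(tree_law \<Otimes>\<^sub>M tree_law)) \<partial>tree_law)"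
      by (subst sigma_finite_measure.nn_integral_fst[OF S2, symmetric]) simp_all
    also have "\<dots> = (\<integral>\<^sup>+y0. (\<integral>\<^sup>+y1. G a y0 y1 \<partial>tree_law) \<partial>tree_law)"
      by (intro nn_integral_cong, subst T.nn_integral_fst[symmetric]) (simp_all add: T.emeasure_space_1[simplified])
    also have "\<dots> = F t (fst a) * (if snd a = 2 then (V n (t + 2 * fst a))\<^sup>2 else 1)"
    proof (cases "snd a = 2")
      case True
      then show ?thesis
        unfolding G_def V_def by (simp add: nn_integral_cmult nn_integral_multc power2_eq_square)
    next
      case False
      then show ?thesis unfolding G_def by (simp add: T.emeasure_space_1[simplified])
    qed
    finally show "(\<integral>\<^sup>+q. G a (fst q) (fst (snd q)) \<partial>(tree_law \<Otimes>\<^sub>M (tree_law \<Otimes>\<^sub>M tree_law))) =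
      F t (fst a) * (if snd a = 2 then (V n (t + 2 * fst a))\<^sup>2 else 1)" .
  qed
  also have "\<dots> = (\<integral>\<^sup>+s. ennreal (exponential_density 2 s) * (F t s * (ennreal (1 / 2) + ennreal (1 / 2) * (V n (t + 2 * s))\<^sup>2)) \<partial>lborel)"
    by (subst nn_integral_node_law, measurable)
       (intro nn_integral_cong, simp add: distrib_left mult_ac)
  finally show "V (Suc n) t = (\<integral>\<^sup>+s. ennreal (exponential_density 2 s) * (F t s * (ennreal (1 / 2) + ennreal (1 / 2) * (V n (t + 2 * s))\<^sup>2)) \<partial>lborel)" .
qed

section \<open>Realised families: births, generations and extinction\<close>

definition tree_born :: "tree \<Rightarrow> nat list \<Rightarrow> bool" where
  "tree_born x w \<longleftrightarrow> (\<forall>k<length w. w ! k < snd (x (take k w)))"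

definition tree_birth :: "tree \<Rightarrow> nat list \<Rightarrow> real" where
  "tree_birth x w = (\<Sum>k<length w. fst (x (take k w)))"

definition valid_tree :: "tree \<Rightarrow> bool" where
  "valid_tree x \<longleftrightarrow> (\<forall>w. 0 < fst (x w) \<and> snd (x w) \<in> {0, 2})"

lemma tree_born_Nil [simp]: "tree_born x []" and tree_birth_Nil [simp]: "tree_birth x [] = 0"
  by (simp_all add: tree_born_def tree_birth_def)

lemma tree_born_Cons: "tree_born x (c # v) \<longleftrightarrow> c < snd (x []) \<and> tree_born (subtree c x) v"
  by (auto simp: tree_born_def subtree_def All_less_Suc2)

lemma tree_birth_Cons: "tree_birth x (c # v) = fst (x []) + tree_birth (subtree c x) v"
  unfolding tree_birth_def subtree_def by (simp add: sum.lessThan_Suc_shift del: sum.lessThan_Suc)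

lemma valid_subtree: "valid_tree x \<Longrightarrow> valid_tree (subtree c x)"
  by (simp add: valid_tree_def subtree_def)

definition generations :: "tree \<Rightarrow> nat \<Rightarrow> nat list set" where
  "generations x n = {w. tree_born x w \<and> length w < n}"

lemma generations_Suc:
  assumes "valid_tree x"
  shows "generations x (Suc n) = insert [] (if snd (x []) = 2
    then (#) 0 ` generations (subtree 0 x) n \<union> (#) 1 ` generations (subtree 1 x) n else {})"
proof (rule set_eqI)
  fix w
  have "snd (x []) = 0 \<or> snd (x []) = 2" using assms by (auto simp: valid_tree_def)
  then show "w \<in> generations x (Suc n) \<longleftrightarrow> w \<in> insert [] (if snd (x []) = 2
    then (#) 0 ` generations (subtree 0 x) n \<union> (#) 1 ` generations (subtree 1 x) n else {})"
    by (cases w) (auto simp: generations_def tree_born_Cons image_iff less_2_cases_iff)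
qed

lemma finite_generations: "valid_tree x \<Longrightarrow> finite (generations x n)"
  by (induction n arbitrary: x) (auto simp: generations_Suc valid_subtree, auto simp: generations_def)

text \<open>With stopping value 1 the unexplored generations leave no trace, so the recursion
  multiplies over the individuals of generation less than \<open>n\<close>.\<close>

lemma tree_functional_eq_prod:
  assumes "valid_tree x"
  shows "tree_functional F 1 n t x = (\<Prod>w\<in>generations x n. F (t + 2 * tree_birth x w) (fst (x w)))"
  using assms
proof (induction n arbitrary: t x)
  case 0
  then show ?case by (simp add: generations_def)
next
  case (Suc n)
  note v = valid_subtree[OF Suc.prems]
  show ?case
  proof (cases "snd (x []) = 2")
    case True
    let ?G = "\<lambda>c. generations (subtree c x) n"
    have split: "(\<Prod>w\<in>generations x (Suc n). F (t + 2 * tree_birth x w) (fst (x w))) =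
      F t (fst (x [])) * ((\<Prod>w\<in>(#) 0 ` ?G 0. F (t + 2 * tree_birth x w) (fst (x w))) *
        (\<Prod>w\<in>(#) 1 ` ?G 1. F (t + 2 * tree_birth x w) (fst (x w))))"
    proof -
      have fin: "finite ((#) c ` ?G c)" for c using finite_generations[OF v] by blast
      have "generations x (Suc n) = insert [] ((#) 0 ` ?G 0 \<union> (#) 1 ` ?G 1)"
        using True by (simp add: generations_Suc[OF Suc.prems])
      moreover have "[] \<notin> (#) 0 ` ?G 0 \<union> (#) 1 ` ?G 1" by auto
      moreover have "(#) 0 ` ?G 0 \<inter> (#) 1 ` ?G 1 = {}" by auto
      ultimately show ?thesis
        using fin[of 0] fin[of 1] by (simp only: prod.insert prod.union_disjoint finite_UnI not_False_eq_True) simp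
    qed
    have sub: "(\<Prod>w\<in>(#) c ` ?G c. F (t + 2 * tree_birth x w) (fst (x w))) = tree_functional F 1 n (t + 2 * fst (x [])) (subtree c x)" for c
      unfolding Suc.IH[OF v]
      by (subst prod.reindex) (auto simp: tree_birth_Cons subtree_def algebra_simps intro!: prod.cong)
    show ?thesis unfolding split sub using True by simp
  next
    case False
    then show ?thesis by (simp add: generations_Suc[OF Suc.prems])
  qed
qed

text \<open>The stopping value 0 annihilates exactly the trees that reach generation
  \<open>n\<close>, so the expectation is the probability of extinction before it.\<close>

lemma tree_functional_extinct:
  assumes "valid_tree x"
  shows "tree_functional (\<lambda>_ _. 1) 0 n t x = of_bool (\<forall>w. length w = n \<longrightarrow> \<not> tree_born x w)"
  using assms
proof (induction n arbitrary: t x)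
  case (Suc n)
  have k: "snd (x []) = 0 \<or> snd (x []) = 2" using Suc.prems by (auto simp: valid_tree_def)
  have "(\<forall>w. length w = Suc n \<longrightarrow> \<not> tree_born x w) \<longleftrightarrow> (\<forall>c v. length v = n \<longrightarrow> c < snd (x []) \<longrightarrow> \<not> tree_born (subtree c x) v)"
  proof -
    have "(\<forall>w. length w = Suc n \<longrightarrow> \<not> tree_born x w) \<longleftrightarrow> (\<forall>c v. length v = n \<longrightarrow> \<not> tree_born x (c # v))"
      by (metis length_Cons length_Suc_conv)
    then show ?thesis by (auto simp: tree_born_Cons)
  qed
  also have "\<dots> \<longleftrightarrow> (snd (x []) = 2 \<longrightarrow> (\<forall>v. length v = n \<longrightarrow> \<not> tree_born (subtree 0 x) v) \<and> (\<forall>v. length v = n \<longrightarrow> \<not> tree_born (subtree 1 x) v))"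
    using k by (auto simp: less_2_cases_iff)
  finally show ?case
    using Suc.IH[OF valid_subtree[OF Suc.prems]] by simp
qed simp

lemma AE_valid_tree: "AE x in tree_law. valid_tree x"
proof -
  define g where "g a = (if 0 < fst a \<and> (snd a = 0 \<or> snd a = 2) then 0 else 1 :: ennreal)" for a :: "real \<times> nat"
  have [measurable]: "g \<in> borel_measurable node_space" unfolding g_def by measurable
  have "(\<integral>\<^sup>+a. g a \<partial>node_law) = (\<integral>\<^sup>+l. ennreal (exponential_density 2 l) * (ennreal (1 / 2) * (g (l, 0) + g (l, 2))) \<partial>lborel)"
    by (rule nn_integral_node_law) measurable
  also have "\<dots> = (\<integral>\<^sup>+(l :: real). 0 \<partial>lborel)"
  proof (rule nn_integral_cong_AE)
    show "AE l in lborel. ennreal (exponential_density 2 l) * (ennreal (1 / 2) * (g (l, 0) + g (l, 2))) = 0"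
      using AE_lborel_singleton[of "0::real"] by eventually_elim (auto simp: g_def exponential_density_def)
  qed
  finally have "(\<integral>\<^sup>+a. g a \<partial>node_law) = 0" by simp
  moreover have "g \<in> borel_measurable node_law"
    using \<open>g \<in> borel_measurable node_space\<close> by (simp add: measurable_cong_sets[OF sets_node_law refl])
  ultimately have "AE a in node_law. g a = 0"
    by (simp add: nn_integral_0_iff_AE)
  then have "AE a in node_law. 0 < fst a \<and> snd a \<in> {0, 2}"
    by eventually_elim (auto simp: g_def split: if_splits)
  then have "AE x in tree_law. 0 < fst (x w) \<and> snd (x w) \<in> {0, 2}" for w
    unfolding tree_law_def by (intro AE_PiM_component prob_space_node_law) auto
  then show ?thesis unfolding valid_tree_def by (simp add: AE_all_countable)
qed

text \<open>Criticality: the probability \<open>d n\<close> that generation \<open>n\<close> is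
  reached obeys \<open>d (Suc n) = d n - (d n)\<^sup>2 / 2\<close>. The sequence decreases, and its
  limit must be the only fixed point 0 of this map. An extinct family has finitely many generations
  of at most two children per parent.\<close>

lemma AE_finite_tree: "AE x in tree_law. finite {w. tree_born x w}"
proof -
  interpret T: prob_space tree_law by (rule prob_space_tree_law)
  let ?R = "\<lambda>n. tree_functional (\<lambda>_ _. 1) 0 n 0"
  have [measurable]: "case_prod (\<lambda>_ _. 1 :: ennreal) \<in> borel_measurable (borel \<Otimes>\<^sub>M (borel :: real measure) :: (real \<times> real) measure)"
    by (simp add: case_prod_beta)
  define e where "e n t = (\<integral>\<^sup>+x. tree_functional (\<lambda>_ _. 1) 0 n t x \<partial>tree_law)" for n t
  have dens: "(\<integral>\<^sup>+s. ennreal (exponential_density 2 s) * c \<partial>lborel) = c" for c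
    using prob_space.emeasure_space_1[OF prob_space_exp2] by (simp add: nn_integral_multc emeasure_density)
  define d :: "nat \<Rightarrow> real" where "d = rec_nat 1 (\<lambda>_ d. d - d\<^sup>2 / 2)"
  have d_simps [simp]: "d 0 = 1" "d (Suc n) = d n - (d n)\<^sup>2 / 2" for n by (simp_all add: d_def)
  have d01: "0 \<le> d n \<and> d n \<le> 1" for n
  proof (induction n)
    case (Suc n)
    then have "(d n)\<^sup>2 \<le> d n" by (simp add: power2_eq_square mult_left_le)
    then show ?case using Suc zero_le_power2[of "d n"] unfolding d_simps by linarith
  qed simp
  have e: "e n t = ennreal (1 - d n)" for n t
  proof (induction n arbitrary: t)
    case 0
    then show ?case using nn_integral_tree_functional(2)[of "\<lambda>_ _. 1" 0 t] by (simp add: e_def)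
  next
    case (Suc n)
    have "e (Suc n) t = (\<integral>\<^sup>+s. ennreal (exponential_density 2 s) * (1 * (ennreal (1 / 2) + ennreal (1 / 2) * (e n (t + 2 * s))\<^sup>2)) \<partial>lborel)"
      unfolding e_def by (rule nn_integral_tree_functional(3)) measurable
    also have "\<dots> = ennreal (1 / 2) + ennreal (1 / 2) * (ennreal (1 - d n))\<^sup>2"
      unfolding Suc mult_1 by (rule dens)
    also have "\<dots> = ennreal (1 / 2 + 1 / 2 * (1 - d n)\<^sup>2)"
      using d01[of n] by (simp add: ennreal_power ennreal_mult[symmetric] ennreal_plus[symmetric] del: ennreal_plus ennreal_half)
    also have "1 / 2 + 1 / 2 * (1 - d n)\<^sup>2 = 1 - d (Suc n)"
      by (simp add: power2_eq_square field_simps)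
    finally show ?case .
  qed
  have "d \<longlonglongrightarrow> 0"
  proof -
    have "decseq d" by (intro decseq_SucI) simp
    then obtain l where l: "d \<longlonglongrightarrow> l"
      using decseq_convergent[of d 0] d01 by blast
    have "(\<lambda>n. d (Suc n)) \<longlonglongrightarrow> l - l\<^sup>2 / 2"
      unfolding d_simps by (intro tendsto_intros l) simp
    moreover have "(\<lambda>n. d (Suc n)) \<longlonglongrightarrow> l" using l by (rule LIMSEQ_Suc)
    ultimately have "l - l\<^sup>2 / 2 = l" by (rule LIMSEQ_unique)
    then show ?thesis using l by simp
  qed
  have R1: "AE x in tree_law. ?R n x \<le> 1" for n
    using AE_valid_tree by eventually_elim (simp add: tree_functional_extinct of_bool_def)
  \<comment> \<open>On valid trees the infimum is the indicator of survival through all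
    generations.\<close>
  have "(\<integral>\<^sup>+x. (INF n. 1 - ?R n x) \<partial>tree_law) \<le> ennreal (d n)" for n
  proof -
    have "(\<integral>\<^sup>+x. (INF n. 1 - ?R n x) \<partial>tree_law) \<le> (\<integral>\<^sup>+x. 1 - ?R n x \<partial>tree_law)"
      by (intro nn_integral_mono INF_lower) auto
    also have "\<dots> = (\<integral>\<^sup>+x. 1 \<partial>tree_law) - e n 0"
      unfolding e_def by (intro nn_integral_diff R1) (use e[of n 0] in \<open>auto simp: e_def\<close>)
    also have "\<dots> = ennreal (d n)"
    proof -
      have "(\<integral>\<^sup>+x. 1 \<partial>tree_law) = ennreal 1" using T.emeasure_space_1 by simp
      then show ?thesis unfolding e using d01[of n] by (simp only: ennreal_minus diff_ge_0_iff_ge) (simp del: ennreal_1)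
    qed
    finally show ?thesis .
  qed
  moreover have "(\<lambda>n. ennreal (d n)) \<longlonglongrightarrow> ennreal 0"
    using \<open>d \<longlonglongrightarrow> 0\<close> by (intro tendsto_ennrealI)
  ultimately have "(\<integral>\<^sup>+x. (INF n. 1 - ?R n x) \<partial>tree_law) = 0"
    using LIMSEQ_le_const[of "\<lambda>n. ennreal (d n)" "ennreal 0" "\<integral>\<^sup>+x. (INF n. 1 - ?R n x) \<partial>tree_law"] by auto
  then have "AE x in tree_law. (INF n. 1 - ?R n x) = 0"
    by (subst (asm) nn_integral_0_iff_AE) auto
  then show ?thesis
    using AE_valid_tree
  proof eventually_elim
    case (elim x)
    have "\<exists>n. ?R n x \<noteq> 0"
    proof (rule ccontr)
      assume "\<nexists>n. ?R n x \<noteq> 0"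
      then show False using elim by simp
    qed
    then obtain n where "?R n x \<noteq> 0" by blast
    then have n: "\<forall>w. length w = n \<longrightarrow> \<not> tree_born x w"
      unfolding tree_functional_extinct[OF elim(2)] by (simp only: of_bool_eq_0_iff not_not)
    have "{w. tree_born x w} \<subseteq> generations x n"
    proof
      fix w assume w: "w \<in> {w. tree_born x w}"
      then have "tree_born x (take n w)" by (auto simp: tree_born_def min_def)
      then have "length (take n w) \<noteq> n" using n by blast
      then show "w \<in> generations x n" using w by (auto simp: generations_def)
    qed
    then show ?case using finite_generations[OF elim(2)] finite_subset by blast
  qed
qed

section \<open>The functional of a family tree under killing\<close>

context killing_rate
begin

text \<open>The death contributes \<open>f\<close> at the death time, and the marks during the
  lifetime contribute the exponential of minus the killing collected there. The value 1 for negative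
  lifetimes, a null event, keeps the factor at most 1 everywhere, so that the functional decreases
  in the number of generations.\<close>

definition survival_factor :: "real \<Rightarrow> real \<Rightarrow> ennreal" where
  "survival_factor t s = ennreal (if 0 \<le> s then f (t + 2 * s) * exp (hazard (t + 2 * s) - hazard t) else 1)"

lemma measurable_survival_factor [measurable]: "case_prod survival_factor \<in> borel_measurable (borel \<Otimes>\<^sub>M borel)"
  unfolding survival_factor_def by measurable

lemma survival_factor_le_1: "survival_factor t s \<le> 1"
proof -
  have "f (t + 2 * s) * exp (hazard (t + 2 * s) - hazard t) \<le> 1" if "0 \<le> s"
    using f_range that hazard_antimono[of t "t + 2 * s"] by (intro mult_le_one) auto
  then show ?thesis by (simp add: survival_factor_def)
qed

text \<open>The infimum over generations is measurable on all trees, whereas the product over all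
  born individuals makes sense only for finite ones.\<close>

definition tree_weight :: "tree \<Rightarrow> ennreal" where
  "tree_weight x = (INF n. tree_functional survival_factor 1 n 0 x)"

lemma tree_weight_measurable [measurable]: "tree_weight \<in> borel_measurable tree_space"
  unfolding tree_weight_def by measurable

lemma tree_functional_decseq: "tree_functional survival_factor 1 (Suc n) t x \<le> tree_functional survival_factor 1 n t x"
proof (induction n arbitrary: t x)
  case 0
  then show ?case using survival_factor_le_1 by simp
next
  case (Suc n)
  show ?case
    by (subst (1 2) tree_functional.simps) (auto intro!: mult_left_mono mult_mono Suc.IH simp del: tree_functional.simps)
qed

text \<open>On a finite tree the functional no longer changes beyond the last generation, so the
  infimum is attained.\<close>

lemma tree_weight_eq:
  assumes v: "valid_tree x" and fin: "finite {w. tree_born x w}"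
  shows "tree_weight x = ennreal (\<Prod>w\<in>{w. tree_born x w}.
    f (2 * (tree_birth x w + fst (x w))) * exp (hazard (2 * (tree_birth x w + fst (x w))) - hazard (2 * tree_birth x w)))"
proof -
  let ?R = "\<lambda>n. tree_functional survival_factor 1 n 0 x"
  obtain N where N: "\<forall>w\<in>{w. tree_born x w}. length w < N"
    using finite_imageI[OF fin, of length] by (metis (no_types, lifting) finite_nat_set_iff_bounded imageI)
  have R: "?R n = ennreal (\<Prod>w\<in>{w. tree_born x w}.
    f (2 * (tree_birth x w + fst (x w))) * exp (hazard (2 * (tree_birth x w + fst (x w))) - hazard (2 * tree_birth x w)))" if "N \<le> n" for n
  proof -
    have "generations x n = {w. tree_born x w}" using N that by (force simp: generations_def)
    moreover have "0 \<le> fst (x w)" for w using v by (simp add: valid_tree_def less_imp_le)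
    ultimately show ?thesis
      unfolding tree_functional_eq_prod[OF v]
      by (subst prod_ennreal[symmetric]) (auto intro!: prod.cong mult_nonneg_nonneg simp: f_range survival_factor_def distrib_left)
  qed
  have "decseq ?R" by (intro decseq_SucI tree_functional_decseq)
  then have "?R \<longlonglongrightarrow> tree_weight x" unfolding tree_weight_def by (rule LIMSEQ_INF)
  moreover have "?R \<longlonglongrightarrow> ?R N"
    by (rule tendsto_eventually) (use R in \<open>auto simp: eventually_sequentially\<close>)
  ultimately show ?thesis using R[of N] LIMSEQ_unique by fastforce
qed

text \<open>Generation by generation the expectations \<open>V n\<close> decrease to a fixed point
  \<open>U\<close> of the branching equation. The comparison with the excursion functional gives
  \<open>(1 + U 0) / 2\<close>, whose two halves match an absent and a present initial
  individual.\<close>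

theorem nn_integral_tree_weight:
  assumes T: "0 \<le> T"
  shows "ennreal (1 / 2) + ennreal (1 / 2) * (\<integral>\<^sup>+x. tree_weight x \<partial>tree_law) = ennreal (excursion_functional f 0)"
proof -
  interpret T: prob_space tree_law by (rule prob_space_tree_law)
  let ?R = "tree_functional survival_factor 1"
  define V where "V n t = (\<integral>\<^sup>+x. ?R n t x \<partial>tree_law)" for n t
  have Vm [measurable]: "V n \<in> borel_measurable borel" for n
    unfolding V_def by (rule nn_integral_tree_functional(1)) measurable
  have V0: "V 0 t = 1" for t
    unfolding V_def by (rule nn_integral_tree_functional(2)) measurable
  have VS: "V (Suc n) t = (\<integral>\<^sup>+s. ennreal (exponential_density 2 s) * (survival_factor t s *
      (ennreal (1 / 2) + ennreal (1 / 2) * (V n (t + 2 * s))\<^sup>2)) \<partial>lborel)" for n t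
    unfolding V_def by (rule nn_integral_tree_functional(3)) measurable
  have Vdec: "V (Suc n) t \<le> V n t" for n t
    unfolding V_def by (intro nn_integral_mono tree_functional_decseq)
  have V1: "V n t \<le> 1" for n t
  proof (induction n)
    case (Suc n)
    then show ?case using Vdec[of n t] by (rule order.trans[rotated])
  qed (simp add: V0)
  define v where "v n t = enn2real (V n t)" for n t
  have Vv: "V n t = ennreal (v n t)" for n t
    using V1[of n t] by (simp add: v_def le_less_trans)
  have v01: "0 \<le> v n t" "v n t \<le> 1" for n t
    using V1[of n t] by (auto simp: v_def enn2real_leI)
  have [measurable]: "v n \<in> borel_measurable borel" for n unfolding v_def by measurable
  define U where "U t = (INF n. v n t)" for t
  have vU: "(\<lambda>n. v n t) \<longlonglongrightarrow> U t" for t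
    unfolding U_def
  proof (rule LIMSEQ_decseq_INF)
    show "bdd_below (range (\<lambda>n. v n t))" using v01 by (auto intro!: bdd_belowI2)
    show "decseq (\<lambda>n. v n t)"
      using Vdec V1 by (intro decseq_SucI) (auto simp: v_def intro!: enn2real_mono le_less_trans[OF V1])
  qed
  have [measurable]: "U \<in> borel_measurable borel"
    by (rule borel_measurable_LIMSEQ_metric[OF _ vU]) measurable
  have U01: "0 \<le> U t" "U t \<le> 1" for t
    using LIMSEQ_le_const[OF vU] LIMSEQ_le_const2[OF vU] v01 by blast+
  have dens: "(\<integral>\<^sup>+s. ennreal (exponential_density 2 s) \<partial>lborel) = 1"
    using prob_space.emeasure_space_1[OF prob_space_exp2] by (simp add: emeasure_density)
  have VS': "V (Suc n) t = (\<integral>\<^sup>+s. ennreal (exponential_density 2 s) * (survival_factor t s *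
      ennreal (1 / 2 + 1 / 2 * (v n (t + 2 * s))\<^sup>2)) \<partial>lborel)" for n t
  proof -
    have h: "ennreal (1 / 2) + ennreal (1 / 2) * (ennreal y)\<^sup>2 = ennreal (1 / 2 + 1 / 2 * y\<^sup>2)" if "0 \<le> y" for y
      using that by (simp add: ennreal_power ennreal_mult[symmetric] ennreal_plus[symmetric] del: ennreal_plus ennreal_half)
    show ?thesis unfolding VS Vv[of n] h[OF v01(1)] ..
  qed
  have U_eq: "ennreal (U t) = (\<integral>\<^sup>+s. ennreal (exponential_density 2 s) * (survival_factor t s *
      ennreal (1 / 2 + 1 / 2 * (U (t + 2 * s))\<^sup>2)) \<partial>lborel)" for t
  proof -
    have "(\<lambda>n. V (Suc n) t) \<longlonglongrightarrow> ennreal (U t)"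
      unfolding Vv by (intro tendsto_ennrealI LIMSEQ_Suc vU)
    moreover have "(\<lambda>n. V (Suc n) t) \<longlonglongrightarrow> (\<integral>\<^sup>+s. ennreal (exponential_density 2 s) * (survival_factor t s *
      ennreal (1 / 2 + 1 / 2 * (U (t + 2 * s))\<^sup>2)) \<partial>lborel)"
      unfolding VS'
    proof (rule nn_integral_dominated_convergence[where w = "\<lambda>s. ennreal (exponential_density 2 s)"])
      show "AE s in lborel. ennreal (exponential_density 2 s) * (survival_factor t s * ennreal (1 / 2 + 1 / 2 * (v n (t + 2 * s))\<^sup>2)) \<le> ennreal (exponential_density 2 s)" for n
      proof (rule AE_I2)
        fix s
        have "1 / 2 + 1 / 2 * (v n (t + 2 * s))\<^sup>2 \<le> 1" using v01[of n "t + 2 * s"] power_le_one[of "v n (t + 2 * s)" 2] by simp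
        then have "survival_factor t s * ennreal (1 / 2 + 1 / 2 * (v n (t + 2 * s))\<^sup>2) \<le> 1 * 1"
          by (intro mult_mono survival_factor_le_1) (simp_all only: ennreal_le_1 zero_le)
        then show "ennreal (exponential_density 2 s) * (survival_factor t s * ennreal (1 / 2 + 1 / 2 * (v n (t + 2 * s))\<^sup>2)) \<le> ennreal (exponential_density 2 s)"
          using mult_left_mono[of _ 1 "ennreal (exponential_density 2 s)"] by simp
      qed
      show "AE s in lborel. (\<lambda>n. ennreal (exponential_density 2 s) * (survival_factor t s * ennreal (1 / 2 + 1 / 2 * (v n (t + 2 * s))\<^sup>2)))
          \<longlonglongrightarrow> ennreal (exponential_density 2 s) * (survival_factor t s * ennreal (1 / 2 + 1 / 2 * (U (t + 2 * s))\<^sup>2))"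
        by (intro AE_I2 tendsto_intros ennreal_tendsto_cmult tendsto_ennrealI vU) (auto simp: survival_factor_def ennreal_mult_less_top)
    qed (auto simp: dens)
    ultimately show ?thesis by (rule LIMSEQ_unique)
  qed
  \<comment> \<open>The substitution \<open>x = t + 2 * s\<close> turns the lifetime density of rate
    2 into \<open>exp (- (x - t))\<close>, the form required by the comparison.\<close>
  have U_conv: "ennreal (U t) = (\<integral>\<^sup>+x. (if t \<le> x then ennreal (exp (- (x - t)) *
        (f x * exp (hazard x - hazard t) * (1 / 2 + 1 / 2 * (U x)\<^sup>2))) else 0) \<partial>lborel)" for t
  proof -
    let ?g = "\<lambda>x. (if t \<le> x then ennreal (exp (- (x - t)) * (f x * exp (hazard x - hazard t) * (1 / 2 + 1 / 2 * (U x)\<^sup>2))) else 0)"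
    have "(\<integral>\<^sup>+x. ?g x \<partial>lborel) = ennreal 2 * (\<integral>\<^sup>+s. ?g (t + 2 * s) \<partial>lborel)"
      using nn_integral_real_affine[of ?g 2 t] by simp
    also have "\<dots> = (\<integral>\<^sup>+s. ennreal 2 * ?g (t + 2 * s) \<partial>lborel)"
      by (rule nn_integral_cmult[symmetric]) measurable
    also have "\<dots> = (\<integral>\<^sup>+s. ennreal (exponential_density 2 s) * (survival_factor t s * ennreal (1 / 2 + 1 / 2 * (U (t + 2 * s))\<^sup>2)) \<partial>lborel)"
    proof (rule nn_integral_cong)
      fix s :: real
      show "ennreal 2 * ?g (t + 2 * s) = ennreal (exponential_density 2 s) * (survival_factor t s * ennreal (1 / 2 + 1 / 2 * (U (t + 2 * s))\<^sup>2))"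
      proof (cases "0 \<le> s")
        case True
        then have "ennreal (exponential_density 2 s) * (survival_factor t s * ennreal (1 / 2 + 1 / 2 * (U (t + 2 * s))\<^sup>2)) =
          ennreal (2 * exp (- (2 * s)) * (f (t + 2 * s) * exp (hazard (t + 2 * s) - hazard t) * (1 / 2 + 1 / 2 * (U (t + 2 * s))\<^sup>2)))"
          by (simp add: exponential_density_def survival_factor_def f_range ennreal_mult mult_ac del: ennreal_plus)
        moreover have "ennreal 2 * ?g (t + 2 * s) = ennreal (2 * (exp (- (2 * s)) * (f (t + 2 * s) * exp (hazard (t + 2 * s) - hazard t) * (1 / 2 + 1 / 2 * (U (t + 2 * s))\<^sup>2))))"
          using True by (subst ennreal_mult) (auto simp: f_range)
        ultimately show ?thesis by (simp only: mult.assoc)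
      next
        case False
        then show ?thesis by (simp add: exponential_density_def)
      qed
    qed
    finally show ?thesis using U_eq[of t] by simp
  qed
  have v_end: "V n t = 1" if "T \<le> t" for n t
    using that
  proof (induction n arbitrary: t)
    case (Suc n)
    have "V (Suc n) t = (\<integral>\<^sup>+s. ennreal (exponential_density 2 s) \<partial>lborel)"
      unfolding VS
    proof (rule nn_integral_cong)
      fix s :: real
      show "ennreal (exponential_density 2 s) * (survival_factor t s * (ennreal (1 / 2) + ennreal (1 / 2) * (V n (t + 2 * s))\<^sup>2)) = ennreal (exponential_density 2 s)"
      proof (cases "0 \<le> s")
        case True
        have "ennreal (1 / 2) + ennreal (1 / 2) = ennreal (1 / 2 + 1 / 2)" by (rule ennreal_plus[symmetric]) auto
        then have h: "ennreal (1 / 2) + ennreal (1 / 2) * 1\<^sup>2 = 1" by simp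
        have s: "survival_factor t s = 1" using True Suc.prems by (simp add: survival_factor_def f_end hazard_end)
        have "V n (t + 2 * s) = 1" using True Suc.prems by (intro Suc.IH) simp
        then show ?thesis by (simp only: h s mult_1_right mult_1)
      next
        case False
        then show ?thesis by (simp add: exponential_density_def)
      qed
    qed
    then show ?case by (simp only: dens)
  qed (simp add: V0)
  have "U t = 1" if "T \<le> t" for t
  proof -
    have "(\<lambda>n. v n t) = (\<lambda>_. 1)" using v_end[OF that] by (simp add: v_def)
    then show ?thesis using LIMSEQ_unique[OF vU[of t]] by simp
  qed
  then have "excursion_functional f 0 = (1 + U 0) / 2"
    by (intro branching_functional_eq_excursion_functional U01 U_conv) (use T in auto)
  moreover have "(\<integral>\<^sup>+x. tree_weight x \<partial>tree_law) = ennreal (U 0)"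
  proof -
    have "(\<integral>\<^sup>+x. tree_weight x \<partial>tree_law) = (INF n. V n 0)"
      unfolding V_def tree_weight_def
      by (rule nn_integral_monotone_convergence_INF_AE[where i = 0])
         (auto simp: tree_functional_decseq T.emeasure_space_1[simplified] simp del: tree_functional.simps(2))
    moreover have "(\<lambda>n. V n 0) \<longlonglongrightarrow> (INF n. V n 0)"
      by (intro LIMSEQ_INF decseq_SucI Vdec)
    moreover have "(\<lambda>n. V n 0) \<longlonglongrightarrow> ennreal (U 0)"
      unfolding Vv by (intro tendsto_ennrealI vU)
    ultimately show ?thesis using LIMSEQ_unique by metis
  qed
  moreover have "ennreal (1 / 2) + ennreal (1 / 2) * ennreal (U 0) = ennreal ((1 + U 0) / 2)"
    using U01[of 0] by (simp add: ennreal_mult[symmetric] ennreal_plus[symmetric] add_divide_distrib del: ennreal_plus ennreal_half)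
  ultimately show ?thesis by (simp only:)
qed

end

section \<open>Sample paths: deaths and marks of a finite population\<close>

text \<open>Pathwise facts that a realised family provides. Births after time 0 happen only at
  deaths, none or two at once, so no death is cancelled in the population size. Individuals die at
  distinct times. Before the last death there is always somebody alive, so the clock of the marks
  does not pause.\<close>

locale population =
  fixes B :: "'i set" and b d :: "'i \<Rightarrow> real"
  assumes finite_B: "finite B"
    and birth_nonneg: "u \<in> B \<Longrightarrow> 0 \<le> b u"
    and birth_less_death: "u \<in> B \<Longrightarrow> b u < d u"
    and inj_death: "inj_on d B"
    and births: "0 < t \<Longrightarrow> card {u\<in>B. b u = t} \<in> (if t \<in> d ` B then {0, 2} else {0})"
    and connected: "0 \<le> t \<Longrightarrow> w \<in> B \<Longrightarrow> t < d w \<Longrightarrow> \<exists>u\<in>B. b u \<le> t \<and> t < d u"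
begin

definition size_at :: "real \<Rightarrow> nat" where
  "size_at s = card {u\<in>B. b u \<le> s \<and> s < d u}"

text \<open>The summand is the part of the lifetime of \<open>u\<close> spent up to time
  \<open>s\<close>. This is the integral of \<open>size_at\<close> in a closed form from which
  continuity is immediate.\<close>

definition clock :: "real \<Rightarrow> real" where
  "clock s = (\<Sum>u\<in>B. min s (d u) - min s (b u))"

lemma death_pos: "u \<in> B \<Longrightarrow> 0 < d u"
  using birth_nonneg birth_less_death by force

lemma size_at_sum: "real (size_at s) = (\<Sum>u\<in>B. of_bool (b u \<le> s) - of_bool (d u \<le> s))"
proof -
  have "real (size_at s) = (\<Sum>u\<in>B. of_bool (b u \<le> s \<and> s < d u))"
    unfolding size_at_def using finite_B by (simp add: Collect_conj_eq[symmetric] Int_def)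
  also have "\<dots> = (\<Sum>u\<in>B. of_bool (b u \<le> s) - of_bool (d u \<le> s))"
    using birth_less_death by (intro sum.cong) force+
  finally show ?thesis .
qed

lemma card_sum_of_bool: "real (card {u\<in>B. P u}) = (\<Sum>u\<in>B. of_bool (P u))"
  using finite_B by (simp add: Int_def)

lemma size_at_diff:
  assumes "s \<le> s'"
  shows "real (size_at s') - real (size_at s) = real (card {u\<in>B. s < b u \<and> b u \<le> s'}) - real (card {u\<in>B. s < d u \<and> d u \<le> s'})"
  unfolding size_at_sum card_sum_of_bool sum_subtractf[symmetric]
  using assms by (intro sum.cong) auto

lemma size_at_left:
  "\<forall>\<^sub>F s in at_left t. real (size_at s) = (\<Sum>u\<in>B. of_bool (b u < t) - of_bool (d u < t))"
proof -
  have ev: "\<forall>\<^sub>F s in at_left t. of_bool (x \<le> s) = (of_bool (x < t) :: real)" for x :: real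
  proof (cases "x < t")
    case True
    then have "\<forall>\<^sub>F s in at_left t. s \<in> {x<..<t}" by (rule eventually_at_left_real)
    then show ?thesis by eventually_elim (use True in auto)
  next
    case False
    have "\<forall>\<^sub>F s in at_left t. s \<in> {t - 1<..<t}" by (rule eventually_at_left_real) simp
    then show ?thesis by eventually_elim (use False in auto)
  qed
  have "\<forall>\<^sub>F s in at_left t. \<forall>u\<in>B. of_bool (b u \<le> s) = (of_bool (b u < t) :: real) \<and> of_bool (d u \<le> s) = (of_bool (d u < t) :: real)"
    using finite_B by (intro eventually_ball_finite ballI eventually_conj ev) auto
  then show ?thesis
    unfolding size_at_sum by eventually_elim (auto intro!: sum.cong)
qed

lemma card_death_eq: "card {u\<in>B. d u = t} = of_bool (t \<in> d ` B)"
proof (cases "t \<in> d ` B")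
  case True
  then obtain u where u: "u \<in> B" "d u = t" by auto
  then have "{u\<in>B. d u = t} = {u}" using inj_death by (auto simp: inj_on_def)
  then show ?thesis using True by simp
next
  case False
  then have "{u\<in>B. d u = t} = {}" by auto
  then show ?thesis using False by (simp only: card.empty) simp
qed

text \<open>At a death the size changes by 0 - 1 or 2 - 1, and at no other positive time do births
  occur.\<close>

lemma jump_size_at:
  assumes "0 < t"
  shows "jump (\<lambda>s. real (size_at s)) t \<in> {1, -1} \<longleftrightarrow> t \<in> d ` B"
proof -
  have "((\<lambda>s. real (size_at s)) \<longlongrightarrow> (\<Sum>u\<in>B. of_bool (b u < t) - of_bool (d u < t))) (at_left t)"
    by (rule tendsto_eventually[OF size_at_left])
  then have "jump (\<lambda>s. real (size_at s)) t = real (size_at t) - (\<Sum>u\<in>B. of_bool (b u < t) - of_bool (d u < t))"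
    unfolding jump_def by (subst tendsto_Lim) auto
  also have "\<dots> = (\<Sum>u\<in>B. of_bool (b u = t)) - (\<Sum>u\<in>B. of_bool (d u = t))"
    unfolding size_at_sum sum_subtractf[symmetric] by (intro sum.cong) auto
  also have "\<dots> = real (card {u\<in>B. b u = t}) - of_bool (t \<in> d ` B)"
    unfolding card_sum_of_bool[symmetric] card_death_eq by simp
  finally have j: "jump (\<lambda>s. real (size_at s)) t = real (card {u\<in>B. b u = t}) - of_bool (t \<in> d ` B)" .
  have c: "card {u\<in>B. b u = t} = 0 \<or> t \<in> d ` B \<and> card {u\<in>B. b u = t} = 2"
    using births[OF assms] by (cases "t \<in> d ` B") auto
  show ?thesis
    unfolding j using c by (elim disjE conjE) (simp_all only: of_bool_def, auto)
qed

lemma clock_nonpos: "s \<le> 0 \<Longrightarrow> clock s = 0"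
  unfolding clock_def using birth_nonneg death_pos by (intro sum.neutral) (force simp: min_def)

lemma clock_mono: "s \<le> s' \<Longrightarrow> clock s \<le> clock s'"
  unfolding clock_def using birth_less_death by (intro sum_mono) (force simp: min_def)

lemma clock_nonneg: "0 \<le> clock s"
  using clock_mono[of 0 s] clock_mono[of s 0] clock_nonpos[of 0] clock_nonpos[of s] by (cases "0 \<le> s") auto

text \<open>The individual alive at \<open>s\<close>, which \<open>connected\<close> provides, has a
  strictly growing share of the clock.\<close>

lemma clock_strict:
  assumes "0 \<le> s" "s < s'" "w \<in> B" "s < d w"
  shows "clock s < clock s'"
proof -
  obtain u where u: "u \<in> B" "b u \<le> s" "s < d u" using connected assms by blast
  show ?thesis unfolding clock_def
  proof (rule sum_strict_mono_ex1[OF finite_B])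
    show "\<forall>x\<in>B. min s (d x) - min s (b x) \<le> min s' (d x) - min s' (b x)"
      using birth_less_death assms(2) by (force simp: min_def)
    show "\<exists>a\<in>B. min s (d a) - min s (b a) < min s' (d a) - min s' (b a)"
      using u assms(2) by (intro bexI[of _ u]) (auto simp: min_def)
  qed
qed

lemma clock_const:
  assumes "\<And>w. w \<in> B \<Longrightarrow> d w \<le> s" "s \<le> s'"
  shows "clock s = clock s'"
  unfolding clock_def using assms birth_less_death by (intro sum.cong refl) (force simp: min_def)

lemma continuous_clock: "continuous_on A clock"
  unfolding clock_def by (intro continuous_intros)

lemma clock_measurable [measurable]: "clock \<in> borel_measurable borel"
  using continuous_clock by (rule borel_measurable_continuous_onI)

lemma integral_size_at: "(LBINT v:{0..t}. real (size_at v)) = clock t"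
proof (cases "0 \<le> t")
  case True
  have "(LBINT v:{0..t}. real (size_at v)) = (LBINT v. (\<Sum>u\<in>B. indicator ({0..t} \<inter> {b u..<d u}) v))"
    unfolding set_lebesgue_integral_def
  proof (rule Bochner_Integration.integral_cong[OF refl])
    fix v
    have "(\<Sum>u\<in>B. indicator ({0..t} \<inter> {b u..<d u}) v) = indicator {0..t} v * (\<Sum>u\<in>B. of_bool (b u \<le> v \<and> v < d u) :: real)"
      by (auto simp: sum_distrib_left indicator_def intro!: sum.cong)
    then show "indicator {0..t} v *\<^sub>R real (size_at v) = (\<Sum>u\<in>B. indicator ({0..t} \<inter> {b u..<d u}) v)"
      unfolding size_at_def card_sum_of_bool by simp
  qed
  also have "\<dots> = (\<Sum>u\<in>B. LBINT v. indicator ({0..t} \<inter> {b u..<d u}) v)"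
  proof (rule Bochner_Integration.integral_sum)
    fix u
    have "emeasure lborel ({0..t} \<inter> {b u..<d u}) \<le> emeasure lborel {0..t}"
      by (intro emeasure_mono) auto
    also have "\<dots> < \<infinity>" by (simp add: emeasure_lborel_Icc_eq)
    finally show "integrable lborel (indicator ({0..t} \<inter> {b u..<d u}) :: real \<Rightarrow> real)"
      by (intro integrable_real_indicator) auto
  qed
  also have "\<dots> = clock t"
    unfolding clock_def
  proof (intro sum.cong refl)
    fix u assume u: "u \<in> B"
    have b: "0 \<le> b u" "b u < d u" using birth_nonneg birth_less_death u by auto
    have "(LBINT v. indicator ({0..t} \<inter> {b u..<d u}) v :: real) = measure lborel ({0..t} \<inter> {b u..<d u})"
      by simp
    also have "\<dots> = min t (d u) - min t (b u)"
    proof -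
      consider "d u \<le> t" | "b u \<le> t" "t < d u" | "t < b u" by linarith
      then show ?thesis
      proof cases
        case 1
        then have "{0..t} \<inter> {b u..<d u} = {b u..<d u}" using b by auto
        then show ?thesis using 1 b by simp
      next
        case 2
        then have "{0..t} \<inter> {b u..<d u} = {b u..t}" using b by auto
        then show ?thesis using 2 b by simp
      next
        case 3
        then have "{0..t} \<inter> {b u..<d u} = {}" using b by auto
        then show ?thesis using 3 b by simp
      qed
    qed
    finally show "(LBINT v. indicator ({0..t} \<inter> {b u..<d u}) v) = min t (d u) - min t (b u)" .
  qed
  finally show ?thesis .
next
  case False
  then show ?thesis by (simp add: clock_nonpos set_lebesgue_integral_def)
qed

definition total_clock :: real where
  "total_clock = (\<Sum>u\<in>B. d u - b u)"

lemma clock_le_total: "clock s \<le> total_clock"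
  unfolding clock_def total_clock_def using birth_less_death by (intro sum_mono) (force simp: min_def)

lemma size_at_measurable [measurable]: "(\<lambda>s. real (size_at s)) \<in> borel_measurable borel"
  unfolding size_at_sum by measurable

lemma nn_integral_size_at:
  assumes [measurable]: "h \<in> borel_measurable borel"
  shows "(\<integral>\<^sup>+s. h s * ennreal (indicator {0..} s * real (size_at s)) \<partial>lborel) = (\<Sum>u\<in>B. \<integral>\<^sup>+s. h s * indicator {b u..<d u} s \<partial>lborel)"
proof -
  have "ennreal (indicator {0..} s * real (size_at s)) = (\<Sum>u\<in>B. indicator {b u..<d u} s)" for s
  proof -
    have "indicator {0..} s * real (size_at s) = (\<Sum>u\<in>B. indicator {b u..<d u} s)"
      unfolding size_at_def card_sum_of_bool sum_distrib_left using birth_nonneg by (intro sum.cong) (force simp: indicator_def)+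
    then have "ennreal (indicator {0..} s * real (size_at s)) = (\<Sum>u\<in>B. ennreal (indicator {b u..<d u} s))"
      by (simp only: sum_ennreal indicator_pos_le)
    then show ?thesis by (simp add: ennreal_indicator)
  qed
  then show ?thesis by (simp add: sum_distrib_left nn_integral_sum)
qed

text \<open>Change of variables along the clock, whose speed at time \<open>s\<close> is the
  population size. The clock may have kinks at deaths, so the two measures are compared on the half
  lines \<open>{y<..}\<close> instead of differentiating.\<close>

lemma clock_pushforward:
  "distr (density lborel (\<lambda>s. ennreal (indicator {0..} s * real (size_at s)))) borel clock = density lborel (indicator {0..total_clock})"
    (is "distr ?\<mu> borel clock = ?\<nu>")
proof (rule measure_eqI_lessThan)
  have \<mu>: "emeasure (distr ?\<mu> borel clock) {y<..} = (\<Sum>u\<in>B. emeasure lborel ({b u..<d u} \<inter> {s. y < clock s}))" for y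
  proof -
    have [measurable]: "{s. y < clock s} \<in> sets borel"
      using clock_measurable by (auto intro: borel_measurable_iff_greater[THEN iffD1, rule_format, simplified])
    have "emeasure (distr ?\<mu> borel clock) {y<..} = emeasure ?\<mu> {s. y < clock s}"
      by (subst emeasure_distr) (auto simp: vimage_def)
    also have "\<dots> = (\<integral>\<^sup>+s. indicator {s. y < clock s} s * ennreal (indicator {0..} s * real (size_at s)) \<partial>lborel)"
      by (subst emeasure_density) (auto simp: mult.commute)
    also have "\<dots> = (\<Sum>u\<in>B. emeasure lborel ({b u..<d u} \<inter> {s. y < clock s}))"
      by (subst nn_integral_size_at) (auto simp flip: indicator_inter_arith simp: Int_commute)
    finally show ?thesis .
  qed
  show eq: "emeasure (distr ?\<mu> borel clock) {y<..} = emeasure ?\<nu> {y<..}" for y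
  proof -
    have \<nu>: "emeasure ?\<nu> {y<..} = emeasure lborel ({0..total_clock} \<inter> {y<..})"
      by (subst emeasure_density) (auto simp flip: indicator_inter_arith)
    consider "y < 0" | "0 \<le> y" "y < total_clock" | "0 \<le> y" "total_clock \<le> y" by linarith
    then show ?thesis
    proof cases
      case 1
      then have "{b u..<d u} \<inter> {s. y < clock s} = {b u..<d u}" for u using clock_nonneg by (auto intro: less_le_trans)
      moreover have "{0..total_clock} \<inter> {y<..} = {0..total_clock}" using 1 by auto
      moreover have "0 \<le> total_clock" using clock_nonneg clock_le_total order.trans by blast
      ultimately show ?thesis
        unfolding \<mu> \<nu> using birth_less_death by (simp add: total_clock_def less_imp_le sum_ennreal)
    next
      case 2
      then have "B \<noteq> {}" by (auto simp: total_clock_def)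
      define \<zeta> where "\<zeta> = Max (d ` B)"
      have \<zeta>: "d u \<le> \<zeta>" if "u \<in> B" for u using that finite_B by (simp add: \<zeta>_def)
      have \<zeta>0: "0 \<le> \<zeta>" using \<open>B \<noteq> {}\<close> \<zeta> death_pos by force
      have "clock \<zeta> = total_clock"
        unfolding clock_def total_clock_def using \<zeta> birth_less_death by (intro sum.cong refl) (force simp: min_def)
      then obtain c where c: "0 \<le> c" "c \<le> \<zeta>" "clock c = y"
        using IVT'[of clock 0 y \<zeta>] 2 \<zeta>0 continuous_clock clock_nonpos[of 0] by auto
      have "\<exists>w\<in>B. c < d w"
      proof (rule ccontr)
        assume "\<not> (\<exists>w\<in>B. c < d w)"
        then have "clock c = clock \<zeta>" using c by (intro clock_const) (auto simp: not_less)
        then show False using c 2 \<open>clock \<zeta> = total_clock\<close> by simp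
      qed
      then obtain w where w: "w \<in> B" "c < d w" by blast
      \<comment> \<open>Somebody dies after \<open>c\<close>, so the clock exceeds \<open>y\<close>
        immediately after \<open>c\<close>, and the set where it does is a half line in
        time.\<close>
      have iff: "y < clock s \<longleftrightarrow> c < s" for s
        using clock_strict[OF c(1) _ w, of s] clock_mono[of s c] c by (cases "c < s") auto
      have *: "{b u..<d u} \<inter> {s. y < clock s} = (if c < b u then {b u..<d u} else {c<..<d u})" for u
        using birth_less_death by (auto simp: iff)
      have "emeasure lborel ({b u..<d u} \<inter> {s. y < clock s}) = ennreal ((d u - b u) - (min c (d u) - min c (b u)))" if "u \<in> B" for u
        unfolding * using birth_less_death[OF that] by (cases "c < d u") (auto simp: min_def)
      then have "emeasure (distr ?\<mu> borel clock) {y<..} = (\<Sum>u\<in>B. ennreal ((d u - b u) - (min c (d u) - min c (b u))))"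
        unfolding \<mu> by simp
      also have "\<dots> = ennreal (\<Sum>u\<in>B. (d u - b u) - (min c (d u) - min c (b u)))"
        by (rule sum_ennreal) (use birth_less_death in \<open>force simp: min_def\<close>)
      also have "(\<Sum>u\<in>B. (d u - b u) - (min c (d u) - min c (b u))) = total_clock - y"
        unfolding sum_subtractf c(3)[symmetric] by (simp add: total_clock_def clock_def sum_subtractf)
      also have "{0..total_clock} \<inter> {y<..} = {y<..total_clock}" using 2 by auto
      then have "ennreal (total_clock - y) = emeasure ?\<nu> {y<..}" unfolding \<nu> using 2 by simp
      finally show ?thesis .
    next
      case 3
      then have "\<not> y < clock s" for s using clock_le_total[of s] by simp
      then have "{b u..<d u} \<inter> {s. y < clock s} = {}" for u by simp
      moreover have "{0..total_clock} \<inter> {y<..} = {}" using 3 by auto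
      ultimately show ?thesis unfolding \<mu> \<nu> by simp
    qed
  qed
  show "emeasure (distr ?\<mu> borel clock) {y<..} < \<infinity>" for y
  proof -
    have "emeasure lborel ({b u..<d u} \<inter> {s. y < clock s}) < \<infinity>" for u
      by (intro emeasure_bounded_finite bounded_subset[OF compact_imp_bounded[OF compact_Icc[of "b u" "d u"]]]) auto
    then show ?thesis unfolding \<mu> using finite_B by simp
  qed
qed auto

text \<open>While the population is alive the clock runs, so \<open>clock s \<le> clock t \<longleftrightarrow> s \<le> t\<close>.\<close>

lemma exp_integral_step_weight:
  assumes J: "finite J" and q: "\<And>s. s \<in> J \<Longrightarrow> 0 \<le> q s \<and> q s \<le> 1" and T: "\<And>s. s \<in> J \<Longrightarrow> s < T"
  shows "exp (- integral {0..total_clock + 1} (\<lambda>y. 1 - step_weight J clock q y)) =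
    (\<Prod>u\<in>B. exp (killing_rate.hazard (step_weight J (\<lambda>s. s) q) T (d u) - killing_rate.hazard (step_weight J (\<lambda>s. s) q) T (b u)))"
proof -
  let ?f = "step_weight J (\<lambda>s. s) q" and ?g = "step_weight J clock q"
  interpret f: killing_rate ?f "(\<lambda>s. s) ` J" T
    using killing_rate_step_weight[of J q "\<lambda>s. s" T] J q T by blast
  \<comment> \<open>The Poisson generating function is stated for levels strictly below a bound,
    hence the \<open>+ 1\<close>.\<close>
  have cl: "clock s < total_clock + 1" for s using clock_le_total[of s] by linarith
  interpret g: killing_rate ?g "clock ` J" "total_clock + 1"
    by (rule killing_rate_step_weight[OF J q cl])
  have g_end: "?g y = 1" if "total_clock < y" for y
  proof -
    have "\<not> y \<le> clock x" for x using clock_le_total[of x] that by linarith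
    then show ?thesis unfolding step_weight_def by simp
  qed
  have "ennreal (integral {0..total_clock + 1} (\<lambda>y. 1 - ?g y)) =
    (\<integral>\<^sup>+y. (if 0 \<le> y \<and> y \<le> total_clock + 1 then ennreal (1 - ?g y) else 0) \<partial>lborel)"
    by (rule bounded_measurable_integrable_on(2)[symmetric, where B = 1]) (auto simp: g.f_range)
  also have "\<dots> = (\<integral>\<^sup>+y. indicator {0..total_clock} y * ennreal (1 - ?g y) \<partial>lborel)"
    by (intro nn_integral_cong) (auto simp: g_end indicator_def)
  also have "\<dots> = (\<integral>\<^sup>+y. ennreal (1 - ?g y) \<partial>density lborel (indicator {0..total_clock}))"
    by (subst nn_integral_density) auto
  also have "\<dots> = (\<integral>\<^sup>+s. ennreal (1 - ?g (clock s)) * ennreal (indicator {0..} s * real (size_at s)) \<partial>lborel)"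
    unfolding clock_pushforward[symmetric]
    by (subst nn_integral_distr, measurable, subst nn_integral_density) (auto simp: mult.commute)
  also have "\<dots> = (\<integral>\<^sup>+s. ennreal (1 - ?f s) * ennreal (indicator {0..} s * real (size_at s)) \<partial>lborel)"
  proof (rule nn_integral_cong_AE)
    show "AE s in lborel. ennreal (1 - ?g (clock s)) * ennreal (indicator {0..} s * real (size_at s)) = ennreal (1 - ?f s) * ennreal (indicator {0..} s * real (size_at s))"
      \<comment> \<open>At \<open>s = 0\<close> the equivalence fails, since
        \<open>clock t = clock 0\<close> also for negative \<open>t\<close>. For positive
        \<open>s\<close> such \<open>t\<close> are handled through \<open>max 0 t\<close>.\<close>
      using AE_lborel_singleton[of "0::real"]
    proof eventually_elim
      case (elim s)
      show ?case
      proof (cases "0 \<le> s \<and> size_at s \<noteq> 0")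
        case True
        then have "{u\<in>B. b u \<le> s \<and> s < d u} \<noteq> {}" unfolding size_at_def by (metis card.empty)
        then obtain w where w: "w \<in> B" "s < d w" by blast
        have "clock s \<le> clock t \<longleftrightarrow> s \<le> t" for t
        proof (cases "t < s")
          case t: True
          have "clock (max 0 t) < clock s"
            using t elim True w by (intro clock_strict[of "max 0 t" s w]) auto
          moreover have "clock t \<le> clock (max 0 t)" by (rule clock_mono) simp
          ultimately show ?thesis using t by simp
        qed (use clock_mono in auto)
        then have "?g (clock s) = ?f s" unfolding step_weight_def by simp
        then show ?thesis by simp
      qed auto
    qed
  qed
  also have "\<dots> = (\<Sum>u\<in>B. \<integral>\<^sup>+s. ennreal (1 - ?f s) * indicator {b u..<d u} s \<partial>lborel)"
    by (rule nn_integral_size_at) measurable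
  also have "\<dots> = (\<Sum>u\<in>B. ennreal (f.hazard (b u) - f.hazard (d u)))"
  proof (intro sum.cong refl)
    fix u assume u: "u \<in> B"
    have "(\<integral>\<^sup>+s. ennreal (1 - ?f s) * indicator {b u..<d u} s \<partial>lborel) = (\<integral>\<^sup>+s. (if b u \<le> s \<and> s \<le> d u then ennreal (1 - ?f s) else 0) \<partial>lborel)"
    proof (rule nn_integral_cong_AE)
      show "AE s in lborel. ennreal (1 - ?f s) * indicator {b u..<d u} s = (if b u \<le> s \<and> s \<le> d u then ennreal (1 - ?f s) else 0)"
        using AE_lborel_singleton[of "d u"] by eventually_elim auto
    qed
    also have "\<dots> = ennreal (integral {b u..d u} (\<lambda>s. 1 - ?f s))"
      by (rule bounded_measurable_integrable_on(2)[where B = 1]) (auto simp: f.f_range)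
    also have "integral {b u..d u} (\<lambda>s. 1 - ?f s) = f.hazard (b u) - f.hazard (d u)"
      using birth_less_death[OF u] by (intro f.hazard_diff[symmetric]) simp
    finally show "(\<integral>\<^sup>+s. ennreal (1 - ?f s) * indicator {b u..<d u} s \<partial>lborel) = ennreal (f.hazard (b u) - f.hazard (d u))" .
  qed
  also have "\<dots> = ennreal (\<Sum>u\<in>B. f.hazard (b u) - f.hazard (d u))"
    using birth_less_death f.hazard_antimono by (intro sum_ennreal) (simp add: less_imp_le)
  finally have "integral {0..total_clock + 1} (\<lambda>y. 1 - ?g y) = (\<Sum>u\<in>B. f.hazard (b u) - f.hazard (d u))"
    by (subst (asm) ennreal_inj)
       (auto intro!: integral_nonneg g.integrable_killing sum_nonneg simp: g.f_range f.hazard_antimono birth_less_death less_imp_le)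
  then show ?thesis
    by (simp add: exp_sum[OF finite_B, symmetric] sum_negf[symmetric])
qed

end

context population
begin

lemma size_at_right: "\<forall>\<^sub>F s' in at_right s. size_at s' = size_at s"
proof -
  have ev: "\<forall>\<^sub>F s' in at_right s. of_bool (x \<le> s') = (of_bool (x \<le> s) :: real)" for x :: real
  proof (cases "s < x")
    case True
    then have "\<forall>\<^sub>F s' in at_right s. s' \<in> {s<..<x}" by (rule eventually_at_right_real)
    then show ?thesis by eventually_elim (use True in auto)
  next
    case False
    have "\<forall>\<^sub>F s' in at_right s. s' \<in> {s<..<s + 1}" by (rule eventually_at_right_real) simp
    then show ?thesis by eventually_elim (use False in auto)
  qed
  have "\<forall>\<^sub>F s' in at_right s. \<forall>u\<in>B. of_bool (b u \<le> s') = (of_bool (b u \<le> s) :: real) \<and> of_bool (d u \<le> s') = (of_bool (d u \<le> s) :: real)"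
    using finite_B by (intro eventually_ball_finite ballI eventually_conj ev) auto
  then have "\<forall>\<^sub>F s' in at_right s. real (size_at s') = real (size_at s)"
    unfolding size_at_sum by eventually_elim (auto intro!: sum.cong)
  then show ?thesis by simp
qed

end

section \<open>Marks as points reached by the population clock\<close>

locale marked_population = population +
  fixes \<Gamma> :: "nat \<Rightarrow> real"
  assumes strict_mono_points: "strict_mono \<Gamma>" and points_pos: "0 < \<Gamma> n"
    and points_lim: "filterlim \<Gamma> at_top sequentially"
begin

definition points :: "real \<Rightarrow> nat" where
  "points a = card {n. \<Gamma> n \<le> a}"

text \<open>After the last death the clock is constant, and if it stops exactly at a point of
  \<open>\<Gamma>\<close> the preimage is a half line; the bound by a death time keeps only its
  first element.\<close>

definition marks :: "real set" where
  "marks = {t. 0 < t \<and> (\<exists>w\<in>B. t \<le> d w) \<and> clock t \<in> range \<Gamma>}"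

definition events :: "real set" where
  "events = d ` B \<union> marks"

lemma points_lessThan: obtains k where "{n. \<Gamma> n \<le> a} = {..<k}" "a < \<Gamma> k"
proof -
  obtain m where m: "a < \<Gamma> m"
    using points_lim by (auto simp: filterlim_at_top_dense eventually_sequentially)
  define k where "k = (LEAST n. a < \<Gamma> n)"
  have k: "a < \<Gamma> k" unfolding k_def using m by (rule LeastI)
  have "\<Gamma> n \<le> a \<longleftrightarrow> n < k" for n
  proof
    assume "n < k"
    then show "\<Gamma> n \<le> a" unfolding k_def using not_less_Least[of n "\<lambda>n. a < \<Gamma> n"] by auto
  next
    assume "\<Gamma> n \<le> a"
    then have "\<Gamma> n < \<Gamma> k" using k by simp
    then show "n < k" using strict_mono_points by (simp add: strict_mono_less)
  qed
  then show ?thesis using k by (intro that[of k]) auto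
qed

lemma finite_points: "finite {n. \<Gamma> n \<le> a}"
  by (rule points_lessThan[of a]) simp

lemma points_eq_card_range: "points a = card (range \<Gamma> \<inter> {..a})"
proof -
  have "range \<Gamma> \<inter> {..a} = \<Gamma> ` {n. \<Gamma> n \<le> a}" by auto
  then show ?thesis
    unfolding points_def using strict_mono_points by (simp add: card_image strict_mono_on_imp_inj_on strict_mono_eq inj_on_def)
qed

lemma points_right: "\<forall>\<^sub>F a' in at_right a. points a' = points a"
proof -
  obtain k where k: "{n. \<Gamma> n \<le> a} = {..<k}" "a < \<Gamma> k" by (rule points_lessThan)
  have "\<forall>\<^sub>F a' in at_right a. a' \<in> {a<..<\<Gamma> k}" by (rule eventually_at_right_real) fact
  then show ?thesis
  proof eventually_elim
    case (elim a')
    have "\<Gamma> n \<le> a' \<longleftrightarrow> \<Gamma> n \<le> a" for n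
    proof
      assume "\<Gamma> n \<le> a'"
      then have "\<Gamma> n < \<Gamma> k" using elim by simp
      then have "n \<in> {..<k}" using strict_mono_points by (simp add: strict_mono_less)
      then show "\<Gamma> n \<le> a" using k by blast
    qed (use elim in auto)
    then show ?case by (simp add: points_def)
  qed
qed

text \<open>Up to the last death the clock is continuous and strictly increasing, so each point
  reached has one preimage. A value attained after the last death was already attained at that
  death, which is then the mark.\<close>

lemma bij_betw_marks: "bij_betw clock (marks \<inter> {..s}) (range \<Gamma> \<inter> {..clock s})"
  unfolding bij_betw_def
proof
  have less: "clock t < clock t'" if "t \<in> marks" "t' \<in> marks" "t < t'" for t t'
  proof -
    from that obtain w where "w \<in> B" "t' \<le> d w" by (auto simp: marks_def)
    then show ?thesis using that by (intro clock_strict[of t t' w]) (auto simp: marks_def)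
  qed
  show "inj_on clock (marks \<inter> {..s})"
    by (rule linorder_inj_onI) (use less in \<open>auto dest: less_imp_neq\<close>)
  show "clock ` (marks \<inter> {..s}) = range \<Gamma> \<inter> {..clock s}"
  proof (intro equalityI subsetI)
    fix y assume "y \<in> clock ` (marks \<inter> {..s})"
    then show "y \<in> range \<Gamma> \<inter> {..clock s}" using clock_mono by (auto simp: marks_def)
  next
    fix y assume y: "y \<in> range \<Gamma> \<inter> {..clock s}"
    then have y0: "0 < y" using points_pos by auto
    then have s: "0 < s" using y clock_nonpos[of s] by (cases "0 < s") auto
    obtain t where t: "0 \<le> t" "t \<le> s" "clock t = y"
      using IVT'[of clock 0 y s] y y0 s continuous_clock clock_nonpos[of 0] by auto
    have t0: "0 < t" using t y0 clock_nonpos[of t] by (cases "0 < t") auto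
    show "y \<in> clock ` (marks \<inter> {..s})"
    proof (cases "\<exists>w\<in>B. t \<le> d w")
      case True
      then have "t \<in> marks" using t t0 y by (auto simp: marks_def)
      then show ?thesis using t by auto
    next
      case False
      have "B \<noteq> {}" using t y0 by (auto simp: clock_def)
      define \<zeta> where "\<zeta> = Max (d ` B)"
      have \<zeta>: "\<zeta> \<in> d ` B" "\<And>w. w \<in> B \<Longrightarrow> d w \<le> \<zeta>"
        using finite_B \<open>B \<noteq> {}\<close> by (auto simp: \<zeta>_def intro!: Max_in)
      then have "\<zeta> < t" using False by auto
      then have c: "clock \<zeta> = y" using clock_const[OF \<zeta>(2), of t] t by simp
      have "\<zeta> \<in> marks" using \<zeta> c y death_pos by (auto simp: marks_def)
      then show ?thesis using c t \<open>\<zeta> < t\<close> by auto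
    qed
  qed
qed

lemma card_marks: "card (marks \<inter> {..s}) = points (clock s)"
  unfolding points_eq_card_range by (rule bij_betw_same_card[OF bij_betw_marks])

lemma finite_marks: "finite marks"
proof -
  obtain s where s: "\<forall>x\<in>d ` B. x \<le> s"
    using bdd_above_finite[of "d ` B"] finite_B by (auto simp: bdd_above_def)
  have "marks \<inter> {..s} = marks" using s by (force simp: marks_def)
  moreover have "finite (range \<Gamma> \<inter> {..clock s})"
  proof -
    have "range \<Gamma> \<inter> {..clock s} = \<Gamma> ` {n. \<Gamma> n \<le> clock s}" by auto
    then show ?thesis using finite_points[of "clock s"] by simp
  qed
  ultimately show ?thesis using bij_betw_finite[OF bij_betw_marks, of s] by simp
qed

lemma finite_events: "finite events"
  using finite_marks finite_B by (simp add: events_def)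

lemma events_pos: "events \<subseteq> {0<..}"
  using death_pos by (auto simp: events_def marks_def)

text \<open>Just before \<open>t\<close> the clock is strictly below \<open>clock t\<close>, so the
  left limit counts the points strictly below that value. After the last death the clock and the
  count are constant.\<close>

lemma jump_points:
  assumes t: "0 < t"
  shows "jump (\<lambda>s. real (points (clock s))) t = 1 \<longleftrightarrow> t \<in> marks"
proof (cases "\<exists>w\<in>B. t \<le> d w")
  case True
  then obtain w where w: "w \<in> B" "t \<le> d w" by blast
  let ?P = "{n. \<Gamma> n < clock t}"
  have fin: "finite ?P" by (rule finite_subset[OF _ finite_points[of "clock t"]]) auto
  have cont: "(clock \<longlongrightarrow> clock t) (at_left t)"
    using continuous_clock[of UNIV] by (simp add: continuous_on_def filterlim_at_split)
  have "\<forall>\<^sub>F s in at_left t. \<forall>n\<in>?P. \<Gamma> n < clock s"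
    using fin by (intro eventually_ball_finite ballI order_tendstoD(1)[OF cont]) auto
  moreover have "\<forall>\<^sub>F s in at_left t. s \<in> {0<..<t}" using t by (rule eventually_at_left_real)
  ultimately have "\<forall>\<^sub>F s in at_left t. real (points (clock s)) = real (card ?P)"
  proof eventually_elim
    case (elim s)
    have "clock s < clock t" using elim w by (intro clock_strict[of s t w]) auto
    then have "{n. \<Gamma> n \<le> clock s} = ?P" using elim by (auto intro: le_less_trans)
    then show ?case by (simp add: points_def)
  qed
  then have "((\<lambda>s. real (points (clock s))) \<longlongrightarrow> real (card ?P)) (at_left t)" by (rule tendsto_eventually)
  then have j: "jump (\<lambda>s. real (points (clock s))) t = real (points (clock t)) - real (card ?P)"
    unfolding jump_def by (subst tendsto_Lim) auto
  show ?thesis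
  proof (cases "clock t \<in> range \<Gamma>")
    case in_range: True
    then obtain m where m: "\<Gamma> m = clock t" by auto
    have "{n. \<Gamma> n \<le> clock t} = insert m ?P"
      using m strict_mono_points by (auto simp: le_less strict_mono_eq[symmetric])
    then have "points (clock t) = Suc (card ?P)" using fin m by (simp add: points_def)
    then show ?thesis using j in_range t True by (simp add: marks_def)
  next
    case False
    then have "\<Gamma> n \<noteq> clock t" for n by (metis rangeI)
    then have "{n. \<Gamma> n \<le> clock t} = ?P" by (auto simp: le_less)
    then show ?thesis using j False by (simp add: points_def marks_def)
  qed
next
  case False
  then have "\<forall>x\<in>d ` B. x < t" by auto
  then obtain s0 where s0: "s0 < t" "\<forall>x\<in>d ` B. x \<le> s0"
  proof -
    assume *: "\<And>s0. s0 < t \<Longrightarrow> \<forall>x\<in>d ` B. x \<le> s0 \<Longrightarrow> thesis" and a: "\<forall>x\<in>d ` B. x < t"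
    show thesis by (rule *[of "Max (insert 0 (d ` B))"]) (use a t finite_B in auto)
  qed
  have "\<forall>\<^sub>F s in at_left t. s \<in> {s0<..<t}" using s0(1) by (rule eventually_at_left_real)
  then have "\<forall>\<^sub>F s in at_left t. real (points (clock s)) = real (points (clock t))"
  proof eventually_elim
    case (elim s)
    have "clock s = clock t"
      using elim s0(2) by (intro clock_const) (auto intro: order.trans less_imp_le)
    then show ?case by simp
  qed
  then have "((\<lambda>s. real (points (clock s))) \<longlongrightarrow> real (points (clock t))) (at_left t)" by (rule tendsto_eventually)
  then have "jump (\<lambda>s. real (points (clock s))) t = 0"
    unfolding jump_def by (subst tendsto_Lim) auto
  then show ?thesis using False by (simp add: marks_def)
qed

lemma events_eq_jumps:
  "events = {t. 0 < t \<and> (jump (\<lambda>s. real (size_at s)) t \<in> {1, -1} \<or> jump (\<lambda>s. real (points (clock s))) t = 1)}"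
  using jump_size_at jump_points events_pos by (auto simp: events_def)

definition state :: "real \<Rightarrow> nat \<times> nat" where
  "state s = (size_at s, points (clock s))"

text \<open>A lone death is visible because it comes with 0 or 2 births, and a mark raises the
  second component. Several deaths may bring the size back to its old value, so only empty and
  singleton cells are described.\<close>

lemma state_increment:
  assumes s: "0 \<le> s" "s < s'"
  shows "events \<inter> {s<..s'} = {} \<Longrightarrow> state s = state s'"
    and "card (events \<inter> {s<..s'}) = 1 \<Longrightarrow> state s \<noteq> state s'"
proof -
  have births_in: "b u \<in> d ` B" if "u \<in> B" "s < b u" for u
  proof (rule ccontr)
    assume "b u \<notin> d ` B"
    then have "card {v\<in>B. b v = b u} = 0" using births[of "b u"] that s by auto
    then show False using finite_B that by auto
  qed
  have split: "marks \<inter> {..s'} = (marks \<inter> {..s}) \<union> (marks \<inter> {s<..s'})" using s by auto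
  have pts: "points (clock s') = points (clock s) + card (marks \<inter> {s<..s'})"
    unfolding card_marks[symmetric] split by (rule card_Un_disjoint) (use finite_marks in auto)
  {
    assume e: "events \<inter> {s<..s'} = {}"
    then have no: "{u\<in>B. s < d u \<and> d u \<le> s'} = {}" by (auto simp: events_def)
    have "b u \<in> events \<inter> {s<..s'}" if "u \<in> B" "s < b u" "b u \<le> s'" for u
      using births_in that by (simp add: events_def)
    then have nb: "{u\<in>B. s < b u \<and> b u \<le> s'} = {}" using e by blast
    have "real (size_at s') = real (size_at s)" using size_at_diff[of s s'] s unfolding no nb by simp
    moreover have "marks \<inter> {s<..s'} = {}" using e by (auto simp: events_def)
    ultimately show "state s = state s'" using pts by (simp add: state_def)
  }
  {
    assume "card (events \<inter> {s<..s'}) = 1"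
    then obtain e where e: "events \<inter> {s<..s'} = {e}" by (rule card_1_singletonE)
    then have es: "e \<in> events" "s < e" "e \<le> s'" by auto
    show "state s \<noteq> state s'"
    proof (cases "e \<in> marks")
      case True
      then have "e \<in> marks \<inter> {s<..s'}" using es by simp
      then have "0 < card (marks \<inter> {s<..s'})" using finite_marks by (auto simp: card_gt_0_iff)
      then show ?thesis using pts by (simp add: state_def)
    next
      case False
      then have ed: "e \<in> d ` B" using es by (simp add: events_def)
      have only: "x = e" if "x \<in> d ` B" "s < x" "x \<le> s'" for x
      proof -
        have "x \<in> events \<inter> {s<..s'}" using that by (simp add: events_def)
        then show ?thesis unfolding e by simp
      qed
      have "{u\<in>B. s < d u \<and> d u \<le> s'} = {u\<in>B. d u = e}" using only es by auto
      then have D: "card {u\<in>B. s < d u \<and> d u \<le> s'} = 1" using ed by (simp add: card_death_eq)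
      have "{u\<in>B. s < b u \<and> b u \<le> s'} = {u\<in>B. b u = e}" using only births_in es by auto
      moreover have "card {u\<in>B. b u = e} \<in> {0, 2}" using births[of e] ed es s by simp
      ultimately have "card {u\<in>B. s < b u \<and> b u \<le> s'} \<noteq> 1" by auto
      then have "real (size_at s') \<noteq> real (size_at s)" using size_at_diff[of s s'] s D by auto
      then show ?thesis by (auto simp: state_def)
    qed
  }
qed

text \<open>Deaths and marks add up when no mark falls on a death; such a coincidence would be a
  single element of \<open>events\<close>.\<close>

lemma card_events:
  assumes "\<And>u n. u \<in> B \<Longrightarrow> \<Gamma> n \<noteq> clock (d u)"
  shows "card (events \<inter> {..s}) = card {u\<in>B. d u \<le> s} + points (clock s)"
proof -
  have "events \<inter> {..s} = (d ` B \<inter> {..s}) \<union> (marks \<inter> {..s})" by (auto simp: events_def)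
  moreover have "(d ` B \<inter> {..s}) \<inter> (marks \<inter> {..s}) = {}" using assms by (force simp: marks_def)
  ultimately have "card (events \<inter> {..s}) = card (d ` B \<inter> {..s}) + card (marks \<inter> {..s})"
    using finite_B finite_marks by (simp add: card_Un_disjoint)
  moreover have "d ` B \<inter> {..s} = d ` {u\<in>B. d u \<le> s}" by auto
  then have "card (d ` B \<inter> {..s}) = card {u\<in>B. d u \<le> s}"
    using inj_death by (simp add: card_image inj_on_def)
  ultimately show ?thesis by (simp add: card_marks)
qed

end

section \<open>The event counts as a function of the two paths\<close>

text \<open>Only the processes \<open>Z\<close> and \<open>N\<close> are independent, not the labels and spacings they are built from.
  The counts are therefore expressed through countably many values of the two paths, so that their
  law can be computed on the product of the laws of \<open>Z\<close> and \<open>N\<close>, with independent labels and spacings.\<close>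

lemma sum_card_cells:
  assumes "finite E" "mono g"
  shows "(\<Sum>i<n. card (E \<inter> {g i<..g (Suc i)})) = card (E \<inter> {g 0<..(g n :: real)})"
proof (induction n)
  case (Suc n)
  have "g 0 \<le> g n" "g n \<le> g (Suc n)" using assms(2) by (auto simp: mono_def)
  then have "E \<inter> {g 0<..g (Suc n)} = (E \<inter> {g 0<..g n}) \<union> (E \<inter> {g n<..g (Suc n)})" by auto
  moreover have "(E \<inter> {g 0<..g n}) \<inter> (E \<inter> {g n<..g (Suc n)}) = {}" by auto
  ultimately show ?case using assms(1) Suc by (simp add: card_Un_disjoint)
qed simp

text \<open>Once the mesh is below the minimal gap of \<open>E\<close>, every cell contains at most
  one point, and the change of \<open>\<phi>\<close> across the cell tells which case holds. The 1
  inserted in the minimum \<open>\<delta>\<close> covers sets with fewer than two points.\<close>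

lemma grid_count:
  fixes \<phi> :: "real \<Rightarrow> 'b"
  assumes E: "finite E" "E \<subseteq> {0<..}" and t: "0 < t"
    and eq: "\<And>s s'. 0 \<le> s \<Longrightarrow> s < s' \<Longrightarrow> E \<inter> {s<..s'} = {} \<Longrightarrow> \<phi> s = \<phi> s'"
    and neq: "\<And>s s'. 0 \<le> s \<Longrightarrow> s < s' \<Longrightarrow> card (E \<inter> {s<..s'}) = 1 \<Longrightarrow> \<phi> s \<noteq> \<phi> s'"
  shows "\<forall>\<^sub>F k in sequentially. (\<Sum>i<2 ^ k. of_bool (\<phi> (t * real i / 2 ^ k) \<noteq> \<phi> (t * real (Suc i) / 2 ^ k))) = real (card (E \<inter> {..t}))"
proof -
  define D where "D = (\<lambda>(x, y). \<bar>x - y\<bar>) ` {(x, y) \<in> E \<times> E. x \<noteq> y}"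
  have "finite {(x, y) \<in> E \<times> E. x \<noteq> y}"
    by (rule finite_subset[of _ "E \<times> E"]) (use E in auto)
  then have "finite D" unfolding D_def by (rule finite_imageI)
  define \<delta> where "\<delta> = Min (insert 1 D)"
  have \<delta>: "0 < \<delta>" unfolding \<delta>_def using \<open>finite D\<close> by (subst Min_gr_iff) (auto simp: D_def)
  have far: "\<delta> \<le> \<bar>x - y\<bar>" if "x \<in> E" "y \<in> E" "x \<noteq> y" for x y
    unfolding \<delta>_def using that \<open>finite D\<close> by (intro Min_le) (auto simp: D_def image_iff)
  have "(\<lambda>k. t * (1 / 2) ^ k) \<longlonglongrightarrow> t * 0"
    by (intro tendsto_mult tendsto_const LIMSEQ_power_zero) simp
  then have "\<forall>\<^sub>F k in sequentially. t * (1 / 2) ^ k < \<delta>"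
    using \<delta> by (intro order_tendstoD(2)) auto
  then show ?thesis
  proof eventually_elim
    case (elim k)
    define g where "g i = t * real i / 2 ^ k" for i
    have g_less: "g i < g (Suc i)" for i using t by (simp add: g_def divide_strict_right_mono)
    have "mono g" using t by (auto simp: g_def mono_def intro!: divide_right_mono mult_left_mono)
    have width: "g (Suc i) - g i < \<delta>" for i
      using elim by (simp add: g_def power_divide diff_divide_distrib[symmetric] algebra_simps)
    have cell: "of_bool (\<phi> (g i) \<noteq> \<phi> (g (Suc i))) = real (card (E \<inter> {g i<..g (Suc i)}))" for i
    proof -
      have "x = y" if "x \<in> E \<inter> {g i<..g (Suc i)}" "y \<in> E \<inter> {g i<..g (Suc i)}" for x y
      proof (rule ccontr)
        assume "x \<noteq> y"
        then have "\<delta> \<le> \<bar>x - y\<bar>" using that by (intro far) auto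
        then show False using that width[of i] by (auto simp: abs_if split: if_splits)
      qed
      then have "card (E \<inter> {g i<..g (Suc i)}) \<le> 1"
        using E(1) by (simp add: card_le_Suc0_iff_eq)
      then consider "card (E \<inter> {g i<..g (Suc i)}) = 0" | "card (E \<inter> {g i<..g (Suc i)}) = 1" by linarith
      then show ?thesis
      proof cases
        case 1
        then have "E \<inter> {g i<..g (Suc i)} = {}" using E(1) by simp
        then show ?thesis using eq[OF _ g_less[of i]] t by (simp add: g_def)
      next
        case 2
        then show ?thesis using neq[OF _ g_less[of i]] t by (simp add: g_def)
      qed
    qed
    have "(\<Sum>i<2 ^ k. of_bool (\<phi> (g i) \<noteq> \<phi> (g (Suc i)))) = real (card (E \<inter> {g 0<..g (2 ^ k)}))"
      unfolding cell of_nat_sum[symmetric] sum_card_cells[OF E(1) \<open>mono g\<close>] ..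
    also have "E \<inter> {g 0<..g (2 ^ k)} = E \<inter> {..t}" using E(2) by (auto simp: g_def)
    finally show ?case by (simp add: g_def)
  qed
qed

text \<open>Approximates \<open>x \<ge> 0\<close> strictly from the right through countably many
  times. Evaluation of an arbitrary path at a variable time is not measurable on the product space;
  evaluation at these times is, and a right-continuous path recovers its value in the limit.\<close>

definition dyadic_above :: "nat \<Rightarrow> real \<Rightarrow> real" where
  "dyadic_above k x = (real (nat \<lfloor>2 ^ k * x\<rfloor>) + 1) / 2 ^ k"

lemma dyadic_above_tendsto:
  assumes "0 \<le> x"
  shows "filterlim (\<lambda>k. dyadic_above k x) (at_right x) sequentially"
proof -
  have *: "dyadic_above k x = (real_of_int \<lfloor>2 ^ k * x\<rfloor> + 1) / 2 ^ k" for k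
    using assms by (simp add: dyadic_above_def)
  have gt: "x < dyadic_above k x" for k
    unfolding * using real_of_int_floor_add_one_gt[of "2 ^ k * x"] by (simp add: field_simps)
  have le: "dyadic_above k x \<le> x + (1 / 2) ^ k" for k
    unfolding * using of_int_floor_le[of "2 ^ k * x"] by (simp add: field_simps power_divide)
  have "(\<lambda>k. dyadic_above k x) \<longlonglongrightarrow> x"
  proof (rule tendsto_sandwich[of "\<lambda>_. x" _ _ "\<lambda>k. x + (1 / 2) ^ k"])
    have "(\<lambda>k. x + (1 / 2) ^ k) \<longlonglongrightarrow> x + 0" by (intro tendsto_add tendsto_const LIMSEQ_power_zero) simp
    then show "(\<lambda>k. x + (1 / 2) ^ k) \<longlonglongrightarrow> x" by simp
  qed (use gt le in \<open>auto intro!: always_eventually less_imp_le\<close>)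
  moreover have "dyadic_above k x \<in> {x<..} \<and> dyadic_above k x \<noteq> x" for k using gt[of k] by simp
  ultimately show ?thesis by (simp add: filterlim_at)
qed

text \<open>For arbitrary paths the limit may be meaningless, but it is measurable, as each
  integrand looks at countably many coordinates of \<open>z\<close>; for the path of a population it
  is the clock.\<close>

definition path_clock :: "(real \<Rightarrow> nat) \<Rightarrow> real \<Rightarrow> real" where
  "path_clock z t = lim (\<lambda>k. LBINT v:{0..t}. real (z (dyadic_above k v / 2)))"

definition path_marks :: "(real \<Rightarrow> nat) \<Rightarrow> (real \<Rightarrow> nat) \<Rightarrow> real \<Rightarrow> real" where
  "path_marks z n t = lim (\<lambda>k. real (n (dyadic_above k (path_clock z t))))"

definition path_count :: "(real \<Rightarrow> nat) \<Rightarrow> (real \<Rightarrow> nat) \<Rightarrow> real \<Rightarrow> nat" where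
  "path_count z n t = (if t \<le> 0 then 0 else nat \<lfloor>lim (\<lambda>k. \<Sum>i<2 ^ k. of_bool
     (z (t * real i / 2 ^ k / 2) \<noteq> z (t * real (Suc i) / 2 ^ k / 2) \<or>
      path_marks z n (t * real i / 2 ^ k) \<noteq> path_marks z n (t * real (Suc i) / 2 ^ k)) :: real)\<rfloor>)"

text \<open>The three limits are resolved in turn: the clock by dominated convergence, as the size
  never exceeds \<open>card B\<close>; the marks by right-continuity of the point count; the events
  by \<open>grid_count\<close>.\<close>

lemma (in marked_population) path_count_eq:
  assumes z: "\<And>s. 0 \<le> s \<Longrightarrow> z (s / 2) = size_at s" and n: "\<And>a. 0 \<le> a \<Longrightarrow> n a = points a"
  shows "path_count z n t = card (events \<inter> {..t})"
proof (cases "t \<le> 0")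
  case True
  then have "events \<inter> {..t} = {}" using events_pos by force
  then show ?thesis using True by (simp add: path_count_def)
next
  case False
  have above0: "0 \<le> dyadic_above k v" for k v by (simp add: dyadic_above_def)
  have clock: "path_clock z s = clock s" for s
  proof -
    have "(\<lambda>k. LBINT v:{0..s}. real (z (dyadic_above k v / 2))) \<longlonglongrightarrow> (LBINT v:{0..s}. real (size_at v))"
      unfolding set_lebesgue_integral_def
    proof (rule integral_dominated_convergence[where w = "\<lambda>v. indicator {0..s} v * real (card B)"])
      show "(\<lambda>v. indicator {0..s} v *\<^sub>R real (size_at v)) \<in> borel_measurable lborel" by measurable
      have dm: "dyadic_above k \<in> borel_measurable borel" for k
        unfolding dyadic_above_def by measurable
      have [measurable]: "(\<lambda>v. real (size_at (dyadic_above k v))) \<in> borel_measurable borel" for k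
        by (rule measurable_compose[OF dm size_at_measurable])
      show "(\<lambda>v. indicator {0..s} v *\<^sub>R real (z (dyadic_above k v / 2))) \<in> borel_measurable lborel" for k
        by (simp only: z[OF above0]) measurable
      show "integrable lborel (\<lambda>v. indicator {0..s} v * real (card B))"
        by (intro integrable_mult_left integrable_real_indicator) (auto simp: emeasure_lborel_Icc_eq)
      show "AE v in lborel. (\<lambda>k. indicator {0..s} v *\<^sub>R real (z (dyadic_above k v / 2))) \<longlonglongrightarrow> indicator {0..s} v *\<^sub>R real (size_at v)"
      proof (rule AE_I2)
        fix v :: real
        show "(\<lambda>k. indicator {0..s} v *\<^sub>R real (z (dyadic_above k v / 2))) \<longlonglongrightarrow> indicator {0..s} v *\<^sub>R real (size_at v)"
        proof (cases "0 \<le> v")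
          case True
          have "\<forall>\<^sub>F k in sequentially. size_at (dyadic_above k v) = size_at v"
            using dyadic_above_tendsto[OF True] size_at_right[of v] by (auto simp: filterlim_iff)
          then have "\<forall>\<^sub>F k in sequentially. indicator {0..s} v *\<^sub>R real (z (dyadic_above k v / 2)) = indicator {0..s} v *\<^sub>R real (size_at v)"
            by eventually_elim (simp add: z[OF above0])
          then show ?thesis by (rule tendsto_eventually)
        qed simp
      qed
      have "size_at v \<le> card B" for v
        unfolding size_at_def using finite_B by (intro card_mono) auto
      then show "AE v in lborel. norm (indicator {0..s} v *\<^sub>R real (z (dyadic_above k v / 2))) \<le> indicator {0..s} v * real (card B)" for k
        by (intro AE_I2) (auto simp: z[OF above0] indicator_def)
    qed
    then show ?thesis unfolding path_clock_def integral_size_at by (rule limI)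
  qed
  have marks: "path_marks z n s = real (points (clock s))" for s
  proof -
    have "\<forall>\<^sub>F k in sequentially. points (dyadic_above k (clock s)) = points (clock s)"
      using dyadic_above_tendsto[OF clock_nonneg[of s]] points_right[of "clock s"] by (auto simp: filterlim_iff)
    then have "\<forall>\<^sub>F k in sequentially. real (n (dyadic_above k (clock s))) = real (points (clock s))"
      by eventually_elim (simp add: n[OF above0])
    then show ?thesis unfolding path_marks_def clock by (intro limI tendsto_eventually)
  qed
  have "\<forall>\<^sub>F k in sequentially. (\<Sum>i<2 ^ k. of_bool (state (t * real i / 2 ^ k) \<noteq> state (t * real (Suc i) / 2 ^ k))) = real (card (events \<inter> {..t}))"
    by (rule grid_count[OF finite_events events_pos]) (use False state_increment in auto)
  moreover have "of_bool (z (t * real i / 2 ^ k / 2) \<noteq> z (t * real (Suc i) / 2 ^ k / 2) \<or>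
      path_marks z n (t * real i / 2 ^ k) \<noteq> path_marks z n (t * real (Suc i) / 2 ^ k)) =
      (of_bool (state (t * real i / 2 ^ k) \<noteq> state (t * real (Suc i) / 2 ^ k)) :: real)" for i k
    using False z[of "t * real i / 2 ^ k"] z[of "t * real (Suc i) / 2 ^ k"] by (simp add: marks state_def)
  ultimately have "(\<lambda>k. \<Sum>i<2 ^ k. of_bool (z (t * real i / 2 ^ k / 2) \<noteq> z (t * real (Suc i) / 2 ^ k / 2) \<or>
      path_marks z n (t * real i / 2 ^ k) \<noteq> path_marks z n (t * real (Suc i) / 2 ^ k))) \<longlonglongrightarrow> real (card (events \<inter> {..t}))"
    by (intro tendsto_eventually) simp
  then show ?thesis using False by (simp add: path_count_def limI)
qed

lemma measurable_path_count [measurable]: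
  "(\<lambda>p. path_count (fst p) (snd p) t) \<in> (\<Pi>\<^sub>M s\<in>{0..}. count_space UNIV) \<Otimes>\<^sub>M (\<Pi>\<^sub>M s\<in>{0..}. count_space UNIV) \<rightarrow>\<^sub>M count_space UNIV"
proof -
  let ?S = "(\<Pi>\<^sub>M s\<in>{0..}. count_space UNIV) :: (real \<Rightarrow> nat) measure"
  have [measurable]: "(\<lambda>z. z s) \<in> ?S \<rightarrow>\<^sub>M count_space UNIV" if "0 \<le> s" for s
    by (rule measurable_component_singleton) (use that in simp)
  \<comment> \<open>The argument takes countably many values, indexed by
    \<open>nat \<lfloor>2 ^ k * g p\<rfloor>\<close>; composing through this index reduces
    measurability to fixed coordinates.\<close>
  have eval: "(\<lambda>p. real (f p (dyadic_above k (g p) / c))) \<in> borel_measurable M"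
    if [measurable]: "f \<in> M \<rightarrow>\<^sub>M ?S" "g \<in> borel_measurable M" and c: "0 < c" for f and g :: "_ \<Rightarrow> real" and k c and M :: "'z measure"
  proof -
    have "(\<lambda>p. (\<lambda>j p. real (f p ((real j + 1) / 2 ^ k / c))) (nat \<lfloor>2 ^ k * g p\<rfloor>) p) \<in> borel_measurable M"
    proof (rule measurable_compose_countable[where f = "\<lambda>j p. real (f p ((real j + 1) / 2 ^ k / c))" and g = "\<lambda>p. nat \<lfloor>2 ^ k * g p\<rfloor>"])
      have [measurable]: "(\<lambda>z. z ((real j + 1) / 2 ^ k / c)) \<in> ?S \<rightarrow>\<^sub>M count_space UNIV" for j
        using c by (intro measurable_component_singleton) simp
      show "(\<lambda>p. real (f p ((real j + 1) / 2 ^ k / c))) \<in> borel_measurable M" for j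
        by measurable
      have "(\<lambda>x::int. nat x) \<in> count_space UNIV \<rightarrow>\<^sub>M count_space UNIV" by simp
      then show "(\<lambda>p. nat \<lfloor>2 ^ k * g p\<rfloor>) \<in> M \<rightarrow>\<^sub>M count_space UNIV"
        by (rule measurable_compose[rotated]) measurable
    qed
    then show ?thesis by (simp add: dyadic_above_def)
  qed
  have clock [measurable]: "(\<lambda>z. path_clock z s) \<in> borel_measurable ?S" for s
  proof -
    have "(\<lambda>p. real (fst p (dyadic_above k (snd p) / 2))) \<in> borel_measurable (?S \<Otimes>\<^sub>M lborel)" for k
      by (rule eval) auto
    then have [measurable]: "(\<lambda>z. LBINT v:{0..s}. real (z (dyadic_above k v / 2))) \<in> borel_measurable ?S" for k
      unfolding set_lebesgue_integral_def
      by (intro lborel.borel_measurable_lebesgue_integral) (auto simp: case_prod_beta)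
    show ?thesis unfolding path_clock_def by measurable
  qed
  have [measurable]: "(\<lambda>p. path_marks (fst p) (snd p) s) \<in> borel_measurable (?S \<Otimes>\<^sub>M ?S)" for s
  proof -
    have "(\<lambda>p. real (snd p (dyadic_above k (path_clock (fst p) s) / 1))) \<in> borel_measurable (?S \<Otimes>\<^sub>M ?S)" for k
      by (rule eval) auto
    then have [measurable]: "(\<lambda>p. real (snd p (dyadic_above k (path_clock (fst p) s)))) \<in> borel_measurable (?S \<Otimes>\<^sub>M ?S)" for k
      by simp
    show ?thesis unfolding path_marks_def by measurable
  qed
  show ?thesis
  proof (cases "t \<le> 0")
    case False
    have [measurable]: "(\<lambda>p. fst p (t * real i / 2 ^ k / 2)) \<in> ?S \<Otimes>\<^sub>M ?S \<rightarrow>\<^sub>M count_space UNIV" for i k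
      using False by (intro measurable_compose[OF measurable_fst]) auto
    have neq: "Measurable.pred (?S \<Otimes>\<^sub>M ?S) (\<lambda>p. f p \<noteq> g p)" if "f \<in> borel_measurable (?S \<Otimes>\<^sub>M ?S)" "g \<in> borel_measurable (?S \<Otimes>\<^sub>M ?S)" for f g :: "_ \<Rightarrow> real"
      using borel_measurable_neq[OF that] by (simp add: pred_def)
    have "Measurable.pred (?S \<Otimes>\<^sub>M ?S) (\<lambda>p. real (fst p (t * real i / 2 ^ k / 2)) \<noteq> real (fst p (t * real (Suc i) / 2 ^ k / 2)))" for i k
      by (rule neq) measurable
    then have [measurable]: "Measurable.pred (?S \<Otimes>\<^sub>M ?S) (\<lambda>p. fst p (t * real i / 2 ^ k / 2) \<noteq> fst p (t * real (Suc i) / 2 ^ k / 2))" for i k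
      by (simp only: of_nat_eq_iff)
    have [measurable]: "Measurable.pred (?S \<Otimes>\<^sub>M ?S) (\<lambda>p. path_marks (fst p) (snd p) (t * real i / 2 ^ k) \<noteq> path_marks (fst p) (snd p) (t * real (Suc i) / 2 ^ k))" for i k
      by (rule neq) measurable
    have [measurable]: "(\<lambda>p. lim (\<lambda>k. \<Sum>i<2 ^ k. of_bool
     (fst p (t * real i / 2 ^ k / 2) \<noteq> fst p (t * real (Suc i) / 2 ^ k / 2) \<or>
      path_marks (fst p) (snd p) (t * real i / 2 ^ k) \<noteq> path_marks (fst p) (snd p) (t * real (Suc i) / 2 ^ k)) :: real)) \<in> borel_measurable (?S \<Otimes>\<^sub>M ?S)"
      by measurable
    have "(\<lambda>x::int. nat x) \<in> count_space UNIV \<rightarrow>\<^sub>M count_space UNIV" by simp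
    then have "(\<lambda>p. nat \<lfloor>lim (\<lambda>k. \<Sum>i<2 ^ k. of_bool
     (fst p (t * real i / 2 ^ k / 2) \<noteq> fst p (t * real (Suc i) / 2 ^ k / 2) \<or>
      path_marks (fst p) (snd p) (t * real i / 2 ^ k) \<noteq> path_marks (fst p) (snd p) (t * real (Suc i) / 2 ^ k)) :: real)\<rfloor>) \<in> ?S \<Otimes>\<^sub>M ?S \<rightarrow>\<^sub>M count_space UNIV"
      by (rule measurable_compose[rotated]) measurable
    then show ?thesis unfolding path_count_def by (simp only: False if_False)
  qed (simp add: path_count_def)
qed

lemma path_count_cong:
  assumes "\<And>s. 0 \<le> s \<Longrightarrow> z s = z' s" "\<And>s. 0 \<le> s \<Longrightarrow> n s = n' s"
  shows "path_count z n t = path_count z' n' t"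
proof -
  have "0 \<le> dyadic_above k v" for k v by (simp add: dyadic_above_def)
  then have "path_clock z = path_clock z'" "\<And>x k. n (dyadic_above k x) = n' (dyadic_above k x)"
    using assms by (simp_all add: path_clock_def[abs_def])
  then have "path_marks z n = path_marks z' n'" by (simp add: path_marks_def[abs_def])
  then show ?thesis using assms(1) by (simp add: path_count_def)
qed

section \<open>From family trees to populations\<close>

lemma tree_born_snoc: "tree_born x (v @ [c]) \<longleftrightarrow> tree_born x v \<and> c < snd (x v)"
proof -
  have "(v @ [c]) ! k < snd (x (take k (v @ [c]))) \<longleftrightarrow> v ! k < snd (x (take k v))" if "k < length v" for k
    using that by (simp add: nth_append)
  then show ?thesis by (auto simp: tree_born_def less_Suc_eq)
qed

lemma tree_birth_snoc: "tree_birth x (v @ [c]) = tree_birth x v + fst (x v)"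
  unfolding tree_birth_def by simp

lemma tree_born_take: "tree_born x w \<Longrightarrow> tree_born x (take k w)"
  by (auto simp: tree_born_def min_def)

text \<open>Birth and death times on the time scale of \<open>Z (t / 2)\<close>.\<close>

definition birth2 :: "tree \<Rightarrow> nat list \<Rightarrow> real" where
  "birth2 x w = 2 * tree_birth x w"

definition death2 :: "tree \<Rightarrow> nat list \<Rightarrow> real" where
  "death2 x w = 2 * (tree_birth x w + fst (x w))"

text \<open>Every birth after time 0 is at the death of a parent, unique because death times differ,
  and its 0 or 2 children are all born then. For \<open>connected\<close>, the shortest prefix of
  \<open>w\<close> that dies after \<open>t\<close> is alive at \<open>t\<close>.\<close>

lemma population_tree:
  assumes v: "valid_tree x" and fin: "finite {w. tree_born x w}" and inj: "inj_on (death2 x) {w. tree_born x w}"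
  shows "population {w. tree_born x w} (birth2 x) (death2 x)"
proof
  have pos: "0 < fst (x w)" for w using v by (simp add: valid_tree_def)
  have birth0: "0 \<le> tree_birth x w" for w
    unfolding tree_birth_def using pos by (intro sum_nonneg) (simp add: less_imp_le)
  show "finite {w. tree_born x w}" by fact
  show "inj_on (death2 x) {w. tree_born x w}" by fact
  show "0 \<le> birth2 x u" for u using birth0 by (simp add: birth2_def)
  show "birth2 x u < death2 x u" for u using pos by (simp add: birth2_def death2_def)
  show "card {u \<in> {w. tree_born x w}. birth2 x u = t} \<in> (if t \<in> death2 x ` {w. tree_born x w} then {0, 2} else {0})"
    if t: "0 < t" for t
  proof -
    have parent: "\<exists>v c. u = v @ [c] \<and> tree_born x v \<and> c < snd (x v) \<and> death2 x v = t" if "tree_born x u" "birth2 x u = t" for u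
    proof (cases u rule: rev_cases)
      case Nil
      then show ?thesis using that t by (simp add: birth2_def)
    next
      case (snoc v c)
      then show ?thesis using that by (auto simp: tree_born_snoc birth2_def death2_def tree_birth_snoc)
    qed
    show ?thesis
    proof (cases "t \<in> death2 x ` {w. tree_born x w}")
      case True
      then obtain w where w: "tree_born x w" "death2 x w = t" by auto
      have "{u \<in> {w. tree_born x w}. birth2 x u = t} = (\<lambda>c. w @ [c]) ` {..<snd (x w)}"
      proof (intro equalityI subsetI)
        fix u assume u: "u \<in> {u \<in> {w. tree_born x w}. birth2 x u = t}"
        then obtain v c where vc: "u = v @ [c]" "tree_born x v" "c < snd (x v)" "death2 x v = t" using parent by blast
        then have "v = w" using inj w by (auto simp: inj_on_def)
        then show "u \<in> (\<lambda>c. w @ [c]) ` {..<snd (x w)}" using vc by auto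
      qed (use w in \<open>auto simp: tree_born_snoc birth2_def death2_def tree_birth_snoc\<close>)
      then have "card {u \<in> {w. tree_born x w}. birth2 x u = t} = snd (x w)"
        by (simp add: card_image inj_on_def)
      then show ?thesis using v True by (auto simp: valid_tree_def)
    next
      case False
      have e: "{u \<in> {w. tree_born x w}. birth2 x u = t} = {}"
      proof (rule ccontr)
        assume "{u \<in> {w. tree_born x w}. birth2 x u = t} \<noteq> {}"
        then obtain u where u: "tree_born x u" "birth2 x u = t" by auto
        then obtain v c where "tree_born x v" "death2 x v = t" using parent[OF u] by blast
        then show False using False by auto
      qed
      show ?thesis unfolding e using False by simp
    qed
  qed
  show "\<exists>u\<in>{w. tree_born x w}. birth2 x u \<le> t \<and> t < death2 x u"
    if t: "0 \<le> t" "w \<in> {w. tree_born x w}" "t < death2 x w" for t w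
  proof -
    define k where "k = (LEAST k. t < death2 x (take k w))"
    have "t < death2 x (take (length w) w)" using t by simp
    then have k: "t < death2 x (take k w)" unfolding k_def by (rule LeastI)
    have "k \<le> length w" unfolding k_def by (rule Least_le) (use t in simp)
    have "birth2 x (take k w) \<le> t"
    proof (cases k)
      case 0
      then show ?thesis using t by (simp add: birth2_def)
    next
      case (Suc j)
      then have "\<not> t < death2 x (take j w)" using not_less_Least[of j "\<lambda>k. t < death2 x (take k w)"] by (simp add: k_def)
      moreover have "take k w = take j w @ [w ! j]" using Suc \<open>k \<le> length w\<close> by (simp add: take_Suc_conv_app_nth)
      ultimately show ?thesis by (simp add: birth2_def death2_def tree_birth_snoc)
    qed
    then show ?thesis using k t tree_born_take by (intro bexI[of _ "take k w"]) auto
  qed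
qed

lemma population_empty: "population {} b d"
  by unfold_locales auto

text \<open>Only descendants of the initial individual 0 are kept, which suffices when there is at
  most one initial individual.\<close>

definition family_tree :: "(indiv \<Rightarrow> real) \<Rightarrow> (indiv \<Rightarrow> nat) \<Rightarrow> tree" where
  "family_tree L K w = (L (0, w), K (0, w))"

definition population_set :: "nat \<Rightarrow> tree \<Rightarrow> nat list set" where
  "population_set z x = (if z = 0 then {} else {w. tree_born x w})"

lemma card_alive:
  assumes "z \<le> 1"
  shows "card (alive z L K t) = card {w\<in>population_set z (family_tree L K). birth2 (family_tree L K) w \<le> 2 * t \<and> 2 * t < death2 (family_tree L K) w}"
proof -
  have "alive z L K t = Pair 0 ` {w\<in>population_set z (family_tree L K). birth2 (family_tree L K) w \<le> 2 * t \<and> 2 * t < death2 (family_tree L K) w}"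
  proof -
    consider "z = 0" | "z = 1" using assms by linarith
    then show ?thesis
      by cases (auto simp: alive_def ever_born_def birth_time_def population_set_def tree_born_def tree_birth_def family_tree_def birth2_def death2_def image_iff)
  qed
  then show ?thesis by (simp add: card_image inj_on_def)
qed

lemma jump_cong:
  assumes "0 < t" "\<And>s. 0 \<le> s \<Longrightarrow> f s = g s"
  shows "jump f t = jump g t"
proof -
  have "\<forall>\<^sub>F s in at_left t. s \<in> {0<..<t}" using assms(1) by (rule eventually_at_left_real)
  then have "\<forall>\<^sub>F s in at_left t. f s = g s" by eventually_elim (use assms(2) in auto)
  then have "(f \<longlongrightarrow> l) (at_left t) \<longleftrightarrow> (g \<longlongrightarrow> l) (at_left t)" for l
    by (rule tendsto_cong)
  then show ?thesis using assms by (simp add: jump_def t2_space_class.Lim_def)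
qed

lemma (in marked_population) event_times_eq:
  assumes Z: "\<And>s. 0 \<le> s \<Longrightarrow> Z (s / 2) \<omega> = size_at s" and N: "\<And>a. 0 \<le> a \<Longrightarrow> N a \<omega> = points a"
  shows "event_times Z N \<omega> = events"
proof -
  have "(LBINT v:{0..s}. real (Z (v / 2) \<omega>)) = clock s" for s
  proof -
    have "(LBINT v:{0..s}. real (Z (v / 2) \<omega>)) = (LBINT v:{0..s}. real (size_at v))"
      by (rule set_lebesgue_integral_cong) (auto simp: Z)
    then show ?thesis by (simp add: integral_size_at)
  qed
  then have M: "N_marks Z N s \<omega> = points (clock s)" for s
    by (simp add: N_marks_def N clock_nonneg)
  have "jump (\<lambda>s. real (Z (s / 2) \<omega>)) t = jump (\<lambda>s. real (size_at s)) t" if "0 < t" for t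
    by (rule jump_cong[OF that]) (simp add: Z)
  then show ?thesis
    unfolding event_times_def events_eq_jumps M by auto
qed

section \<open>Laws of the ingredients\<close>

lemma (in prob_space) indep_rv_distr:
  assumes "indep_rv M S X T Y"
  shows "distr M S X \<Otimes>\<^sub>M distr M T Y = distr M (S \<Otimes>\<^sub>M T) (\<lambda>\<omega>. (X \<omega>, Y \<omega>))"
proof -
  have [measurable]: "X \<in> M \<rightarrow>\<^sub>M S" "Y \<in> M \<rightarrow>\<^sub>M T"
    and ind: "indep_set {X -` A \<inter> space M | A. A \<in> sets S} {Y -` B \<inter> space M | B. B \<in> sets T}"
    using assms by (auto simp: indep_rv_def)
  interpret X: prob_space "distr M S X" by (rule prob_space_distr) simp
  interpret Y: prob_space "distr M T Y" by (rule prob_space_distr) simp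
  show ?thesis
  proof (rule pair_measure_eqI)
    fix A B assume "A \<in> sets (distr M S X)" "B \<in> sets (distr M T Y)"
    then have [measurable]: "A \<in> sets S" "B \<in> sets T" by auto
    have "emeasure (distr M (S \<Otimes>\<^sub>M T) (\<lambda>\<omega>. (X \<omega>, Y \<omega>))) (A \<times> B) = emeasure M ((X -` A \<inter> space M) \<inter> (Y -` B \<inter> space M))"
      by (subst emeasure_distr) (auto intro!: arg_cong[where f = "emeasure M"])
    also have "\<dots> = emeasure M (X -` A \<inter> space M) * emeasure M (Y -` B \<inter> space M)"
      unfolding emeasure_eq_measure
      by (subst indep_setD[OF ind]) (auto simp: ennreal_mult)
    finally show "emeasure (distr M S X) A * emeasure (distr M T Y) B = emeasure (distr M (S \<Otimes>\<^sub>M T) (\<lambda>\<omega>. (X \<omega>, Y \<omega>))) (A \<times> B)"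
      by (simp add: emeasure_distr)
  qed (unfold_locales, simp)
qed

lemma (in prob_space) distr_family_tree:
  fixes L :: "indiv \<Rightarrow> 'a \<Rightarrow> real" and K :: "indiv \<Rightarrow> 'a \<Rightarrow> nat"
  assumes L: "\<And>u. distributed M lborel (L u) (exponential_density 2)"
    and K: "\<And>u. distr M (count_space UNIV) (K u) = measure_pmf (pmf_of_set {0, 2})"
    and LK: "\<And>u. indep_rv M borel (L u) (count_space UNIV) (K u)"
    and ind: "indep_vars (\<lambda>_. borel \<Otimes>\<^sub>M count_space UNIV) (\<lambda>u \<omega>. (L u \<omega>, K u \<omega>)) UNIV"
  defines "Y \<equiv> \<lambda>\<omega> u. (L u \<omega>, K u \<omega>)" and "\<phi> \<equiv> \<lambda>y w. y (0, w)"
  shows "Y \<in> M \<rightarrow>\<^sub>M (\<Pi>\<^sub>M u\<in>UNIV. node_space)"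
    and "\<phi> \<in> (\<Pi>\<^sub>M u\<in>UNIV. node_space) \<rightarrow>\<^sub>M tree_space"
    and "distr (distr M (\<Pi>\<^sub>M u\<in>UNIV. node_space) Y) tree_space \<phi> = tree_law"
proof -
  let ?S = "(\<Pi>\<^sub>M u\<in>UNIV. node_space) :: (indiv \<Rightarrow> real \<times> nat) measure"
  have rv: "(\<lambda>\<omega>. (L u \<omega>, K u \<omega>)) \<in> M \<rightarrow>\<^sub>M node_space" for u
  proof -
    have "L u \<in> M \<rightarrow>\<^sub>M borel" "K u \<in> M \<rightarrow>\<^sub>M count_space UNIV" using LK[of u] unfolding indep_rv_def by blast+
    then show ?thesis unfolding node_space_def by (rule measurable_Pair)
  qed
  show Y [measurable]: "Y \<in> M \<rightarrow>\<^sub>M ?S"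
    unfolding Y_def by (rule measurable_PiM_single') (use rv in auto)
  have "(\<lambda>y w. y (0, w)) \<in> ?S \<rightarrow>\<^sub>M (\<Pi>\<^sub>M w\<in>UNIV. node_space)"
    by (rule measurable_PiM_single') (auto intro!: measurable_component_singleton)
  then show \<phi> [measurable]: "\<phi> \<in> ?S \<rightarrow>\<^sub>M tree_space" by (simp add: \<phi>_def tree_space_def)
  have node: "distr M node_space (\<lambda>\<omega>. (L u \<omega>, K u \<omega>)) = node_law" for u
  proof -
    have "distr M borel (L u) = density lborel (\<lambda>l. ennreal (exponential_density 2 l))"
      using distributed_distr_eq_density[OF L[of u]] by (simp cong: distr_cong)
    then show ?thesis
      using indep_rv_distr[OF LK[of u]] by (simp add: node_law_def node_space_def K)
  qed
  have ind': "indep_vars (\<lambda>_. node_space) (\<lambda>u \<omega>. (L u \<omega>, K u \<omega>)) UNIV"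
    using ind by (simp add: node_space_def)
  have "distr M ?S (\<lambda>\<omega>. \<lambda>u\<in>UNIV. (L u \<omega>, K u \<omega>)) = (\<Pi>\<^sub>M u\<in>UNIV. distr M node_space (\<lambda>\<omega>. (L u \<omega>, K u \<omega>)))"
    by (rule iffD1[OF indep_vars_iff_distr_eq_PiM ind']) (use rv in auto)
  then have D: "distr M ?S Y = (\<Pi>\<^sub>M u\<in>(UNIV :: indiv set). node_law)"
    by (simp add: Y_def node restrict_def)
  have "distr (\<Pi>\<^sub>M u\<in>(UNIV :: indiv set). node_law) (\<Pi>\<^sub>M w\<in>UNIV. node_law) (\<lambda>\<omega>. \<lambda>w\<in>UNIV. \<omega> (0, w)) = (\<Pi>\<^sub>M w\<in>UNIV. node_law)"
    by (rule distr_PiM_reindex) (auto simp: inj_on_def prob_space_node_law)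
  then show "distr (distr M ?S Y) tree_space \<phi> = tree_law"
    unfolding D \<phi>_def by (simp add: tree_law_def[symmetric] sets_tree_law restrict_def cong: distr_cong)
qed

definition prefixes_of :: "'a list \<Rightarrow> 'a list set" where
  "prefixes_of w = (\<lambda>k. take k w) ` {..length w}"

text \<open>A death time is twice the sum of the lifetimes along all prefixes. Two different words
  cannot be prefixes of each other, so some lifetime enters the difference with a nonzero
  coefficient.\<close>

lemma (in prob_space) AE_distinct_deaths:
  assumes ind: "indep_vars (\<lambda>_. borel) L UNIV" and D: "\<And>u. distributed M lborel (L u) p"
    and ne: "w \<noteq> w'"
  shows "AE \<omega> in M. death2 (family_tree (\<lambda>u. L u \<omega>) (\<lambda>u. K u \<omega>)) w \<noteq> death2 (family_tree (\<lambda>u. L u \<omega>) (\<lambda>u. K u \<omega>)) w'"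
proof -
  have death: "death2 (family_tree l k) w = 2 * (\<Sum>v\<in>prefixes_of w. l (0, v))" for l k w
  proof -
    have "inj_on (\<lambda>k. take k w) {..length w}"
      by (rule inj_on_inverseI[of _ length]) (simp add: min_def)
    then have "(\<Sum>v\<in>prefixes_of w. l (0, v)) = (\<Sum>k\<le>length w. l (0, take k w))"
      by (simp add: prefixes_of_def sum.reindex)
    also have "\<dots> = tree_birth (family_tree l k) w + fst (family_tree l k w)"
      by (simp add: tree_birth_def family_tree_def lessThan_Suc_atMost[symmetric])
    finally show ?thesis by (simp add: death2_def)
  qed
  let ?J = "prefixes_of w \<union> prefixes_of w'"
  define c :: "indiv \<Rightarrow> real" where "c u = of_bool (snd u \<in> prefixes_of w) - of_bool (snd u \<in> prefixes_of w')" for u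
  have fin: "finite (prefixes_of v)" for v :: "nat list" by (simp add: prefixes_of_def)
  have self: "v \<in> prefixes_of v" for v :: "nat list" by (auto simp: prefixes_of_def intro!: image_eqI[of _ _ "length v"])
  have "\<exists>i\<in>Pair 0 ` ?J. c i \<noteq> 0"
  proof (cases "w \<in> prefixes_of w'")
    case False
    then show ?thesis using self[of w] by (intro bexI[of _ "(0, w)"]) (auto simp: c_def)
  next
    case True
    have "w' \<notin> prefixes_of w"
    proof
      assume "w' \<in> prefixes_of w"
      then obtain i j where "w' = take i w" "w = take j w'" using True unfolding prefixes_of_def by blast
      then have "length w = length w'" by (metis length_take min.cobounded1 order.antisym)
      then show False using \<open>w' = take i w\<close> ne by (metis length_take min.absorb_iff1 take_all)
    qed
    then show ?thesis using self[of w'] by (intro bexI[of _ "(0, w')"]) (auto simp: c_def)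
  qed
  then obtain i where i: "i \<in> Pair 0 ` ?J" "c i \<noteq> 0" by blast
  have "AE \<omega> in M. (\<Sum>u\<in>Pair 0 ` ?J. c u * L u \<omega>) \<noteq> 0"
    by (rule AE_linear_combination_neq[where X = L and i = i and c = c, OF ind _ _ i D]) (use fin in auto)
  then show ?thesis
  proof eventually_elim
    case (elim \<omega>)
    have "(\<Sum>u\<in>Pair 0 ` ?J. c u * L u \<omega>) = (\<Sum>v\<in>?J. of_bool (v \<in> prefixes_of w) * L (0, v) \<omega>) - (\<Sum>v\<in>?J. of_bool (v \<in> prefixes_of w') * L (0, v) \<omega>)"
      by (subst sum.reindex) (auto simp: c_def inj_on_def left_diff_distrib sum_subtractf)
    also have "(\<Sum>v\<in>?J. of_bool (v \<in> prefixes_of w) * L (0, v) \<omega>) = (\<Sum>v\<in>prefixes_of w. L (0, v) \<omega>)"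
      using fin by (intro sum.mono_neutral_cong_right) auto
    also have "(\<Sum>v\<in>?J. of_bool (v \<in> prefixes_of w') * L (0, v) \<omega>) = (\<Sum>v\<in>prefixes_of w'. L (0, v) \<omega>)"
      using fin by (intro sum.mono_neutral_cong_right) auto
    finally show ?case using elim by (simp add: death)
  qed
qed

section \<open>The branching process with its marks\<close>

lemma population_population_set:
  assumes "valid_tree x" "finite {w. tree_born x w}" "inj_on (death2 x) {w. tree_born x w}"
  shows "population (population_set z x) (birth2 x) (death2 x)"
  by (auto simp: population_set_def intro: population_tree[OF assms] population_empty)

lemma (in population) marked_population_walk:
  assumes "\<forall>i. 0 < E i \<omega>" "filterlim (\<lambda>n. walk E n \<omega>) at_top sequentially"
  shows "marked_population B b d (\<lambda>n. walk E (Suc n) \<omega>)"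
proof
  show "strict_mono (\<lambda>n. walk E (Suc n) \<omega>)"
    unfolding strict_mono_Suc_iff using assms(1) by (simp add: walk_def)
  show "0 < walk E (Suc n) \<omega>" for n
    unfolding walk_def using assms(1) by (intro sum_pos) auto
  show "filterlim (\<lambda>n. walk E (Suc n) \<omega>) at_top sequentially"
    using filterlim_compose[OF assms(2) filterlim_Suc] .
qed

text \<open>With the path of \<open>Z\<close> frozen, only the Poisson points are random. Deaths
  contribute a constant factor, and the marks contribute a Poisson generating function at the levels
  \<open>clock s\<close>, which \<open>exp_integral_step_weight\<close> rewrites as a product over
  individuals.\<close>

lemma (in prob_space) nn_integral_path_count:
  assumes pop: "population B b d"
    and E_ind: "indep_vars (\<lambda>_. borel) E UNIV" and E_dist: "\<And>i. distributed M lborel (E i) (exponential_density 1)"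
    and N: "AE \<omega> in M. \<forall>a\<ge>0. N a \<omega> = card {n. walk E (Suc n) \<omega> \<le> a}"
    and z: "\<And>s. 0 \<le> s \<Longrightarrow> z (s / 2) = population.size_at B b d s"
    and J: "finite J" and q: "\<And>s. 0 \<le> q s \<and> q s \<le> (1::real)" and T: "\<And>s. s \<in> J \<Longrightarrow> s < T"
  defines "f \<equiv> step_weight J (\<lambda>s. s) q"
  shows "(\<integral>\<^sup>+\<omega>. ennreal (\<Prod>s\<in>J. q s ^ path_count z (\<lambda>a. N a \<omega>) s) \<partial>M) =
    ennreal (\<Prod>u\<in>B. f (d u) * exp (killing_rate.hazard f T (d u) - killing_rate.hazard f T (b u)))"
proof -
  interpret population B b d by (rule pop)
  have f: "0 \<le> f x" for x unfolding f_def step_weight_def using q by (intro prod_nonneg) auto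
  let ?c = "\<Prod>u\<in>B. f (d u)"
  have "AE \<omega> in M. walk E (Suc n) \<omega> \<noteq> clock (d u)" for n u
  proof -
    have "AE \<omega> in M. (\<Sum>i\<in>{..n}. 1 * E i \<omega>) \<noteq> clock (d u)"
      by (rule AE_linear_combination_neq[where X = E and i = n and c = "\<lambda>_. 1", OF E_ind _ _ _ _ E_dist]) auto
    then show ?thesis by eventually_elim (simp add: walk_def lessThan_Suc_atMost)
  qed
  then have "AE \<omega> in M. \<forall>u\<in>B. \<forall>n. walk E (Suc n) \<omega> \<noteq> clock (d u)"
    using finite_B by (simp add: AE_ball_countable countable_finite AE_all_countable)
  then have "AE \<omega> in M. (\<Prod>s\<in>J. q s ^ path_count z (\<lambda>a. N a \<omega>) s) = ?c * (\<Prod>s\<in>J. q s ^ card {n. walk E (Suc n) \<omega> \<le> clock s})"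
    using exponential_walk_at_top[OF E_ind E_dist] N
  proof eventually_elim
    case (elim \<omega>)
    interpret mp: marked_population B b d "\<lambda>n. walk E (Suc n) \<omega>"
      using elim by (intro marked_population_walk) auto
    have pc: "path_count z (\<lambda>a. N a \<omega>) s = card {u\<in>B. d u \<le> s} + card {n. walk E (Suc n) \<omega> \<le> clock s}" for s
    proof -
      have "path_count z (\<lambda>a. N a \<omega>) s = card (mp.events \<inter> {..s})"
        by (rule mp.path_count_eq) (use z elim in \<open>auto simp: mp.points_def\<close>)
      also have "\<dots> = card {u\<in>B. d u \<le> s} + mp.points (clock s)"
        by (rule mp.card_events) (use elim in auto)
      finally show ?thesis by (simp add: mp.points_def)
    qed
    have "(\<Prod>s\<in>J. q s ^ card {u\<in>B. d u \<le> s}) = (\<Prod>s\<in>J. \<Prod>u\<in>B. if d u \<le> s then q s else 1)"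
    proof (intro prod.cong refl)
      fix s
      have "(\<Prod>u\<in>B. if d u \<le> s then q s else 1) = (\<Prod>u\<in>{u\<in>B. d u \<le> s}. q s)"
        by (rule prod.inter_filter[symmetric]) (rule finite_B)
      then show "q s ^ card {u\<in>B. d u \<le> s} = (\<Prod>u\<in>B. if d u \<le> s then q s else 1)" by simp
    qed
    also have "\<dots> = ?c" unfolding f_def step_weight_def by (rule prod.swap)
    finally show ?case by (simp add: pc power_add prod.distrib)
  qed
  then have "(\<integral>\<^sup>+\<omega>. ennreal (\<Prod>s\<in>J. q s ^ path_count z (\<lambda>a. N a \<omega>) s) \<partial>M) =
    (\<integral>\<^sup>+\<omega>. ennreal ?c * ennreal (\<Prod>s\<in>J. q s ^ card {n. walk E (Suc n) \<omega> \<le> clock s}) \<partial>M)"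
    using f q by (intro nn_integral_cong_AE) (auto elim!: eventually_mono simp: ennreal_mult prod_nonneg)
  also have "\<dots> = ennreal ?c * (\<integral>\<^sup>+\<omega>. ennreal (\<Prod>s\<in>J. q s ^ card {n. walk E (Suc n) \<omega> \<le> clock s}) \<partial>M)"
  proof (rule nn_integral_cmult)
    have [measurable]: "E i \<in> borel_measurable M" for i
      using distributed_measurable[OF E_dist[of i]] by simp
    have [measurable]: "walk E n \<in> borel_measurable M" for n
      unfolding walk_def[abs_def] by measurable
    show "(\<lambda>\<omega>. ennreal (\<Prod>s\<in>J. q s ^ card {n. walk E (Suc n) \<omega> \<le> clock s})) \<in> borel_measurable M"
      by measurable
  qed
  also have "\<dots> = ennreal ?c * ennreal (exp (- integral {0..total_clock + 1} (\<lambda>y. 1 - step_weight J clock q y)))"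
  proof -
    have "clock s < total_clock + 1" for s using clock_le_total[of s] by linarith
    then show ?thesis by (subst poisson_pgf[OF E_ind E_dist J q]) auto
  qed
  also have "\<dots> = ennreal (?c * (\<Prod>u\<in>B. exp (killing_rate.hazard f T (d u) - killing_rate.hazard f T (b u))))"
    unfolding f_def by (subst exp_integral_step_weight[OF J q T]) (use f f_def in \<open>auto simp: ennreal_mult prod_nonneg\<close>)
  finally show ?thesis by (simp add: prod.distrib)
qed

section \<open>The branching process, conditioned on the path of \<open>Z\<close>\<close>

locale branching_with_marks = prob_space M for M :: "'b measure" +
  fixes Z N :: "real \<Rightarrow> 'b \<Rightarrow> nat" and L :: "indiv \<Rightarrow> 'b \<Rightarrow> real" and K :: "indiv \<Rightarrow> 'b \<Rightarrow> nat"
    and E :: "nat \<Rightarrow> 'b \<Rightarrow> real"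
  assumes L_dist: "distributed M lborel (L u) (exponential_density 2)"
    and K_dist: "distr M (count_space UNIV) (K u) = measure_pmf (pmf_of_set {0, 2})"
    and LK_indep: "indep_rv M borel (L u) (count_space UNIV) (K u)"
    and labels_indep: "indep_vars (\<lambda>_. borel \<Otimes>\<^sub>M count_space UNIV) (\<lambda>u \<omega>. (L u \<omega>, K u \<omega>)) UNIV"
    and start_indep: "indep_rv M (count_space UNIV) (Z 0)
          (\<Pi>\<^sub>M u\<in>UNIV. borel \<Otimes>\<^sub>M count_space UNIV) (\<lambda>\<omega> u. (L u \<omega>, K u \<omega>))"
    and Z_eq: "AE \<omega> in M. \<forall>t\<ge>0. Z t \<omega> = card (alive (Z 0 \<omega>) (\<lambda>u. L u \<omega>) (\<lambda>u. K u \<omega>) t)"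
    and start_law: "distr M (count_space UNIV) (Z 0) = measure_pmf (map_pmf of_bool (bernoulli_pmf (1 / 2)))"
    and E_indep: "indep_vars (\<lambda>_. borel) E UNIV"
    and E_dist: "distributed M lborel (E i) (exponential_density 1)"
    and N_eq: "AE \<omega> in M. \<forall>t\<ge>0. N t \<omega> = card {n. (\<Sum>i\<le>n. E i \<omega>) \<le> t}"
    and ZN_indep: "indep_processes M Z N"
begin

definition tree_of :: "'b \<Rightarrow> tree" where
  "tree_of \<omega> = family_tree (\<lambda>u. L u \<omega>) (\<lambda>u. K u \<omega>)"

definition paths :: "(real \<Rightarrow> nat) measure" where
  "paths = (\<Pi>\<^sub>M t\<in>{0..}. count_space UNIV)"

definition Z_path :: "'b \<Rightarrow> real \<Rightarrow> nat" where
  "Z_path \<omega> = (\<lambda>t\<in>{0..}. Z t \<omega>)"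

definition N_path :: "'b \<Rightarrow> real \<Rightarrow> nat" where
  "N_path \<omega> = (\<lambda>t\<in>{0..}. N t \<omega>)"

definition count_upto :: "real \<Rightarrow> 'b \<Rightarrow> nat" where
  "count_upto t \<omega> = path_count (Z_path \<omega>) (N_path \<omega>) t"

definition regular_start :: "'b \<Rightarrow> bool" where
  "regular_start \<omega> \<longleftrightarrow> Z 0 \<omega> \<le> 1 \<and> valid_tree (tree_of \<omega>) \<and> finite {w. tree_born (tree_of \<omega>) w} \<and>
     inj_on (death2 (tree_of \<omega>)) {w. tree_born (tree_of \<omega>) w} \<and>
     (\<forall>t\<ge>0. Z t \<omega> = card (alive (Z 0 \<omega>) (\<lambda>u. L u \<omega>) (\<lambda>u. K u \<omega>) t))"

lemma Z_path_measurable [measurable]: "Z_path \<in> M \<rightarrow>\<^sub>M paths"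
  and N_path_measurable [measurable]: "N_path \<in> M \<rightarrow>\<^sub>M paths"
  and paths_indep: "distr M paths Z_path \<Otimes>\<^sub>M distr M paths N_path = distr M (paths \<Otimes>\<^sub>M paths) (\<lambda>\<omega>. (Z_path \<omega>, N_path \<omega>))"
proof -
  have "indep_var paths Z_path paths N_path"
    using ZN_indep by (simp add: indep_processes_def paths_def Z_path_def[abs_def] N_path_def[abs_def])
  then show "Z_path \<in> M \<rightarrow>\<^sub>M paths" "N_path \<in> M \<rightarrow>\<^sub>M paths"
    "distr M paths Z_path \<Otimes>\<^sub>M distr M paths N_path = distr M (paths \<Otimes>\<^sub>M paths) (\<lambda>\<omega>. (Z_path \<omega>, N_path \<omega>))"
    by (auto simp: indep_var_distribution_eq)
qed

lemma path_count_measurable [measurable]: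
  "(\<lambda>p. path_count (fst p) (snd p) t) \<in> paths \<Otimes>\<^sub>M paths \<rightarrow>\<^sub>M count_space UNIV"
  unfolding paths_def by (rule measurable_path_count)

lemma count_upto_measurable [measurable]: "count_upto t \<in> M \<rightarrow>\<^sub>M count_space UNIV"
proof -
  have "(\<lambda>\<omega>. (Z_path \<omega>, N_path \<omega>)) \<in> M \<rightarrow>\<^sub>M paths \<Otimes>\<^sub>M paths" by measurable
  from measurable_compose[OF this path_count_measurable] show ?thesis by (simp add: count_upto_def[abs_def])
qed

lemma
  shows tree_of_measurable [measurable]: "tree_of \<in> M \<rightarrow>\<^sub>M tree_space"
    and distr_tree_of: "distr M tree_space tree_of = tree_law"
    and distr_start_tree: "distr M (count_space UNIV \<Otimes>\<^sub>M tree_space) (\<lambda>\<omega>. (Z 0 \<omega>, tree_of \<omega>)) =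
      distr M (count_space UNIV) (Z 0) \<Otimes>\<^sub>M tree_law"
proof -
  let ?S = "(\<Pi>\<^sub>M u\<in>UNIV. node_space) :: (indiv \<Rightarrow> real \<times> nat) measure"
  let ?Y = "\<lambda>\<omega> u. (L u \<omega>, K u \<omega>)" and ?\<phi> = "\<lambda>y w. y (0, w)"
  note * = distr_family_tree[OF L_dist K_dist LK_indep labels_indep]
  have Y [measurable]: "?Y \<in> M \<rightarrow>\<^sub>M ?S" and \<phi> [measurable]: "?\<phi> \<in> ?S \<rightarrow>\<^sub>M tree_space"
    using *(1,2) by auto
  have tr: "tree_of \<omega> = ?\<phi> (?Y \<omega>)" for \<omega>
    by (simp add: tree_of_def family_tree_def fun_eq_iff)
  show m [measurable]: "tree_of \<in> M \<rightarrow>\<^sub>M tree_space"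
    using measurable_compose[OF Y \<phi>] by (simp add: tr[abs_def])
  have d: "distr (distr M ?S ?Y) tree_space ?\<phi> = distr M tree_space tree_of"
    by (subst distr_distr[OF \<phi> Y]) (simp add: comp_def tr[abs_def])
  show law: "distr M tree_space tree_of = tree_law"
    using *(3) d by simp
  have ind: "indep_rv M (count_space UNIV) (Z 0) ?S ?Y"
    using start_indep by (simp add: node_space_def)
  have [measurable]: "Z 0 \<in> M \<rightarrow>\<^sub>M count_space UNIV" using ind by (simp add: indep_rv_def)
  have ind': "indep_rv M (count_space UNIV) (Z 0) tree_space tree_of"
    unfolding indep_rv_def
  proof (intro conjI)
    \<comment> \<open>Events of the tree are events of the full label array, so independence from
      \<open>Z 0\<close> passes to this smaller family.\<close>
    have sub: "{tree_of -` B \<inter> space M |B. B \<in> sets tree_space} \<subseteq> {?Y -` B \<inter> space M |B. B \<in> sets ?S}"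
    proof safe
      fix B assume B: "B \<in> sets tree_space"
      have "tree_of -` B \<inter> space M = ?Y -` (?\<phi> -` B \<inter> space ?S) \<inter> space M"
        using measurable_space[OF Y] by (auto simp: tr)
      then show "\<exists>B'. tree_of -` B \<inter> space M = ?Y -` B' \<inter> space M \<and> B' \<in> sets ?S"
        using measurable_sets[OF \<phi> B] by blast
    qed
    have "indep_set {Z 0 -` A \<inter> space M |A. A \<in> sets (count_space UNIV)} {?Y -` B \<inter> space M |B. B \<in> sets ?S}"
      using ind by (simp add: indep_rv_def)
    then have "indep_sets (case_bool {Z 0 -` A \<inter> space M |A. A \<in> sets (count_space UNIV)} {?Y -` B \<inter> space M |B. B \<in> sets ?S}) UNIV"
      by (simp only: indep_set_def)
    then have "indep_sets (case_bool {Z 0 -` A \<inter> space M |A. A \<in> sets (count_space UNIV)} {tree_of -` B \<inter> space M |B. B \<in> sets tree_space}) UNIV"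
    proof (rule indep_sets_mono_sets)
      fix i :: bool
      show "case_bool {Z 0 -` A \<inter> space M |A. A \<in> sets (count_space UNIV)} {tree_of -` B \<inter> space M |B. B \<in> sets tree_space} i \<subseteq>
        case_bool {Z 0 -` A \<inter> space M |A. A \<in> sets (count_space UNIV)} {?Y -` B \<inter> space M |B. B \<in> sets ?S} i"
        using sub by (cases i) (simp_all only: bool.case order.refl)
    qed
    then show "indep_set {Z 0 -` A \<inter> space M |A. A \<in> sets (count_space UNIV)} {tree_of -` B \<inter> space M |B. B \<in> sets tree_space}"
      by (simp only: indep_set_def)
  qed measurable
  show "distr M (count_space UNIV \<Otimes>\<^sub>M tree_space) (\<lambda>\<omega>. (Z 0 \<omega>, tree_of \<omega>)) = distr M (count_space UNIV) (Z 0) \<Otimes>\<^sub>M tree_law"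
    using indep_rv_distr[OF ind'] law by simp
qed

lemma Z0_measurable [measurable]: "Z 0 \<in> M \<rightarrow>\<^sub>M count_space UNIV"
  using start_indep by (simp add: indep_rv_def)

lemma AE_regular_start: "AE \<omega> in M. regular_start \<omega>"
proof -
  have "AE x in distr M tree_space tree_of. valid_tree x \<and> finite {w. tree_born x w}"
    unfolding distr_tree_of using AE_valid_tree AE_finite_tree by eventually_elim simp
  then have 1: "AE \<omega> in M. valid_tree (tree_of \<omega>) \<and> finite {w. tree_born (tree_of \<omega>) w}"
    by (rule AE_distrD[OF tree_of_measurable])
  have "AE k in distr M (count_space UNIV) (Z 0). k \<le> 1"
    unfolding start_law by (auto simp: AE_measure_pmf_iff set_map_pmf)
  then have 2: "AE \<omega> in M. Z 0 \<omega> \<le> 1" by (rule AE_distrD[OF Z0_measurable])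
  have L_ind: "indep_vars (\<lambda>_. borel) L UNIV"
    using indep_vars_compose2[OF labels_indep, of "\<lambda>_. fst" "\<lambda>_. borel"] by simp
  have "AE \<omega> in M. \<forall>w w'. w \<noteq> w' \<longrightarrow> death2 (tree_of \<omega>) w \<noteq> death2 (tree_of \<omega>) w'"
    unfolding AE_all_countable tree_of_def
  proof (intro allI)
    fix w w' :: "nat list"
    show "AE \<omega> in M. w \<noteq> w' \<longrightarrow> death2 (family_tree (\<lambda>u. L u \<omega>) (\<lambda>u. K u \<omega>)) w \<noteq> death2 (family_tree (\<lambda>u. L u \<omega>) (\<lambda>u. K u \<omega>)) w'"
      using AE_distinct_deaths[OF L_ind L_dist, of w w' K] by (cases "w = w'") auto
  qed
  then show ?thesis
    using 1 2 Z_eq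
  proof eventually_elim
    case (elim \<omega>)
    have "inj_on (death2 (tree_of \<omega>)) {w. tree_born (tree_of \<omega>) w}"
      by (rule inj_onI) (use elim(1) in blast)
    then show ?case unfolding regular_start_def using elim by blast
  qed
qed

lemma regular_startD:
  assumes "regular_start \<omega>"
  shows "Z 0 \<omega> \<le> 1" "valid_tree (tree_of \<omega>)" "finite {w. tree_born (tree_of \<omega>) w}"
    "inj_on (death2 (tree_of \<omega>)) {w. tree_born (tree_of \<omega>) w}"
    "0 \<le> t \<Longrightarrow> Z t \<omega> = card (alive (Z 0 \<omega>) (\<lambda>u. L u \<omega>) (\<lambda>u. K u \<omega>) t)"
  using assms unfolding regular_start_def by blast+

lemma regular_population:
  assumes "regular_start \<omega>"
  defines "B \<equiv> population_set (Z 0 \<omega>) (tree_of \<omega>)"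
  shows "population B (birth2 (tree_of \<omega>)) (death2 (tree_of \<omega>))"
    and "0 \<le> s \<Longrightarrow> Z (s / 2) \<omega> = population.size_at B (birth2 (tree_of \<omega>)) (death2 (tree_of \<omega>)) s"
proof -
  show pop: "population B (birth2 (tree_of \<omega>)) (death2 (tree_of \<omega>))"
    unfolding B_def by (intro population_population_set regular_startD assms(1))
  show "Z (s / 2) \<omega> = population.size_at B (birth2 (tree_of \<omega>)) (death2 (tree_of \<omega>)) s" if "0 \<le> s"
  proof -
    have "Z (s / 2) \<omega> = card (alive (Z 0 \<omega>) (\<lambda>u. L u \<omega>) (\<lambda>u. K u \<omega>) (s / 2))"
      by (rule regular_startD(5)[OF assms(1)]) (use that in simp)
    also have "\<dots> = card {w\<in>B. birth2 (tree_of \<omega>) w \<le> 2 * (s / 2) \<and> 2 * (s / 2) < death2 (tree_of \<omega>) w}"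
      unfolding tree_of_def B_def by (rule card_alive[OF regular_startD(1)[OF assms(1)]])
    also have "\<dots> = population.size_at B (birth2 (tree_of \<omega>)) (death2 (tree_of \<omega>)) s"
      by (simp add: population.size_at_def[OF pop])
    finally show ?thesis .
  qed
qed

lemma N_eq_walk: "AE \<omega> in M. \<forall>a\<ge>0. N a \<omega> = card {n. walk E (Suc n) \<omega> \<le> a}"
  using N_eq by (simp add: walk_def lessThan_Suc_atMost)

lemma AE_event_times:
  "AE \<omega> in M. finite (event_times Z N \<omega>) \<and> event_times Z N \<omega> \<subseteq> {0<..} \<and>
     (\<forall>t. count_upto t \<omega> = card (event_times Z N \<omega> \<inter> {..t})) \<and> event_seq Z N \<omega> = ordered_seq (event_times Z N \<omega>)"
  using AE_regular_start N_eq_walk exponential_walk_at_top[OF E_indep E_dist]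
proof eventually_elim
  case (elim \<omega>)
  note pop = regular_population[OF elim(1)]
  interpret population "population_set (Z 0 \<omega>) (tree_of \<omega>)" "birth2 (tree_of \<omega>)" "death2 (tree_of \<omega>)"
    by (rule pop(1))
  interpret mp: marked_population "population_set (Z 0 \<omega>) (tree_of \<omega>)" "birth2 (tree_of \<omega>)" "death2 (tree_of \<omega>)" "\<lambda>n. walk E (Suc n) \<omega>"
    using elim by (intro marked_population_walk) auto
  have N: "N a \<omega> = mp.points a" if "0 \<le> a" for a using elim that by (simp add: mp.points_def)
  have et: "event_times Z N \<omega> = mp.events" by (rule mp.event_times_eq) (use pop N in auto)
  have "count_upto t \<omega> = card (mp.events \<inter> {..t})" for t
    unfolding count_upto_def by (rule mp.path_count_eq) (use pop N in \<open>auto simp: Z_path_def N_path_def\<close>)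
  moreover have "event_seq Z N \<omega> = ordered_seq (event_times Z N \<omega>)"
    by (simp add: event_seq_def ordered_seq_def event_count_def event_time_def fin_seq_def fun_eq_iff)
  ultimately show ?case unfolding et using mp.finite_events mp.events_pos by auto
qed

text \<open>Independence of the two paths lets \<open>N\<close> be resampled for each fixed
  \<open>Z\<close>. The inner expectation becomes the tree weight, or 1 without an initial
  individual, and the outer one averages over a Bernoulli start independent of a tree with law
  \<open>tree_law\<close>.\<close>

lemma nn_integral_count_upto:
  assumes J: "finite J" and q: "\<And>s. 0 \<le> q s \<and> q s \<le> (1::real)"
  shows "(\<integral>\<^sup>+\<omega>. ennreal (\<Prod>s\<in>J. q s ^ count_upto s \<omega>) \<partial>M) = ennreal (excursion_functional (step_weight J (\<lambda>s. s) q) 0)"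
proof -
  \<comment> \<open>The inserted 0 keeps \<open>T\<close> nonnegative for empty \<open>J\<close> or
    negative levels; the \<open>+ 1\<close> puts all levels strictly below it.\<close>
  define T where "T = Max (insert 0 J) + 1"
  have le_Max: "s \<le> Max (insert 0 J)" if "s \<in> insert 0 J" for s
    using that J by (intro Max_ge) auto
  have T: "s < T" if "s \<in> J" for s using le_Max[of s] that by (simp add: T_def)
  have T0: "0 \<le> T" using le_Max[of 0] by (simp add: T_def)
  let ?f = "step_weight J (\<lambda>s. s) q"
  interpret killing_rate ?f J T
    using killing_rate_step_weight[of J q "\<lambda>s. s" T] J q T by simp
  define H where "H z x = (if z = 0 then 1 else tree_weight x)" for z :: nat and x
  have [measurable]: "(\<lambda>p. H (fst p) (snd p)) \<in> borel_measurable (count_space UNIV \<Otimes>\<^sub>M tree_space)"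
    unfolding H_def by measurable
  interpret NP: prob_space "distr M paths N_path" by (rule prob_space_distr) measurable
  interpret TL: prob_space tree_law by (rule prob_space_tree_law)
  let ?\<Phi> = "\<lambda>p. ennreal (\<Prod>s\<in>J. q s ^ path_count (fst p) (snd p) s)"
  have \<Phi> [measurable]: "?\<Phi> \<in> borel_measurable (paths \<Otimes>\<^sub>M paths)" by measurable
  have "(\<integral>\<^sup>+\<omega>. ennreal (\<Prod>s\<in>J. q s ^ count_upto s \<omega>) \<partial>M) = (\<integral>\<^sup>+p. ?\<Phi> p \<partial>distr M (paths \<Otimes>\<^sub>M paths) (\<lambda>\<omega>. (Z_path \<omega>, N_path \<omega>)))"
    by (subst nn_integral_distr) (auto simp: count_upto_def)
  also have "\<dots> = (\<integral>\<^sup>+z. \<integral>\<^sup>+n. ?\<Phi> (z, n) \<partial>distr M paths N_path \<partial>distr M paths Z_path)"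
    unfolding paths_indep[symmetric] by (rule NP.nn_integral_fst[symmetric]) measurable
  also have "\<dots> = (\<integral>\<^sup>+\<omega>. \<integral>\<^sup>+n. ?\<Phi> (Z_path \<omega>, n) \<partial>distr M paths N_path \<partial>M)"
    by (rule nn_integral_distr) measurable
  also have "\<dots> = (\<integral>\<^sup>+\<omega>. H (Z 0 \<omega>) (tree_of \<omega>) \<partial>M)"
  proof (rule nn_integral_cong_AE)
    show "AE \<omega> in M. (\<integral>\<^sup>+n. ?\<Phi> (Z_path \<omega>, n) \<partial>distr M paths N_path) = H (Z 0 \<omega>) (tree_of \<omega>)"
      using AE_regular_start AE_space
    proof eventually_elim
      case (elim \<omega>)
      note pop = regular_population[OF elim(1)]
      have "Z_path \<omega> \<in> space paths" using elim(2) by (rule measurable_space[OF Z_path_measurable])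
      then have "(\<lambda>n. ?\<Phi> (Z_path \<omega>, n)) \<in> borel_measurable paths"
        by (rule measurable_Pair2[OF \<Phi>])
      then have "(\<integral>\<^sup>+n. ?\<Phi> (Z_path \<omega>, n) \<partial>distr M paths N_path) = (\<integral>\<^sup>+\<omega>'. ?\<Phi> (Z_path \<omega>, N_path \<omega>') \<partial>M)"
        by (intro nn_integral_distr N_path_measurable) simp
      also have "\<dots> = (\<integral>\<^sup>+\<omega>'. ennreal (\<Prod>s\<in>J. q s ^ path_count (Z_path \<omega>) (\<lambda>a. N a \<omega>') s) \<partial>M)"
        by (intro nn_integral_cong arg_cong[where f = ennreal] prod.cong refl arg_cong2[where f = power])
           (auto simp: N_path_def intro!: path_count_cong)
      also have "\<dots> = ennreal (\<Prod>u\<in>population_set (Z 0 \<omega>) (tree_of \<omega>). ?f (death2 (tree_of \<omega>) u) *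
          exp (hazard (death2 (tree_of \<omega>) u) - hazard (birth2 (tree_of \<omega>) u)))"
        by (rule nn_integral_path_count[OF pop(1) E_indep E_dist N_eq_walk _ J q T])
           (use pop(2) in \<open>simp add: Z_path_def\<close>)
      also have "\<dots> = H (Z 0 \<omega>) (tree_of \<omega>)"
        using tree_weight_eq[OF regular_startD(2,3)[OF elim(1)]] by (simp add: H_def population_set_def death2_def birth2_def)
      finally show ?case .
    qed
  qed
  also have "\<dots> = (\<integral>\<^sup>+p. H (fst p) (snd p) \<partial>distr M (count_space UNIV \<Otimes>\<^sub>M tree_space) (\<lambda>\<omega>. (Z 0 \<omega>, tree_of \<omega>)))"
    by (subst nn_integral_distr) auto
  also have "\<dots> = (\<integral>\<^sup>+z. \<integral>\<^sup>+x. H z x \<partial>tree_law \<partial>measure_pmf (map_pmf of_bool (bernoulli_pmf (1 / 2))))"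
  proof -
    have "(\<lambda>p. H (fst p) (snd p)) \<in> borel_measurable (distr M (count_space UNIV) (Z 0) \<Otimes>\<^sub>M tree_law)"
      by measurable
    then show ?thesis
      unfolding distr_start_tree start_law[symmetric] by (subst TL.nn_integral_fst[symmetric]) auto
  qed
  also have "\<dots> = ennreal (1 / 2) * (\<integral>\<^sup>+x. H 1 x \<partial>tree_law) + ennreal (1 / 2) * (\<integral>\<^sup>+x. H 0 x \<partial>tree_law)"
    by (simp add: nn_integral_bernoulli_pmf mult.commute)
  also have "\<dots> = ennreal (1 / 2) + ennreal (1 / 2) * (\<integral>\<^sup>+x. tree_weight x \<partial>tree_law)"
    using TL.emeasure_space_1 by (simp add: H_def add.commute)
  also have "\<dots> = ennreal (excursion_functional ?f 0)"
    by (rule nn_integral_tree_weight[OF T0])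
  finally show ?thesis .
qed

end

theorem corollary4p1:
  fixes P :: "'a measure" and X :: "nat \<Rightarrow> 'a \<Rightarrow> real"
    and Q :: "'b measure" and Z N :: "real \<Rightarrow> 'b \<Rightarrow> nat"
  assumes "prob_space P"
    and "prob_space.indep_vars P (\<lambda>_. borel) X UNIV"
    and "\<And>i. distributed P lborel (X i) (\<lambda>x. ennreal (1 / 2 * exp (- \<bar>x\<bar>)))"
    and "prob_space Q"
    and "critical_binary_branching Q Z"
    and "distr Q (count_space UNIV) (Z 0) = measure_pmf (map_pmf of_bool (bernoulli_pmf (1 / 2)))"
    and "standard_poisson_process Q N"
    and "indep_processes Q Z N"
  shows "(AE \<omega> in P. (\<exists>k\<ge>1. walk X k \<omega> < 0) \<and> walk_order_stat X 0 \<omega> = 0 \<and>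
            (\<forall>k < walk_nu X \<omega>. walk_order_stat X k \<omega> < walk_order_stat X (Suc k) \<omega>)) \<and>
         (AE \<omega> in Q. finite (event_times Z N \<omega>)) \<and>
         same_law P (walk_seq X) Q (event_seq Z N) fin_seq_space \<and>
         (\<forall>z :: complex. z \<noteq> 0 \<and> norm z \<le> 1 \<longrightarrow>
            (LINT \<omega>|P. z ^ walk_nu X \<omega>) = inverse z * (1 - csqrt (1 - z)))"
proof -
  interpret P: prob_space P by fact
  interpret Q: prob_space Q by fact
  note X = assms(2,3)
  obtain L K where LK: "\<forall>u. distributed Q lborel (L u) (exponential_density 2)"
    "\<forall>u. distr Q (count_space UNIV) (K u) = measure_pmf (pmf_of_set {0, 2})"
    "\<forall>u. indep_rv Q borel (L u) (count_space UNIV) (K u)"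
    "Q.indep_vars (\<lambda>_. borel \<Otimes>\<^sub>M count_space UNIV) (\<lambda>u \<omega>. (L u \<omega>, K u \<omega>)) (UNIV :: indiv set)"
    "indep_rv Q (count_space UNIV) (Z 0) (\<Pi>\<^sub>M u\<in>UNIV. borel \<Otimes>\<^sub>M count_space UNIV) (\<lambda>\<omega> u. (L u \<omega>, K u \<omega>))"
    "AE \<omega> in Q. \<forall>t\<ge>0. Z t \<omega> = card (alive (Z 0 \<omega>) (\<lambda>u. L u \<omega>) (\<lambda>u. K u \<omega>) t)"
    using assms(5) unfolding critical_binary_branching_def by blast
  obtain E where E: "Q.indep_vars (\<lambda>_. borel) E UNIV" "\<forall>i. distributed Q lborel (E i) (exponential_density 1)"
    "AE \<omega> in Q. \<forall>t\<ge>0. N t \<omega> = card {n::nat. (\<Sum>i\<le>n. E i \<omega>) \<le> t}"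
    using assms(7) unfolding standard_poisson_process_def by blast
  interpret B: branching_with_marks Q Z N L K E
    by unfold_locales (use LK E assms(6,8) in auto)
  have "same_law P (walk_seq X) Q (event_seq Z N) fin_seq_space"
  proof (rule same_law_ordered_seqI[where C = "walk_count X" and D = B.count_upto and E = "walk_points X" and F = "event_times Z N"])
    show "AE \<omega> in P. finite (walk_points X \<omega>) \<and> walk_points X \<omega> \<subseteq> {0<..} \<and>
        (\<forall>t. walk_count X t \<omega> = card (walk_points X \<omega> \<inter> {..t})) \<and> walk_seq X \<omega> = ordered_seq (walk_points X \<omega>)"
      using P.AE_walk_order_stat[OF X] by eventually_elim blast
    show "(\<integral>\<^sup>+\<omega>. ennreal (\<Prod>t\<in>J. q t ^ walk_count X t \<omega>) \<partial>P) = (\<integral>\<^sup>+\<omega>. ennreal (\<Prod>t\<in>J. q t ^ B.count_upto t \<omega>) \<partial>Q)"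
      if "finite J" "\<And>i. 0 \<le> q i \<and> q i \<le> (1::real)" for J q
      using P.nn_integral_walk_count[OF X that] B.nn_integral_count_upto[OF that] by simp
  qed (use assms(1,4) P.measurable_walk_count[OF X] B.count_upto_measurable B.AE_event_times in auto)
  moreover have "AE \<omega> in P. (\<exists>k\<ge>1. walk X k \<omega> < 0) \<and> walk_order_stat X 0 \<omega> = 0 \<and>
            (\<forall>k < walk_nu X \<omega>. walk_order_stat X k \<omega> < walk_order_stat X (Suc k) \<omega>)"
    using P.AE_walk_order_stat[OF X]
  proof eventually_elim
    case (elim \<omega>)
    then obtain n where "walk X (Suc n) \<omega> < 0" by (auto simp: walk_excursion_def)
    then have "\<exists>k\<ge>1. walk X k \<omega> < 0" by (intro exI[of _ "Suc n"]) simp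
    then show ?case using elim by blast
  qed
  moreover have "AE \<omega> in Q. finite (event_times Z N \<omega>)"
    using B.AE_event_times by eventually_elim blast
  moreover have "(LINT \<omega>|P. z ^ walk_nu X \<omega>) = inverse z * (1 - csqrt (1 - z))" if "z \<noteq> 0" "norm z \<le> 1" for z :: complex
    by (rule P.walk_nu_pgf[OF X that])
  ultimately show ?thesis by blast
qed

end
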